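(* Any singular holomorphic foliation by curves on a Calabi-Yau manifold has a foliated affine structure.
   Context: A Calabi-Yau manifold is a compact Kähler manifold with trivial canonical bundle. A singular holomorphic foliation by curves $\mathcal{F}$ on $M$ is given by an open cover $\{U_i\}$ and holomorphic vector fields $Z_i$ on $U_i$ whose zero sets have codimension at least two, with $Z_i=g_{ij}Z_j$ on $U_i\cap U_j$ for nowhere vanishing holomorphic functions $g_{ij}$. The $Z_i$ generate the sheaf of sections of a line bundle $T_\mathcal{F}$, the tangent bundle of $\mathcal{F}$; $\mathrm{Sing}(\mathcal{F})$ is the common zero set of the $Z_i$. A foliated affine structure on $\mathcal{F}$ is an open cover $\{U_i\}$ of $M\setminus\mathrm{Sing}(\mathcal{F})$ with holomorphic submersions $\phi_i:U_i\to\mathbf{C}$ transverse to $\mathcal{F}$ (restricting to local biholomorphisms on leaves) such that along each leaf $L$ the changes of charts $(\phi_i|_L)\circ(\phi_j|_L)^{-1}$ are affine maps. Equivalently, it is a foliated connection on $T_\mathcal{F}$: an additive map $\nabla$ from local sections of $T_\mathcal{F}$ to holomorphic functions on $M$ with $\nabla(fZ)=Zf+f\nabla(Z)$. *)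

theory Defs
  imports "HOL-Analysis.Analysis"
begin

section \<open>Functions on open subsets of \<open>complex ^ 'n\<close>\<close>

text \<open>Holomorphic functions of several variables on an open set \<open>D\<close>: the real Frechet derivative
  exists and is complex linear.\<close>

definition sv_holomorphic_on :: "(complex ^ 'n::finite \<Rightarrow> complex) \<Rightarrow> (complex ^ 'n) set \<Rightarrow> bool" where
  "sv_holomorphic_on f D \<longleftrightarrow>
     (\<forall>z\<in>D. \<exists>L. (f has_derivative L) (at z) \<and> (\<forall>a v. L (a *s v) = a * L v))"

definition sv_holomorphic_map_on :: "(complex ^ 'n::finite \<Rightarrow> complex ^ 'k::finite) \<Rightarrow> (complex ^ 'n) set \<Rightarrow> bool" where
  "sv_holomorphic_map_on f D \<longleftrightarrow> (\<forall>i. sv_holomorphic_on (\<lambda>z. f z $ i) D)"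

text \<open>\<open>C\<^sup>k\<close> functions on an open set, via iterated directional derivatives.\<close>

fun Ck_on :: "nat \<Rightarrow> ('a::euclidean_space \<Rightarrow> 'b::real_normed_vector) \<Rightarrow> 'a set \<Rightarrow> bool" where
  "Ck_on 0 f D \<longleftrightarrow> continuous_on D f"
| "Ck_on (Suc k) f D \<longleftrightarrow>
     f differentiable_on D \<and> (\<forall>v. Ck_on k (\<lambda>x. frechet_derivative f (at x) v) D)"

definition smooth_fun_on :: "('a::euclidean_space \<Rightarrow> 'b::real_normed_vector) \<Rightarrow> 'a set \<Rightarrow> bool" where
  "smooth_fun_on f D \<longleftrightarrow> (\<forall>k. Ck_on k f D)"

text \<open>Exterior derivative of a 2-form on an open subset of a vector space, evaluated at \<open>z\<close> on the
  constant vector fields \<open>u\<close>, \<open>v\<close>, \<open>w\<close> (whose brackets vanish).\<close>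

definition ext_deriv2 ::
  "('a::euclidean_space \<Rightarrow> 'a \<Rightarrow> 'a \<Rightarrow> real) \<Rightarrow> 'a \<Rightarrow> 'a \<Rightarrow> 'a \<Rightarrow> 'a \<Rightarrow> real" where
  "ext_deriv2 \<omega> z u v w =
     frechet_derivative (\<lambda>x. \<omega> x v w) (at z) u
   - frechet_derivative (\<lambda>x. \<omega> x u w) (at z) v
   + frechet_derivative (\<lambda>x. \<omega> x u v) (at z) w"


section \<open>Complex manifolds\<close>

text \<open>The manifold is the whole of a Hausdorff type \<open>'m\<close>, of complex dimension \<open>CARD('n)\<close>. A chart
  is a pair of a domain and a coordinate map; values of the map off the domain are irrelevant.\<close>

type_synonym ('m, 'n) chart = "'m set \<times> ('m \<Rightarrow> complex ^ 'n)"

abbreviation dom_of :: "('m, 'n) chart \<Rightarrow> 'm set" where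
  "dom_of c \<equiv> fst c"

abbreviation coord :: "('m, 'n) chart \<Rightarrow> 'm \<Rightarrow> complex ^ 'n" where
  "coord c \<equiv> snd c"

abbreviation param :: "('m, 'n) chart \<Rightarrow> complex ^ 'n \<Rightarrow> 'm" where
  "param c \<equiv> inv_into (dom_of c) (coord c)"

definition is_chart :: "('m::t2_space, 'n::finite) chart \<Rightarrow> bool" where
  "is_chart c \<longleftrightarrow> open (dom_of c) \<and> open (coord c ` dom_of c) \<and>
     homeomorphism (dom_of c) (coord c ` dom_of c) (coord c) (param c)"

definition transition :: "('m, 'n) chart \<Rightarrow> ('m, 'n) chart \<Rightarrow> complex ^ 'n \<Rightarrow> complex ^ 'n" where
  "transition c c' = coord c' \<circ> param c"

definition holo_compatible :: "('m, 'n::finite) chart \<Rightarrow> ('m, 'n) chart \<Rightarrow> bool" where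
  "holo_compatible c c' \<longleftrightarrow>
     sv_holomorphic_map_on (transition c c') (coord c ` (dom_of c \<inter> dom_of c')) \<and>
     sv_holomorphic_map_on (transition c' c) (coord c' ` (dom_of c \<inter> dom_of c'))"

definition complex_atlas :: "('m::t2_space, 'n::finite) chart set \<Rightarrow> bool" where
  "complex_atlas A \<longleftrightarrow>
     (\<forall>c\<in>A. is_chart c) \<and> (\<forall>c\<in>A. \<forall>c'\<in>A. holo_compatible c c') \<and> (\<Union>c\<in>A. dom_of c) = UNIV"

text \<open>Charts of the maximal atlas containing \<open>A\<close>.\<close>

definition holo_chart :: "('m::t2_space, 'n::finite) chart set \<Rightarrow> ('m, 'n) chart \<Rightarrow> bool" where
  "holo_chart A c \<longleftrightarrow> is_chart c \<and> (\<forall>c'\<in>A. holo_compatible c c')"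

definition holo_fun_on :: "('m, 'n::finite) chart set \<Rightarrow> 'm set \<Rightarrow> ('m \<Rightarrow> complex) \<Rightarrow> bool" where
  "holo_fun_on A W f \<longleftrightarrow>
     (\<forall>c\<in>A. sv_holomorphic_on (f \<circ> param c) (coord c ` (dom_of c \<inter> W)))"

text \<open>Differential at \<open>p\<close> of the change of coordinates from \<open>c\<close> to \<open>c'\<close>.\<close>

definition change_diff ::
  "('m, 'n::finite) chart \<Rightarrow> ('m, 'n) chart \<Rightarrow> 'm \<Rightarrow> complex ^ 'n \<Rightarrow> complex ^ 'n" where
  "change_diff c c' p = frechet_derivative (transition c c') (at (coord c p))"

text \<open>A (1,0) vector field is given by its component vector in every chart of the atlas, with the
  usual transformation law; \<open>X c p\<close> is only meaningful for \<open>p\<close> in the domain of \<open>c\<close>.\<close>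

type_synonym ('m, 'n) vfield = "('m, 'n) chart \<Rightarrow> 'm \<Rightarrow> complex ^ 'n"

definition holo_vfield_on :: "('m, 'n::finite) chart set \<Rightarrow> 'm set \<Rightarrow> ('m, 'n) vfield \<Rightarrow> bool" where
  "holo_vfield_on A W X \<longleftrightarrow>
     (\<forall>c\<in>A. sv_holomorphic_map_on (X c \<circ> param c) (coord c ` (dom_of c \<inter> W))) \<and>
     (\<forall>c\<in>A. \<forall>c'\<in>A. \<forall>p \<in> dom_of c \<inter> dom_of c' \<inter> W. X c' p = change_diff c c' p (X c p))"

definition zero_set :: "('m, 'n::finite) chart set \<Rightarrow> 'm set \<Rightarrow> ('m, 'n) vfield \<Rightarrow> 'm set" where
  "zero_set A W X = {p\<in>W. \<forall>c\<in>A. p \<in> dom_of c \<longrightarrow> X c p = 0}"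


section \<open>Calabi-Yau manifolds\<close>

text \<open>\<open>h c p\<close> is the metric at \<open>p\<close> in the coordinates \<open>c\<close>: complex linear in the first and
  antilinear in the second argument.\<close>

type_synonym ('m, 'n) hmetric =
  "('m, 'n) chart \<Rightarrow> 'm \<Rightarrow> complex ^ 'n \<Rightarrow> complex ^ 'n \<Rightarrow> complex"

definition hermitian_metric :: "('m, 'n::finite) chart set \<Rightarrow> ('m, 'n) hmetric \<Rightarrow> bool" where
  "hermitian_metric A h \<longleftrightarrow>
     (\<forall>c\<in>A. \<forall>p\<in>dom_of c.
        (\<forall>a u v w. h c p (a *s u + v) w = a * h c p u w + h c p v w) \<and>
        (\<forall>u v. h c p v u = cnj (h c p u v)) \<and>
        (\<forall>v. v \<noteq> 0 \<longrightarrow> 0 < Re (h c p v v))) \<and>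
     (\<forall>c\<in>A. \<forall>u v. smooth_fun_on (\<lambda>z. h c (param c z) u v) (coord c ` dom_of c)) \<and>
     (\<forall>c\<in>A. \<forall>c'\<in>A. \<forall>p \<in> dom_of c \<inter> dom_of c'. \<forall>u v.
        h c' p (change_diff c c' p u) (change_diff c c' p v) = h c p u v)"

definition fundamental_form ::
  "('m, 'n) hmetric \<Rightarrow> ('m, 'n) chart \<Rightarrow> complex ^ 'n \<Rightarrow> complex ^ 'n \<Rightarrow> complex ^ 'n \<Rightarrow> real" where
  "fundamental_form h c z u v = - Im (h c (param c z) u v)"

definition kaehler :: "('m, 'n::finite) chart set \<Rightarrow> bool" where
  "kaehler A \<longleftrightarrow> (\<exists>h. hermitian_metric A h \<and>
     (\<forall>c\<in>A. \<forall>z \<in> coord c ` dom_of c. \<forall>u v w. ext_deriv2 (fundamental_form h c) z u v w = 0))"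

text \<open>The canonical bundle is described by the frames \<open>dz\<^sub>1 \<and> \<dots> \<and> dz\<^sub>n\<close> of the charts. Since
  \<open>dz'\<^sub>1 \<and> \<dots> \<and> dz'\<^sub>n = det (\<partial>z' / \<partial>z) dz\<^sub>1 \<and> \<dots> \<and> dz\<^sub>n\<close>, the coefficients \<open>s c\<close> of a section satisfy
  \<open>s c = det (\<partial>z' / \<partial>z) * s c'\<close>.\<close>

definition canonical_cocycle ::
  "('m, 'n::finite) chart \<Rightarrow> ('m, 'n) chart \<Rightarrow> 'm \<Rightarrow> complex" where
  "canonical_cocycle c c' p = det (matrix (change_diff c c' p))"

definition holo_line_bundle_section ::
  "('m, 'n::finite) chart set \<Rightarrow> (('m, 'n) chart \<Rightarrow> ('m, 'n) chart \<Rightarrow> 'm \<Rightarrow> complex) \<Rightarrow>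
   (('m, 'n) chart \<Rightarrow> 'm \<Rightarrow> complex) \<Rightarrow> bool" where
  "holo_line_bundle_section A g s \<longleftrightarrow>
     (\<forall>c\<in>A. holo_fun_on A (dom_of c) (s c)) \<and>
     (\<forall>c\<in>A. \<forall>c'\<in>A. \<forall>p \<in> dom_of c \<inter> dom_of c'. s c p = g c c' p * s c' p)"

definition trivial_line_bundle ::
  "('m, 'n::finite) chart set \<Rightarrow> (('m, 'n) chart \<Rightarrow> ('m, 'n) chart \<Rightarrow> 'm \<Rightarrow> complex) \<Rightarrow> bool" where
  "trivial_line_bundle A g \<longleftrightarrow>
     (\<exists>s. holo_line_bundle_section A g s \<and> (\<forall>c\<in>A. \<forall>p\<in>dom_of c. s c p \<noteq> 0))"

definition calabi_yau :: "('m::t2_space, 'n::finite) chart set \<Rightarrow> bool" where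
  "calabi_yau A \<longleftrightarrow>
     complex_atlas A \<and> compact (UNIV :: 'm set) \<and> kaehler A \<and> trivial_line_bundle A canonical_cocycle"


section \<open>Singular holomorphic foliations by curves\<close>

text \<open>\<open>S\<close> is near \<open>p\<close> a complex submanifold of codimension \<open>k\<close>.\<close>

definition regular_point_codim ::
  "('m::t2_space, 'n::finite) chart set \<Rightarrow> 'm set \<Rightarrow> 'm \<Rightarrow> nat \<Rightarrow> bool" where
  "regular_point_codim A S p k \<longleftrightarrow> p \<in> S \<and>
     (\<exists>c K. holo_chart A c \<and> p \<in> dom_of c \<and> card K = k \<and>
        S \<inter> dom_of c = {q \<in> dom_of c. \<forall>i\<in>K. coord c q $ i = 0})"

text \<open>For an analytic set \<open>S\<close>: as usual, its dimension is the largest dimension attained at its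
  regular points (which are dense in it).\<close>

definition analytic_codim_ge :: "('m::t2_space, 'n::finite) chart set \<Rightarrow> 'm set \<Rightarrow> nat \<Rightarrow> bool" where
  "analytic_codim_ge A S k \<longleftrightarrow> (\<forall>p j. regular_point_codim A S p j \<longrightarrow> k \<le> j)"

text \<open>The family \<open>(U\<^sub>i, Z\<^sub>i)\<close> is given as a set of pairs.\<close>

type_synonym ('m, 'n) foliation_data = "('m set \<times> ('m, 'n) vfield) set"

definition foliation :: "('m::t2_space, 'n::finite) chart set \<Rightarrow> ('m, 'n) foliation_data \<Rightarrow> bool" where
  "foliation A F \<longleftrightarrow>
     (\<Union>(U, Z)\<in>F. U) = UNIV \<and>
     (\<forall>(U, Z)\<in>F. open U \<and> holo_vfield_on A U Z \<and> analytic_codim_ge A (zero_set A U Z) 2) \<and>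
     (\<forall>(U, Z)\<in>F. \<forall>(V, Y)\<in>F. \<exists>g. holo_fun_on A (U \<inter> V) g \<and>
        (\<forall>p \<in> U \<inter> V. g p \<noteq> 0 \<and> (\<forall>c\<in>A. p \<in> dom_of c \<longrightarrow> Z c p = g p *s Y c p)))"

definition sing :: "('m, 'n::finite) chart set \<Rightarrow> ('m, 'n) foliation_data \<Rightarrow> 'm set" where
  "sing A F = (\<Union>(U, Z)\<in>F. zero_set A U Z)"

text \<open>Immersed holomorphic discs in the complement of the singular set, tangent to the foliation.\<close>

definition tangent_disc ::
  "('m::t2_space, 'n::finite) chart set \<Rightarrow> ('m, 'n) foliation_data \<Rightarrow> (complex \<Rightarrow> 'm) \<Rightarrow> bool" where
  "tangent_disc A F \<gamma> \<longleftrightarrow>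
     continuous_on (ball 0 1) \<gamma> \<and> \<gamma> ` ball 0 1 \<inter> sing A F = {} \<and>
     (\<forall>c\<in>A. \<forall>i. (\<lambda>t. coord c (\<gamma> t) $ i) holomorphic_on {t \<in> ball 0 1. \<gamma> t \<in> dom_of c}) \<and>
     (\<forall>t \<in> ball 0 1. \<forall>(U, Z)\<in>F. \<forall>c\<in>A. \<gamma> t \<in> U \<inter> dom_of c \<longrightarrow>
        (\<exists>a. a \<noteq> 0 \<and> (\<forall>i. deriv (\<lambda>s. coord c (\<gamma> s) $ i) t = a * Z c (\<gamma> t) $ i)))"

text \<open>The leaf topology on the complement of the singular set is generated by the plaques, i.e. the
  injectively immersed tangent discs; the leaves are its connected components.\<close>

definition leaf_topology ::
  "('m::t2_space, 'n::finite) chart set \<Rightarrow> ('m, 'n) foliation_data \<Rightarrow> 'm topology" where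
  "leaf_topology A F =
     topology_generated_by {\<gamma> ` ball 0 1 | \<gamma>. tangent_disc A F \<gamma> \<and> inj_on \<gamma> (ball 0 1)}"

definition leaves :: "('m::t2_space, 'n::finite) chart set \<Rightarrow> ('m, 'n) foliation_data \<Rightarrow> 'm set set" where
  "leaves A F = connected_components_of (leaf_topology A F)"


section \<open>Foliated affine structures\<close>

text \<open>The differential at \<open>p\<close> of a function, in the coordinates \<open>c\<close>.\<close>

definition diff_at :: "('m, 'n::finite) chart \<Rightarrow> ('m \<Rightarrow> complex) \<Rightarrow> 'm \<Rightarrow> complex ^ 'n \<Rightarrow> complex" where
  "diff_at c f p = frechet_derivative (f \<circ> param c) (at (coord c p))"

definition holo_submersion_on ::
  "('m, 'n::finite) chart set \<Rightarrow> 'm set \<Rightarrow> ('m \<Rightarrow> complex) \<Rightarrow> bool" where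
  "holo_submersion_on A U f \<longleftrightarrow> holo_fun_on A U f \<and>
     (\<forall>p\<in>U. \<forall>c\<in>A. p \<in> dom_of c \<longrightarrow> surj (diff_at c f p))"

text \<open>The kernel of the differential is transverse to the tangent line of the foliation.\<close>

definition transverse_on ::
  "('m, 'n::finite) chart set \<Rightarrow> ('m, 'n) foliation_data \<Rightarrow> 'm set \<Rightarrow> ('m \<Rightarrow> complex) \<Rightarrow> bool" where
  "transverse_on A F U f \<longleftrightarrow>
     (\<forall>p\<in>U. \<forall>(V, Z)\<in>F. \<forall>c\<in>A. p \<in> V \<inter> dom_of c \<longrightarrow> diff_at c f p (Z c p) \<noteq> 0)"

text \<open>The change of charts \<open>(\<phi>|\<^sub>L) \<circ> (\<psi>|\<^sub>L)\<inverse>\<close> is defined on \<open>\<psi> ` W\<close> for every \<open>W\<close> open in the leaf on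
  which \<open>\<psi>\<close> is injective. Its affine expression is constant only on connected \<open>W\<close>.\<close>

definition affine_change_on ::
  "('m::t2_space, 'n::finite) chart set \<Rightarrow> ('m, 'n) foliation_data \<Rightarrow>
   'm set \<Rightarrow> 'm set \<times> ('m \<Rightarrow> complex) \<Rightarrow> 'm set \<times> ('m \<Rightarrow> complex) \<Rightarrow> bool" where
  "affine_change_on A F L = (\<lambda>(U, \<phi>) (V, \<psi>).
     \<forall>W. openin (leaf_topology A F) W \<and> connectedin (leaf_topology A F) W \<and>
         W \<subseteq> L \<inter> U \<inter> V \<and> inj_on \<psi> W \<longrightarrow>
       (\<exists>a b. a \<noteq> 0 \<and> (\<forall>z \<in> \<psi> ` W. (\<phi> \<circ> inv_into W \<psi>) z = a * z + b)))"

definition foliated_affine_structure ::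
  "('m::t2_space, 'n::finite) chart set \<Rightarrow> ('m, 'n) foliation_data \<Rightarrow>
   ('m set \<times> ('m \<Rightarrow> complex)) set \<Rightarrow> bool" where
  "foliated_affine_structure A F \<Phi> \<longleftrightarrow>
     (\<Union>(U, \<phi>)\<in>\<Phi>. U) = - sing A F \<and>
     (\<forall>(U, \<phi>)\<in>\<Phi>. open U \<and> holo_submersion_on A U \<phi> \<and> transverse_on A F U \<phi>) \<and>
     (\<forall>L\<in>leaves A F. \<forall>c\<in>\<Phi>. \<forall>d\<in>\<Phi>. affine_change_on A F L c d)"

end

theory Submission
  imports Defs "HOL-Complex_Analysis.Conformal_Mappings"
begin

text \<open>Let \<open>s\<close> be a holomorphic volume form. Near a regular point choose independent first integrals
  \<open>f\<^sub>2, \<dots>, f\<^sub>n\<close> of the foliation. Contracting \<open>d\<phi> \<and> df\<^sub>2 \<and> \<dots> \<and> df\<^sub>n = s\<close> with a generator \<open>Z\<close> turns this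
  equation for \<open>\<phi>\<close> into a linear transport equation \<open>Z\<phi> = \<kappa>\<close>, which has a holomorphic solution. These \<open>\<phi>\<close>
  are the affine charts: a change \<open>(\<phi>, f) \<mapsto> (\<phi>', f')\<close> has Jacobian determinant \<open>1\<close> and \<open>f'\<close> depends on \<open>f\<close>
  only, so \<open>\<partial>\<phi>' / \<partial>\<phi>\<close> depends on \<open>f\<close> only and is constant along the leaves. In terms of connections, \<open>\<nabla>Z\<close>
  is the divergence of \<open>Z\<close> with respect to \<open>s\<close>.\<close>

section \<open>Holomorphic functions of several variables\<close>

text \<open>No flow straightens the foliation: the first integrals and the affine coordinate both
  come from one theorem on linear transport equations
  \<open>\<Sum>\<^sub>j a\<^sub>j \<partial>\<^sub>j u = d\<close> with
  \<open>a\<^sub>k = 1\<close>. The form \<open>a\<^sub>k = 1\<close> is reached by dividing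
  \<open>Z\<close> by a component that is nonzero at the base point, and \<open>\<kappa>\<close> is
  the quotient of \<open>s\<close> by the Jacobian determinant of \<open>(z\<^sub>k, f)\<close>.
  Solving the equation by iteration loses a derivative at every step, and only estimates for
  holomorphic functions compensate for this; hence the function theory of several variables that
  comes before it. The second obstacle is the passage from local to leafwise statements. Two charts
  are compared near a point of the manifold, whereas a single affine expression is required on every
  leafwise open connected set on which the inverted chart is injective, and such a set may return to
  the same neighbourhood many times. The local expressions are patched along the leaf, which works
  because injectivity makes their coefficients unique.\<close>

definition partial :: "'n::finite \<Rightarrow> (complex ^ 'n \<Rightarrow> complex) \<Rightarrow> complex ^ 'n \<Rightarrow> complex" where
  "partial j f z = deriv (\<lambda>t. f (z + axis j t)) 0"

text \<open>Holomorphy in Osgood's form. It is the convenient form for integrals and limits, since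
  each variable is then handled by one-variable theorems; on open sets it agrees with
  \<open>sv_holomorphic_on\<close>.\<close>

definition sep_holomorphic_on :: "(complex ^ 'n::finite \<Rightarrow> complex) \<Rightarrow> (complex ^ 'n) set \<Rightarrow> bool" where
  "sep_holomorphic_on f D \<longleftrightarrow> continuous_on D f \<and>
     (\<forall>z\<in>D. \<forall>j. (\<lambda>t. f (z + axis j t)) field_differentiable at 0)"

section \<open>Calculus along the coordinate axes\<close>

lemma norm_axis [simp]: "norm (axis j x :: 'a::real_normed_vector ^ 'n::finite) = norm x"
proof -
  have "L2_set (\<lambda>i. norm ((axis j x :: 'a ^ 'n) $ i)) UNIV = sqrt (\<Sum>i\<in>UNIV. if i = j then (norm x)\<^sup>2 else 0)"
    unfolding L2_set_def by (intro arg_cong[where f = sqrt] sum.cong) (auto simp: axis_def)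
  then show ?thesis by (simp add: norm_vec_def)
qed

lemma axis_add: "axis j (x + y) = axis j x + (axis j y :: 'a::monoid_add ^ 'n::finite)"
  by (simp add: vec_eq_iff axis_def)

lemma axis_scaleR: "axis j (r *\<^sub>R x) = r *\<^sub>R (axis j x :: 'a::real_vector ^ 'n::finite)"
  by (simp add: vec_eq_iff axis_def)

lemma axis_vector_scalar: "axis j (a * x) = a *s (axis j x :: 'a::semiring_0 ^ 'n::finite)"
  by (simp add: vec_eq_iff axis_def)

lemma axis_zero [simp]: "axis j 0 = (0 :: 'a::zero ^ 'n::finite)"
  by (simp add: vec_eq_iff axis_def)

lemma axis_diff: "axis j (x - y) = axis j x - (axis j y :: 'a::group_add ^ 'n::finite)"
  by (simp add: vec_eq_iff axis_def)

lemma bounded_linear_axis: "bounded_linear (axis j :: 'a::real_normed_vector \<Rightarrow> 'a ^ 'n::finite)"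
  by (rule bounded_linear_intro[where K = 1]) (simp_all add: axis_add axis_scaleR)

lemmas continuous_on_axis [continuous_intros] = bounded_linear.continuous_on [OF bounded_linear_axis]
lemmas has_derivative_axis [derivative_intros] = bounded_linear.has_derivative [OF bounded_linear_axis]

lemma has_derivative_along_axis:
  assumes "(f has_derivative L) (at (z + axis j t))" "\<And>a v. L (a *s v) = a * L v"
  shows "((\<lambda>t. f (z + axis j t)) has_field_derivative L (axis j 1)) (at t)"
proof -
  have "((\<lambda>t. f (z + axis j t)) has_derivative (\<lambda>h. L (axis j h))) (at t)"
    by (rule has_derivative_compose[where f = "\<lambda>t. z + axis j t", OF _ assms(1)])
       (auto intro!: derivative_eq_intros)
  moreover have "(\<lambda>h. L (axis j h)) = (*) (L (axis j 1))"
  proof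
    show "L (axis j h) = L (axis j 1) * h" for h
      using assms(2)[of h "axis j 1"] by (simp add: axis_vector_scalar[symmetric] mult.commute)
  qed
  ultimately show ?thesis unfolding has_field_derivative_def by metis
qed

lemma partial_eqI:
  assumes "((\<lambda>t. f (z + axis j t)) has_field_derivative d) (at 0)"
  shows "partial j f z = d"
  unfolding partial_def by (rule DERIV_imp_deriv[OF assms])

lemma sep_holomorphic_DERIV:
  assumes "sep_holomorphic_on f D" "z + axis j t \<in> D"
  shows "((\<lambda>t. f (z + axis j t)) has_field_derivative partial j f (z + axis j t)) (at t)"
proof -
  have "(\<lambda>s. f ((z + axis j t) + axis j s)) field_differentiable at 0"
    using assms unfolding sep_holomorphic_on_def by blast
  \<comment> \<open>The point 0 is written as \<open>t - t\<close> so that the chain rule matches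
    the shift \<open>s - t\<close>.\<close>
  then have "((\<lambda>s. f ((z + axis j t) + axis j s)) has_field_derivative partial j f (z + axis j t)) (at (t - t))"
    unfolding partial_def by (simp add: DERIV_deriv_iff_field_differentiable)
  then have "(((\<lambda>s. f ((z + axis j t) + axis j s)) \<circ> (\<lambda>s. s - t)) has_field_derivative partial j f (z + axis j t) * 1) (at t)"
    by (rule DERIV_chain) (auto intro!: derivative_eq_intros)
  then show ?thesis by (simp add: axis_diff o_def)
qed


section \<open>Cauchy's formula in one coordinate and Osgood's lemma\<close>

lemma sep_holomorphic_slice:
  assumes "sep_holomorphic_on f D" "\<And>t. t \<in> T \<Longrightarrow> z + axis j t \<in> D"
  shows "(\<lambda>t. f (z + axis j t)) holomorphic_on T"
  unfolding holomorphic_on_def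
proof
  fix t assume "t \<in> T"
  then have "((\<lambda>t. f (z + axis j t)) has_field_derivative partial j f (z + axis j t)) (at t within T)"
    by (rule has_field_derivative_at_within[OF sep_holomorphic_DERIV[OF assms]])
  then show "(\<lambda>t. f (z + axis j t)) field_differentiable at t within T"
    unfolding field_differentiable_def by blast
qed

text \<open>Expresses a derivative by values of \<open>f\<close> alone, over an interval that does
  not depend on \<open>z\<close>. Continuity and holomorphy of the derivative thus reduce to those
  of parameter integrals.\<close>

lemma partial_cauchy_integral:
  assumes f: "sep_holomorphic_on f D" and "0 < r" and D: "\<And>t. norm t \<le> r \<Longrightarrow> z + axis j t \<in> D"
  shows "partial j f z = 1 / (2 * of_real pi * \<i>) * integral {0..1} (\<lambda>x. f (z + axis j (circlepath 0 r x)) /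
           (circlepath 0 r x)\<^sup>2 * (2 * of_real pi * \<i> * of_real r * exp (2 * of_real pi * \<i> * of_real x)))"
proof -
  let ?g = "\<lambda>t. f (z + axis j t)"
  have "?g holomorphic_on cball 0 r"
    by (rule sep_holomorphic_slice[OF f]) (simp add: D)
  then have "continuous_on (cball 0 r) ?g" "?g holomorphic_on ball 0 r"
    by (auto intro: holomorphic_on_imp_continuous_on holomorphic_on_subset)
  then have "(?g has_field_derivative (1 / (2 * of_real pi * \<i>) *
      contour_integral (circlepath 0 r) (\<lambda>u. ?g u / (u - 0)^2))) (at 0)"
    using \<open>0 < r\<close> by (intro Cauchy_derivative_integral_circlepath) auto
  then have "partial j f z = 1 / (2 * of_real pi * \<i>) *
      contour_integral (circlepath 0 r) (\<lambda>u. ?g u / (u - 0)^2)"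
    by (rule partial_eqI)
  then show ?thesis
    by (simp add: contour_integral_integral vector_derivative_circlepath)
qed

lemma norm_partial_le:
  assumes f: "sep_holomorphic_on f D" and r: "0 < r" and D: "\<And>t. norm t \<le> r \<Longrightarrow> z + axis j t \<in> D"
    and B: "\<And>t. norm t = r \<Longrightarrow> norm (f (z + axis j t)) \<le> B"
  shows "norm (partial j f z) \<le> B / r"
proof -
  let ?g = "\<lambda>t. f (z + axis j t)"
  have "?g holomorphic_on cball 0 r"
    by (rule sep_holomorphic_slice[OF f]) (simp add: D)
  then have "continuous_on (cball 0 r) ?g" "?g holomorphic_on ball 0 r"
    by (auto intro: holomorphic_on_imp_continuous_on holomorphic_on_subset)
  then have "norm ((deriv ^^ 1) ?g 0) \<le> fact 1 * B / r ^ 1"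
    using r B by (intro Cauchy_inequality) auto
  then show ?thesis by (simp add: partial_def)
qed

lemma continuous_on_local_openI:
  assumes "\<And>x. x \<in> S \<Longrightarrow> \<exists>T. open T \<and> x \<in> T \<and> continuous_on (S \<inter> T) f"
  shows "continuous_on S f"
  unfolding continuous_on_def
proof
  fix x assume "x \<in> S"
  then obtain T where T: "open T" "x \<in> T" "continuous_on (S \<inter> T) f" using assms by blast
  then have "(f \<longlongrightarrow> f x) (at x within S \<inter> T)"
    using \<open>x \<in> S\<close> by (auto simp: continuous_on_def)
  moreover have "at x within S \<inter> T = at x within S"
    by (rule at_within_nhd[of x T]) (use T in auto)
  ultimately show "(f \<longlongrightarrow> f x) (at x within S)" by simp
qed

text \<open>Near a given point one radius serves for all circles in Cauchy's formula, so the
  derivative is locally a parameter integral with a jointly continuous integrand. Joint continuity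
  is what the Leibniz rule will ask for.\<close>

lemma continuous_on_partial_param:
  fixes F :: "'s::topological_space \<Rightarrow> complex ^ 'n::finite \<Rightarrow> complex"
  assumes D: "open D" and cont: "continuous_on (S \<times> D) (\<lambda>(s, z). F s z)"
    and hol: "\<And>s. s \<in> S \<Longrightarrow> sep_holomorphic_on (F s) D"
  shows "continuous_on (S \<times> D) (\<lambda>(s, z). partial j (F s) z)"
proof (rule continuous_on_local_openI)
  fix p assume "p \<in> S \<times> D"
  then obtain s0 z0 where p: "p = (s0, z0)" "s0 \<in> S" "z0 \<in> D" by auto
  obtain e where e: "0 < e" "ball z0 e \<subseteq> D" using D p(3) openE by blast
  \<comment> \<open>With half the radius, circles of radius \<open>r\<close> about points of
    \<open>ball z0 r\<close> stay in \<open>D\<close>.\<close>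
  define r where "r = e / 2"
  have r: "0 < r" using e by (simp add: r_def)
  have inD: "z + axis j t \<in> D" if "z \<in> ball z0 r" "norm t \<le> r" for z t
  proof -
    have "dist z0 (z + axis j t) \<le> dist z0 z + norm t"
      using dist_triangle[of z0 "z + axis j t" z] by (simp add: dist_norm)
    then have "z + axis j t \<in> ball z0 e" using that by (simp add: r_def)
    then show ?thesis using e by blast
  qed
  let ?G = "\<lambda>q x. F (fst q) (snd q + axis j (circlepath 0 r x)) /
           (circlepath 0 r x)\<^sup>2 * (2 * of_real pi * \<i> * of_real r * exp (2 * of_real pi * \<i> * of_real x))"
  have nz: "circlepath 0 r x \<noteq> 0" for x using r by (simp add: circlepath)
  have ncp: "norm (circlepath 0 r x) = r" for x
    using r by (simp add: circlepath norm_mult)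
  have contG: "continuous_on ((S \<times> ball z0 r) \<times> cbox 0 1) (\<lambda>(q, x). ?G q x)"
  proof -
    have "continuous_on ((S \<times> ball z0 r) \<times> cbox 0 1)
        (\<lambda>y. (\<lambda>(s, z). F s z) (fst (fst y), snd (fst y) + axis j (circlepath 0 r (snd y))))"
    proof (rule continuous_on_compose2[OF cont])
      show "continuous_on ((S \<times> ball z0 r) \<times> cbox 0 1)
         (\<lambda>y. (fst (fst y), snd (fst y) + axis j (circlepath 0 r (snd y))))"
        unfolding circlepath by (intro continuous_intros)
    qed (use inD ncp in auto)
    then have "continuous_on ((S \<times> ball z0 r) \<times> cbox 0 1) (\<lambda>y. ?G (fst y) (snd y))"
      using nz unfolding circlepath by (intro continuous_intros) (auto simp: case_prod_beta)
    then show ?thesis by (simp add: case_prod_beta)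
  qed
  have "continuous_on (S \<times> ball z0 r) (\<lambda>q. 1 / (2 * of_real pi * \<i>) * integral (cbox 0 1) (?G q))"
    by (intro continuous_intros integral_continuous_on_param contG)
  then have "continuous_on (S \<times> ball z0 r) (\<lambda>(s, z). partial j (F s) z)"
  proof (rule continuous_on_eq)
    fix q assume "q \<in> S \<times> ball z0 r"
    then show "1 / (2 * of_real pi * \<i>) * integral (cbox 0 1) (?G q) = (case q of (s, z) \<Rightarrow> partial j (F s) z)"
      using partial_cauchy_integral[OF hol r inD, of "fst q" "snd q"] by (auto simp: cbox_interval)
  qed
  then have "continuous_on (S \<times> D \<inter> UNIV \<times> ball z0 r) (\<lambda>(s, z). partial j (F s) z)"
    by (rule continuous_on_subset) auto
  then show "\<exists>T. open T \<and> p \<in> T \<and> continuous_on (S \<times> D \<inter> T) (\<lambda>(s, z). partial j (F s) z)"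
    using p r by (intro exI[of _ "UNIV \<times> ball z0 r"]) (auto intro: open_Times)
qed

lemma continuous_on_partial:
  assumes "open D" "sep_holomorphic_on f D"
  shows "continuous_on D (partial j f)"
proof -
  have "continuous_on D f" using assms(2) by (simp add: sep_holomorphic_on_def)
  \<comment> \<open>A one-point parameter set reduces the claim to the version with
    parameters.\<close>
  then have "continuous_on ({0::real} \<times> D) (\<lambda>y. f (snd y))"
    by (rule continuous_on_compose2) (auto intro: continuous_intros)
  then have "continuous_on ({0::real} \<times> D) (\<lambda>(s, z). partial j f z)"
    by (intro continuous_on_partial_param assms) (simp add: case_prod_beta)
  then have "continuous_on D (\<lambda>z. (\<lambda>(s, z). partial j f z) (0::real, z))"
    by (rule continuous_on_compose2) (auto intro: continuous_intros)
  then show ?thesis by simp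
qed

text \<open>Osgood's lemma. The coordinates in which the increment may be nonzero are added one at a
  time; each new one is handled by the mean value inequality on its axis, where continuity of the
  partial derivative, a consequence of Cauchy's formula, makes the error small.\<close>

lemma sep_holomorphic_has_derivative:
  fixes f :: "complex ^ 'n::finite \<Rightarrow> complex"
  assumes D: "open D" and f: "sep_holomorphic_on f D" and z: "z \<in> D"
  shows "(f has_derivative (\<lambda>h. \<Sum>j\<in>UNIV. h $ j * partial j f z)) (at z)"
proof -
  have main: "\<forall>e>0. \<exists>d>0. \<forall>h. norm h < d \<and> (\<forall>j. j \<notin> S \<longrightarrow> h $ j = 0) \<longrightarrow>
      norm (f (z + h) - f z - (\<Sum>j\<in>S. h $ j * partial j f z)) \<le> e * norm h" if "finite S" for S :: "'n set"
    using that
  proof (induction S rule: finite_induct)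
    case empty
    show ?case
    proof (intro allI impI exI[of _ 1] conjI)
      fix e :: real and h :: "complex ^ 'n"
      assume "norm h < 1 \<and> (\<forall>j. j \<notin> {} \<longrightarrow> h $ j = 0)"
      then have "h = 0" by (simp add: vec_eq_iff)
      show "norm (f (z + h) - f z - (\<Sum>j\<in>{}. h $ j * partial j f z)) \<le> e * norm h"
        unfolding \<open>h = 0\<close> by simp
    qed simp
  next
    case (insert k S)
    show ?case
    proof (intro allI impI)
      fix e :: real assume "0 < e"
      then obtain d1 where d1: "0 < d1" "\<And>h. norm h < d1 \<Longrightarrow> (\<forall>j. j \<notin> S \<longrightarrow> h $ j = 0) \<Longrightarrow>
          norm (f (z + h) - f z - (\<Sum>j\<in>S. h $ j * partial j f z)) \<le> e / 2 * norm h"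
        using insert.IH[rule_format, of "e / 2"] by auto
      have "continuous_on D (partial k f)" by (rule continuous_on_partial[OF D f])
      then have "isCont (partial k f) z" using D z continuous_on_eq_continuous_at by blast
      then obtain d2 where d2: "0 < d2" "\<And>w. dist w z < d2 \<Longrightarrow> dist (partial k f w) (partial k f z) < e / 2"
        using \<open>0 < e\<close> unfolding continuous_at_eps_delta by (metis half_gt_zero)
      obtain d3 where d3: "0 < d3" "ball z d3 \<subseteq> D" using D z openE by blast
      \<comment> \<open>Halved because \<open>h' + axis k t\<close> may be twice as long as
        \<open>h\<close>.\<close>
      define d where "d = min d1 (min d2 d3) / 2"
      have "0 < d" using d1 d2 d3 by (simp add: d_def)
      moreover have "norm (f (z + h) - f z - (\<Sum>j\<in>insert k S. h $ j * partial j f z)) \<le> e * norm h"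
        if h: "norm h < d" "\<forall>j. j \<notin> insert k S \<longrightarrow> h $ j = 0" for h
      proof -
        define h' where "h' = h - axis k (h $ k)"
        have h'j: "h' $ j = (if j = k then 0 else h $ j)" for j by (simp add: h'_def axis_def)
        have nh': "norm h' \<le> norm h" by (rule norm_le_componentwise_cart) (simp add: h'j)
        have hk: "norm (h $ k) \<le> norm h" by (rule Finite_Cartesian_Product.norm_nth_le)
        have near: "norm (h' + axis k t) < min d1 (min d2 d3)" if "norm t \<le> norm (h $ k)" for t
          using norm_triangle_ineq[of h' "axis k t"] that nh' hk h(1) by (simp add: d_def)
        \<comment> \<open>With the linear term at \<open>z\<close> subtracted, the derivative of
          \<open>?g\<close> is a difference of two nearby values of
          \<open>partial k f\<close>.\<close>
        let ?g = "\<lambda>t. f (z + h' + axis k t) - t * partial k f z"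
        have gb: "norm (?g (h $ k) - ?g 0) \<le> e / 2 * norm (h $ k - 0)"
        proof (rule field_differentiable_bound)
          show "convex (cball 0 (norm (h $ k)) :: complex set)" by simp
          fix t :: complex assume "t \<in> cball 0 (norm (h $ k))"
          then have t: "norm t \<le> norm (h $ k)" by simp
          have "z + h' + axis k t \<in> D"
          proof (rule subsetD[OF d3(2)])
            show "z + h' + axis k t \<in> ball z d3"
              using near[OF t] norm_minus_cancel[of "h' + axis k t"] by (simp add: dist_norm)
          qed
          then have "((\<lambda>t. f (z + h' + axis k t)) has_field_derivative partial k f (z + h' + axis k t)) (at t)"
            by (rule sep_holomorphic_DERIV[OF f])
          then have "(?g has_field_derivative partial k f (z + h' + axis k t) - partial k f z) (at t)"
            by (auto intro!: derivative_eq_intros)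
          then show "(?g has_field_derivative partial k f (z + h' + axis k t) - partial k f z) (at t within cball 0 (norm (h $ k)))"
            by (rule has_field_derivative_at_within)
          show "norm (partial k f (z + h' + axis k t) - partial k f z) \<le> e / 2"
            using d2(2)[of "z + h' + axis k t"] near[OF t] by (simp add: dist_norm add.assoc)
        qed auto
        have b1: "norm (f (z + h) - f (z + h') - h $ k * partial k f z) \<le> e / 2 * norm h"
        proof -
          have "f (z + h) - f (z + h') - h $ k * partial k f z = ?g (h $ k) - ?g 0"
            by (simp add: h'_def)
          also have "norm (?g (h $ k) - ?g 0) \<le> e / 2 * norm (h $ k - 0)" by (rule gb)
          also have "\<dots> \<le> e / 2 * norm h" using hk \<open>0 < e\<close> by simp
          finally show ?thesis .
        qed
        have b2: "norm (f (z + h') - f z - (\<Sum>j\<in>S. h' $ j * partial j f z)) \<le> e / 2 * norm h'"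
          using h(2) near[of 0] by (intro d1(2)) (auto simp: h'j)
        have "(\<Sum>j\<in>S. h' $ j * partial j f z) = (\<Sum>j\<in>S. h $ j * partial j f z)"
          using insert.hyps by (intro sum.cong) (auto simp: h'j)
        then have "norm (f (z + h') - f z - (\<Sum>j\<in>S. h $ j * partial j f z)) \<le> e / 2 * norm h'"
          using b2 by simp
        also have "e / 2 * norm h' \<le> e / 2 * norm h"
          using mult_left_mono[OF nh', of "e / 2"] \<open>0 < e\<close> by simp
        finally have b3: "norm (f (z + h') - f z - (\<Sum>j\<in>S. h $ j * partial j f z)) \<le> e / 2 * norm h" .
        from b1 b3 have "norm ((f (z + h) - f (z + h') - h $ k * partial k f z) +
            (f (z + h') - f z - (\<Sum>j\<in>S. h $ j * partial j f z))) \<le> e / 2 * norm h + e / 2 * norm h"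
          by (intro norm_triangle_mono)
        then show ?thesis using insert.hyps by (simp add: algebra_simps)
      qed
      ultimately show "\<exists>d>0. \<forall>h. norm h < d \<and> (\<forall>j. j \<notin> insert k S \<longrightarrow> h $ j = 0) \<longrightarrow>
          norm (f (z + h) - f z - (\<Sum>j\<in>insert k S. h $ j * partial j f z)) \<le> e * norm h"
        by blast
    qed
  qed
  have "bounded_linear (\<lambda>h. \<Sum>j\<in>UNIV. h $ j * partial j f z)"
    by (intro bounded_linear_sum bounded_linear_mult_const bounded_linear_vec_nth)
  moreover have est: "\<exists>d>0. \<forall>h. norm h < d \<longrightarrow>
      norm (f (z + h) - f z - (\<Sum>j\<in>UNIV. h $ j * partial j f z)) \<le> e * norm h" if "0 < e" for e
    using main[OF finite[of UNIV]] that by auto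
  ultimately show ?thesis unfolding has_derivative_at_alt
  proof (intro conjI allI impI)
    fix e :: real assume "0 < e"
    then obtain d where d: "0 < d" "\<And>h. norm h < d \<Longrightarrow>
      norm (f (z + h) - f z - (\<Sum>j\<in>UNIV. h $ j * partial j f z)) \<le> e * norm h"
      using est by blast
    show "\<exists>d>0. \<forall>y. norm (y - z) < d \<longrightarrow>
        norm (f y - f z - (\<Sum>j\<in>UNIV. (y - z) $ j * partial j f z)) \<le> e * norm (y - z)"
      using d(1) d(2)[of "y - z" for y] by (intro exI[of _ d]) simp
  qed
qed


lemma sep_holomorphic_iff_sv_holomorphic:
  assumes "open D"
  shows "sep_holomorphic_on f D \<longleftrightarrow> sv_holomorphic_on f D"
proof
  assume f: "sep_holomorphic_on f D"
  show "sv_holomorphic_on f D"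
    unfolding sv_holomorphic_on_def
    by (intro ballI exI conjI, rule sep_holomorphic_has_derivative[OF assms f])
       (auto simp: sum_distrib_left mult.assoc)
next
  assume f: "sv_holomorphic_on f D"
  have "continuous_on D f"
    using f unfolding sv_holomorphic_on_def
    by (intro continuous_at_imp_continuous_on) (blast intro: has_derivative_continuous)
  moreover have "(\<lambda>t. f (z + axis j t)) field_differentiable at 0" if z: "z \<in> D" for z j
  proof -
    obtain L where L: "(f has_derivative L) (at z)" "\<And>a v. L (a *s v) = a * L v"
      using f z unfolding sv_holomorphic_on_def by blast
    have "((\<lambda>t. f (z + axis j t)) has_field_derivative L (axis j 1)) (at 0)"
      by (rule has_derivative_along_axis) (use L in auto)
    then show ?thesis unfolding field_differentiable_def by blast
  qed
  ultimately show "sep_holomorphic_on f D" by (simp add: sep_holomorphic_on_def)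
qed

section \<open>Closure properties of holomorphic functions\<close>

lemma sv_holomorphic_on_subset: "sv_holomorphic_on f D \<Longrightarrow> E \<subseteq> D \<Longrightarrow> sv_holomorphic_on f E"
  unfolding sv_holomorphic_on_def by blast

lemma sv_holomorphic_on_localI:
  assumes "\<And>z. z \<in> D \<Longrightarrow> \<exists>E. z \<in> E \<and> sv_holomorphic_on f E"
  shows "sv_holomorphic_on f D"
  using assms unfolding sv_holomorphic_on_def by blast

lemma sv_holomorphic_on_cong:
  assumes "open D" "\<And>z. z \<in> D \<Longrightarrow> f z = g z" "sv_holomorphic_on f D"
  shows "sv_holomorphic_on g D"
  unfolding sv_holomorphic_on_def
proof
  fix z assume z: "z \<in> D"
  then obtain L where L: "(f has_derivative L) (at z)" "\<forall>a v. L (a *s v) = a * L v"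
    using assms(3) unfolding sv_holomorphic_on_def by blast
  have "(g has_derivative L) (at z)"
    by (rule has_derivative_transform_within_open[OF L(1) assms(1) z assms(2)])
  with L(2) show "\<exists>L. (g has_derivative L) (at z) \<and> (\<forall>a v. L (a *s v) = a * L v)" by blast
qed

lemma sv_holomorphic_on_imp_continuous_on:
  "sv_holomorphic_on f D \<Longrightarrow> continuous_on D f"
  unfolding sv_holomorphic_on_def
  by (intro continuous_at_imp_continuous_on) (blast intro: has_derivative_continuous)

lemma sv_holomorphic_has_derivative:
  assumes "sv_holomorphic_on f D" "z \<in> D"
  shows "(f has_derivative (\<lambda>h. \<Sum>j\<in>UNIV. h $ j * partial j f z)) (at z)"
proof -
  obtain L where L: "(f has_derivative L) (at z)" "\<And>a v. L (a *s v) = a * L v"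
    using assms unfolding sv_holomorphic_on_def by blast
  interpret L: bounded_linear L using L(1) by (rule has_derivative_bounded_linear)
  have partial: "L (axis j 1) = partial j f z" for j
    by (rule sym, rule partial_eqI, rule has_derivative_along_axis) (use L in auto)
  have "L h = (\<Sum>j\<in>UNIV. h $ j * partial j f z)" for h
  proof -
    have "L h = L (\<Sum>j\<in>UNIV. h $ j *s axis j 1)" by (simp add: basis_expansion)
    also have "\<dots> = (\<Sum>j\<in>UNIV. h $ j * partial j f z)" by (simp add: L.sum L(2) partial)
    finally show ?thesis .
  qed
  then have "L = (\<lambda>h. \<Sum>j\<in>UNIV. h $ j * partial j f z)" by blast
  with L(1) show ?thesis by simp
qed

lemma sv_holomorphic_DERIV:
  assumes "sv_holomorphic_on f D" "z + axis j t \<in> D"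
  shows "((\<lambda>t. f (z + axis j t)) has_field_derivative partial j f (z + axis j t)) (at t)"
proof -
  have "((\<lambda>t. f (z + axis j t)) has_field_derivative
      (\<Sum>i\<in>UNIV. axis j 1 $ i * partial i f (z + axis j t))) (at t)"
    by (rule has_derivative_along_axis[OF sv_holomorphic_has_derivative[OF assms]])
       (auto simp: sum_distrib_left mult.assoc)
  also have "(\<Sum>i\<in>UNIV. axis j 1 $ i * partial i f (z + axis j t)) =
      (\<Sum>i\<in>UNIV. if i = j then partial i f (z + axis j t) else 0)"
    by (rule sum.cong) (auto simp: axis_def)
  finally show ?thesis by simp
qed

lemma sv_holomorphic_DERIV0:
  assumes "sv_holomorphic_on f D" "z \<in> D"
  shows "((\<lambda>t. f (z + axis j t)) has_field_derivative partial j f z) (at 0)"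
  using sv_holomorphic_DERIV[of f D z j 0] assms by simp

lemma sv_holomorphic_on_const [intro]: "sv_holomorphic_on (\<lambda>z. c) D"
  unfolding sv_holomorphic_on_def by (intro ballI exI[of _ "\<lambda>h. 0"]) (auto intro!: derivative_eq_intros)

lemma sv_holomorphic_on_nth [intro]: "sv_holomorphic_on (\<lambda>z. z $ i) D"
  unfolding sv_holomorphic_on_def
  by (intro ballI exI[of _ "\<lambda>h. h $ i"]) (auto intro!: bounded_linear_imp_has_derivative bounded_linear_vec_nth)

lemma sv_holomorphic_on_add [intro]:
  assumes "sv_holomorphic_on f D" "sv_holomorphic_on g D"
  shows "sv_holomorphic_on (\<lambda>z. f z + g z) D"
  unfolding sv_holomorphic_on_def
proof
  fix z assume z: "z \<in> D"
  show "\<exists>L. ((\<lambda>z. f z + g z) has_derivative L) (at z) \<and> (\<forall>a v. L (a *s v) = a * L v)"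
    by (intro exI conjI, rule has_derivative_add[OF assms[THEN sv_holomorphic_has_derivative[OF _ z]]])
       (auto simp: sum_distrib_left algebra_simps)
qed

lemma sv_holomorphic_on_mult [intro]:
  assumes "sv_holomorphic_on f D" "sv_holomorphic_on g D"
  shows "sv_holomorphic_on (\<lambda>z. f z * g z) D"
  unfolding sv_holomorphic_on_def
proof
  fix z assume z: "z \<in> D"
  show "\<exists>L. ((\<lambda>z. f z * g z) has_derivative L) (at z) \<and> (\<forall>a v. L (a *s v) = a * L v)"
    by (intro exI conjI, rule has_derivative_mult[OF assms[THEN sv_holomorphic_has_derivative[OF _ z]]])
       (auto simp: sum_distrib_left algebra_simps)
qed

lemma sv_holomorphic_on_minus [intro]:
  "sv_holomorphic_on f D \<Longrightarrow> sv_holomorphic_on (\<lambda>z. - f z) D"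
  using sv_holomorphic_on_mult[OF sv_holomorphic_on_const[of "-1"], of f D] by simp

lemma sv_holomorphic_on_diff [intro]:
  "sv_holomorphic_on f D \<Longrightarrow> sv_holomorphic_on g D \<Longrightarrow> sv_holomorphic_on (\<lambda>z. f z - g z) D"
  using sv_holomorphic_on_add[OF _ sv_holomorphic_on_minus, of f D g] by simp

lemma sv_holomorphic_on_sum [intro]:
  "(\<And>i. i \<in> I \<Longrightarrow> sv_holomorphic_on (f i) D) \<Longrightarrow> sv_holomorphic_on (\<lambda>z. \<Sum>i\<in>I. f i z) D"
  by (induction I rule: infinite_finite_induct) auto

lemma sv_holomorphic_on_prod [intro]:
  "(\<And>i. i \<in> I \<Longrightarrow> sv_holomorphic_on (f i) D) \<Longrightarrow> sv_holomorphic_on (\<lambda>z. \<Prod>i\<in>I. f i z) D"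
  by (induction I rule: infinite_finite_induct) auto

lemma sv_holomorphic_on_inverse [intro]:
  assumes "sv_holomorphic_on f D" "\<And>z. z \<in> D \<Longrightarrow> f z \<noteq> 0"
  shows "sv_holomorphic_on (\<lambda>z. inverse (f z)) D"
  unfolding sv_holomorphic_on_def
proof
  fix z assume z: "z \<in> D"
  show "\<exists>L. ((\<lambda>z. inverse (f z)) has_derivative L) (at z) \<and> (\<forall>a v. L (a *s v) = a * L v)"
    by (intro exI conjI, rule Deriv.has_derivative_inverse[OF assms(2)[OF z] assms(1)[THEN sv_holomorphic_has_derivative[OF _ z]]])
       (auto simp: sum_distrib_left sum_distrib_right algebra_simps)
qed

lemma sv_holomorphic_on_divide [intro]:
  "sv_holomorphic_on f D \<Longrightarrow> sv_holomorphic_on g D \<Longrightarrow> (\<And>z. z \<in> D \<Longrightarrow> g z \<noteq> 0) \<Longrightarrow>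
     sv_holomorphic_on (\<lambda>z. f z / g z) D"
  unfolding divide_inverse by (intro sv_holomorphic_on_mult sv_holomorphic_on_inverse)

lemmas sv_holomorphic_intros = sv_holomorphic_on_const sv_holomorphic_on_nth sv_holomorphic_on_add
  sv_holomorphic_on_diff sv_holomorphic_on_mult sv_holomorphic_on_sum sv_holomorphic_on_prod

lemma sv_holomorphic_on_det:
  fixes M :: "complex ^ 'n::finite \<Rightarrow> complex ^ 'm::finite ^ 'm"
  assumes "\<And>i j. sv_holomorphic_on (\<lambda>z. M z $ i $ j) D"
  shows "sv_holomorphic_on (\<lambda>z. det (M z)) D"
  unfolding det_def by (intro sv_holomorphic_on_sum sv_holomorphic_on_mult sv_holomorphic_on_prod assms) auto

section \<open>Holomorphic maps, parameter integrals and holomorphy of derivatives\<close>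

lemma has_derivative_vecI:
  fixes f :: "'a::real_normed_vector \<Rightarrow> 'b::euclidean_space ^ 'k::finite"
  assumes "\<And>i. ((\<lambda>x. f x $ i) has_derivative (\<lambda>h. L h $ i)) (at x)"
  shows "(f has_derivative L) (at x)"
proof -
  have "((\<lambda>x. \<Sum>i\<in>UNIV. axis i (f x $ i)) has_derivative (\<lambda>h. \<Sum>i\<in>UNIV. axis i (L h $ i))) (at x)"
    by (intro has_derivative_sum has_derivative_axis assms)
  moreover have "(\<Sum>i\<in>UNIV. axis i (v $ i)) = v" for v :: "'b ^ 'k"
    by (simp add: vec_eq_iff axis_def)
  ultimately show ?thesis by simp
qed

lemma sv_holomorphic_map_has_derivative:
  assumes "sv_holomorphic_map_on f D" "z \<in> D"
  shows "(f has_derivative (\<lambda>h. (\<chi> i j. partial j (\<lambda>z. f z $ i) z) *v h)) (at z)"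
proof (rule has_derivative_vecI)
  fix i
  have "((\<lambda>z. f z $ i) has_derivative (\<lambda>h. \<Sum>j\<in>UNIV. h $ j * partial j (\<lambda>z. f z $ i) z)) (at z)"
    using assms by (intro sv_holomorphic_has_derivative) (auto simp: sv_holomorphic_map_on_def)
  then show "((\<lambda>z. f z $ i) has_derivative (\<lambda>h. ((\<chi> i j. partial j (\<lambda>z. f z $ i) z) *v h) $ i)) (at z)"
    by (simp add: matrix_vector_mult_def mult.commute)
qed

lemma sv_holomorphic_on_compose:
  assumes f: "sv_holomorphic_on f E" and g: "sv_holomorphic_map_on g D" and gD: "g ` D \<subseteq> E"
  shows "sv_holomorphic_on (\<lambda>z. f (g z)) D"
  unfolding sv_holomorphic_on_def
proof
  fix z assume z: "z \<in> D"
  then have "g z \<in> E" using gD by blast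
  from has_derivative_compose[OF sv_holomorphic_map_has_derivative[OF g z] sv_holomorphic_has_derivative[OF f this]]
  show "\<exists>L. ((\<lambda>z. f (g z)) has_derivative L) (at z) \<and> (\<forall>a v. L (a *s v) = a * L v)"
    by (intro exI conjI, assumption)
       (auto simp: sum_distrib_left algebra_simps vector_scalar_mult_def matrix_vector_mult_def)
qed

text \<open>By Osgood's lemma it suffices to have continuity and, on each axis, the Leibniz rule in
  one complex variable.\<close>

lemma sv_holomorphic_on_integral_param:
  fixes F :: "real \<Rightarrow> complex ^ 'n::finite \<Rightarrow> complex"
  assumes D: "open D" and cont: "continuous_on ({0..1} \<times> D) (\<lambda>(s, z). F s z)"
    and hol: "\<And>s. s \<in> {0..1} \<Longrightarrow> sv_holomorphic_on (F s) D"
  shows "sv_holomorphic_on (\<lambda>z. integral {0..1} (\<lambda>s. F s z)) D"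
proof -
  have sep: "sep_holomorphic_on (F s) D" if "s \<in> {0..1}" for s
    using hol[OF that] sep_holomorphic_iff_sv_holomorphic[OF D] by blast
  \<comment> \<open>The integral lemmas want the parameter first and the integration variable
    second. The reparametrisation \<open>h\<close> lets the same fact serve for points of
    \<open>D\<close> and for points on an axis.\<close>
  have swap: "continuous_on (X \<times> cbox 0 1) (\<lambda>(t, s). G s (h t))"
    if "continuous_on ({0..1} \<times> D) (\<lambda>(s, z). G s z)" "continuous_on X h" "h ` X \<subseteq> D"
    for G :: "real \<Rightarrow> complex ^ 'n \<Rightarrow> complex" and h :: "'x::topological_space \<Rightarrow> complex ^ 'n" and X
  proof -
    have c: "continuous_on (X \<times> {0..1::real}) (\<lambda>p. h (fst p))"
      by (rule continuous_on_compose2[OF that(2)]) (auto intro: continuous_intros)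
    have "continuous_on (X \<times> {0..1}) (\<lambda>p. (\<lambda>(s, z). G s z) (snd p, h (fst p)))"
      by (rule continuous_on_compose2[OF that(1)])
         (use that(3) c in \<open>auto intro!: continuous_on_Pair continuous_on_snd continuous_on_id\<close>)
    then show ?thesis by (simp add: case_prod_beta)
  qed
  have "continuous_on D (\<lambda>z. integral (cbox 0 1) (\<lambda>s. F s z))"
    by (intro integral_continuous_on_param swap[OF cont]) auto
  moreover have "(\<lambda>t. integral (cbox 0 1) (\<lambda>s. F s (z + axis j t))) field_differentiable at 0" if z: "z \<in> D" for z j
  proof -
    obtain r where r: "0 < r" "ball z r \<subseteq> D" using D z openE by blast
    have inD: "z + axis j t \<in> D" if "t \<in> ball 0 r" for t
      using that r(2) by (auto simp: subset_iff dist_norm)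
    have ch: "continuous_on (ball 0 r) (\<lambda>t. z + axis j t)" by (intro continuous_intros)
    have "(\<lambda>t. integral (cbox 0 1) (\<lambda>s. F s (z + axis j t))) holomorphic_on ball 0 r"
    proof (rule leibniz_rule_holomorphic)
      fix t s assume ts: "t \<in> ball (0::complex) r" "s \<in> cbox (0::real) 1"
      show "((\<lambda>t. F s (z + axis j t)) has_field_derivative partial j (F s) (z + axis j t)) (at t within ball 0 r)"
        by (rule has_field_derivative_at_within, rule sv_holomorphic_DERIV[OF hol inD])
           (use ts in \<open>auto simp: cbox_interval\<close>)
    next
      fix t assume t: "t \<in> ball (0::complex) r"
      have "continuous_on (cbox 0 1) (\<lambda>s. (\<lambda>(s, z). F s z) (s, z + axis j t))"
        using inD[OF t] by (intro continuous_on_compose2[OF cont] continuous_intros) (auto simp: cbox_interval)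
      then show "(\<lambda>s. F s (z + axis j t)) integrable_on cbox 0 1"
        by (intro integrable_continuous) simp
    next
      show "continuous_on (ball 0 r \<times> cbox 0 1) (\<lambda>(t, s). partial j (F s) (z + axis j t))"
        using inD by (intro swap[OF continuous_on_partial_param[OF D cont sep] ch]) auto
    qed auto
    then show ?thesis using r by (intro holomorphic_on_imp_differentiable_at[of _ "ball 0 r"]) auto
  qed
  ultimately have "sep_holomorphic_on (\<lambda>z. integral (cbox 0 1) (\<lambda>s. F s z)) D"
    by (simp add: sep_holomorphic_on_def)
  then show ?thesis using D by (simp add: sep_holomorphic_iff_sv_holomorphic cbox_interval)
qed

text \<open>Cauchy's formula writes the derivative locally as an integral of translates of
  \<open>f\<close> with weights independent of \<open>z\<close>.\<close>

lemma sv_holomorphic_on_partial: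
  assumes D: "open D" and f: "sv_holomorphic_on f D"
  shows "sv_holomorphic_on (partial i f) D"
proof (rule sv_holomorphic_on_localI)
  fix z0 assume "z0 \<in> D"
  then obtain e where e: "0 < e" "ball z0 e \<subseteq> D" using D openE by blast
  define r where "r = e / 2"
  have r: "0 < r" using e by (simp add: r_def)
  have inD: "z + axis i t \<in> D" if "z \<in> ball z0 r" "norm t \<le> r" for z t
  proof -
    have "dist z0 (z + axis i t) \<le> dist z0 z + norm t"
      using dist_triangle[of z0 "z + axis i t" z] by (simp add: dist_norm)
    then have "z + axis i t \<in> ball z0 e" using that by (simp add: r_def)
    then show ?thesis using e by blast
  qed
  have nz: "circlepath 0 r x \<noteq> 0" for x using r by (simp add: circlepath)
  have ncp: "norm (circlepath 0 r x) = r" for x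
    using r by (simp add: circlepath norm_mult)
  let ?w = "\<lambda>x. (2 * of_real pi * \<i> * of_real r * exp (2 * of_real pi * \<i> * of_real x)) / (circlepath 0 r x)\<^sup>2"
  let ?G = "\<lambda>x z. f (z + axis i (circlepath 0 r x)) * ?w x"
  have "sv_holomorphic_on (\<lambda>z. integral {0..1} (\<lambda>x. ?G x z)) (ball z0 r)"
  proof (rule sv_holomorphic_on_integral_param)
    have "continuous_on ({0..1} \<times> ball z0 r) (\<lambda>p. f (snd p + axis i (circlepath 0 r (fst p))))"
      unfolding circlepath
      by (rule continuous_on_compose2[OF sv_holomorphic_on_imp_continuous_on[OF f]], intro continuous_intros)
         (use inD ncp in \<open>auto simp: circlepath\<close>)
    moreover have "continuous_on ({0..1} \<times> ball z0 r) (\<lambda>p. ?w (fst p))"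
      using nz unfolding circlepath by (intro continuous_intros) auto
    ultimately show "continuous_on ({0..1} \<times> ball z0 r) (\<lambda>(x, z). ?G x z)"
      unfolding case_prod_beta by (rule continuous_on_mult)
  next
    fix x :: real
    have "sv_holomorphic_on (\<lambda>z. f (z + axis i (circlepath 0 r x))) (ball z0 r)"
      by (rule sv_holomorphic_on_compose[OF f]) (auto simp: sv_holomorphic_map_on_def inD ncp)
    then show "sv_holomorphic_on (?G x) (ball z0 r)"
      by (rule sv_holomorphic_on_mult) (rule sv_holomorphic_on_const)
  qed auto
  then have "sv_holomorphic_on (\<lambda>z. 1 / (2 * of_real pi * \<i>) * integral {0..1} (\<lambda>x. ?G x z)) (ball z0 r)"
    by auto
  then have "sv_holomorphic_on (partial i f) (ball z0 r)"
  proof (rule sv_holomorphic_on_cong[rotated 2])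
    fix z assume "z \<in> ball z0 r"
    then show "1 / (2 * of_real pi * \<i>) * integral {0..1} (\<lambda>x. ?G x z) = partial i f z"
      using f D by (subst partial_cauchy_integral[OF _ r inD]) (auto simp: sep_holomorphic_iff_sv_holomorphic)
  qed auto
  then show "\<exists>E. z0 \<in> E \<and> sv_holomorphic_on (partial i f) E" using r by (intro exI[of _ "ball z0 r"]) auto
qed

section \<open>The transport equation\<close>

text \<open>Polydiscs suit the iteration better than balls: moving one coordinate towards the centre
  stays inside, slices parallel to an axis are discs, and the distance to the boundary can be
  measured in each coordinate separately.\<close>

definition polydisc :: "complex ^ 'n::finite \<Rightarrow> real \<Rightarrow> (complex ^ 'n) set" where
  "polydisc z0 R = {z. \<forall>j. norm (z $ j - z0 $ j) < R}"

lemma open_polydisc: "open (polydisc z0 R)"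
proof -
  have "polydisc z0 R = (\<Inter>j\<in>UNIV. {z. norm (z $ j - z0 $ j) < R})"
    by (auto simp: polydisc_def)
  also have "open \<dots>"
    by (intro open_INT ballI finite open_Collect_less continuous_intros)
  finally show ?thesis .
qed

lemma centre_in_polydisc: "0 < R \<Longrightarrow> z0 \<in> polydisc z0 R"
  by (simp add: polydisc_def)

lemma polydisc_mono: "r \<le> R \<Longrightarrow> polydisc z0 r \<subseteq> polydisc z0 R"
  by (auto simp: polydisc_def intro: less_le_trans)

lemma norm_le_sum_components: "norm (z :: complex ^ 'n::finite) \<le> (\<Sum>j\<in>UNIV. norm (z $ j))"
  unfolding norm_vec_def by (rule L2_set_le_sum) simp

lemma polydisc_in_open:
  assumes "open D" "z0 \<in> D"
  obtains R where "0 < R" "polydisc (z0 :: complex ^ 'n::finite) R \<subseteq> D"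
proof -
  obtain e where e: "0 < e" "ball z0 e \<subseteq> D" using assms openE by blast
  \<comment> \<open>The Euclidean norm is at most the sum of the \<open>CARD('n)\<close> component
    norms.\<close>
  define R where "R = e / real CARD('n)"
  have "0 < R" using e by (simp add: R_def)
  moreover have "polydisc z0 R \<subseteq> D"
  proof
    fix z assume z: "z \<in> polydisc z0 R"
    have "norm (z - z0) \<le> (\<Sum>j\<in>UNIV. norm (z $ j - z0 $ j))"
      using norm_le_sum_components[of "z - z0"] by simp
    also have "\<dots> < (\<Sum>j\<in>(UNIV :: 'n set). R)"
      using z by (intro sum_strict_mono) (auto simp: polydisc_def)
    also have "\<dots> = e" by (simp add: R_def)
    finally have "z \<in> ball z0 e" by (simp add: dist_norm norm_minus_commute)
    with e show "z \<in> D" by blast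
  qed
  ultimately show ?thesis by (rule that)
qed

text \<open>The integral of \<open>w\<close> in the k-th variable from the slice through
  \<open>z0\<close> to \<open>z\<close>: \<open>s = 0\<close> is the projection of \<open>z\<close>
  to the slice and \<open>s = 1\<close> is \<open>z\<close> itself. The fixed interval makes it a
  parameter integral.\<close>

definition primitive :: "'n::finite \<Rightarrow> complex ^ 'n \<Rightarrow> (complex ^ 'n \<Rightarrow> complex) \<Rightarrow> complex ^ 'n \<Rightarrow> complex" where
  "primitive k z0 w z = (z $ k - z0 $ k) *
     integral {0..1} (\<lambda>s. w (z + axis k ((of_real s - 1) * (z $ k - z0 $ k))))"

lemma axis_nth_if: "axis k x $ j = (if j = k then x else 0)"
  by (simp add: axis_def)

lemma primitive_path_nth:
  "(z + axis k ((of_real s - 1) * (z $ k - z0 $ k))) $ j - z0 $ j =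
    (if j = k then of_real s * (z $ k - z0 $ k) else z $ j - z0 $ j)"
  by (simp add: axis_nth_if algebra_simps)

lemma primitive_path_in_polydisc:
  assumes "z \<in> polydisc z0 R" "s \<in> {0..1}"
  shows "z + axis k ((of_real s - 1) * (z $ k - z0 $ k)) \<in> polydisc z0 R"
  unfolding polydisc_def
proof (clarify)
  fix j
  have "s * norm (z $ k - z0 $ k) \<le> norm (z $ k - z0 $ k)"
    using assms(2) by (intro mult_left_le_one_le) auto
  then show "norm ((z + axis k ((of_real s - 1) * (z $ k - z0 $ k))) $ j - z0 $ j) < R"
    unfolding primitive_path_nth using assms
    by (auto simp: norm_mult polydisc_def intro: le_less_trans)
qed

lemma primitive_integrand_continuous:
  assumes "continuous_on (polydisc z0 R) w" "z \<in> polydisc z0 R"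
  shows "continuous_on {0..1} (\<lambda>s. w (z + axis k ((of_real s - 1) * (z $ k - z0 $ k))))"
  by (rule continuous_on_compose2[OF assms(1)])
     (use primitive_path_in_polydisc[OF assms(2)] in \<open>auto intro!: continuous_intros\<close>)

lemma sv_holomorphic_on_primitive:
  assumes w: "sv_holomorphic_on w (polydisc z0 R)"
  shows "sv_holomorphic_on (primitive k z0 w) (polydisc z0 R)"
proof -
  have "sv_holomorphic_on (\<lambda>z. integral {0..1} (\<lambda>s. w (z + axis k ((of_real s - 1) * (z $ k - z0 $ k))))) (polydisc z0 R)"
  proof (rule sv_holomorphic_on_integral_param[OF open_polydisc])
    have "continuous_on ({0..1} \<times> polydisc z0 R)
       (\<lambda>p. w (snd p + axis k ((of_real (fst p) - 1) * (snd p $ k - z0 $ k))))"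
      by (rule continuous_on_compose2[OF sv_holomorphic_on_imp_continuous_on[OF w]])
         (auto intro!: continuous_intros primitive_path_in_polydisc)
    then show "continuous_on ({0..1} \<times> polydisc z0 R)
       (\<lambda>(s, z). w (z + axis k ((of_real s - 1) * (z $ k - z0 $ k))))"
      by (simp add: case_prod_beta)
  next
    fix s :: real assume s: "s \<in> {0..1}"
    show "sv_holomorphic_on (\<lambda>z. w (z + axis k ((of_real s - 1) * (z $ k - z0 $ k)))) (polydisc z0 R)"
    proof (rule sv_holomorphic_on_compose[OF w])
      show "sv_holomorphic_map_on (\<lambda>z. z + axis k ((of_real s - 1) * (z $ k - z0 $ k))) (polydisc z0 R)"
        unfolding sv_holomorphic_map_on_def vector_add_component axis_nth_if
      proof
        show "sv_holomorphic_on (\<lambda>z. z $ i + (if i = k then (of_real s - 1) * (z $ k - z0 $ k) else 0)) (polydisc z0 R)" for i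
          by (cases "i = k"; simp; intro sv_holomorphic_intros)
      qed
    qed (use primitive_path_in_polydisc[OF _ s] in auto)
  qed
  then show ?thesis
    unfolding primitive_def by (rule sv_holomorphic_on_mult[rotated]) (intro sv_holomorphic_intros)
qed

text \<open>On the complex line through \<open>z\<close> in direction \<open>k\<close>,
  \<open>w\<close> has a one-variable primitive \<open>G\<close>, and by the fundamental theorem the
  integral is an increment of \<open>G\<close>. No differentiation under the integral sign
  occurs.\<close>

lemma partial_primitive:
  assumes w: "sv_holomorphic_on w (polydisc z0 R)" and z: "z \<in> polydisc z0 R"
  shows "partial k (primitive k z0 w) z = w z"
proof -
  define \<zeta> where "\<zeta> = z $ k - z0 $ k"
  have dist_shift: "dist a (a + x) = norm x" for a x :: complex by (simp add: dist_norm)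
  \<comment> \<open>These are the parameters whose point on the line lies in the polydisc;
    \<open>- \<zeta>\<close> is where the line meets the slice of the centre.\<close>
  let ?T = "ball (- \<zeta>) R"
  have Q: "z + axis k t \<in> polydisc z0 R" if "t \<in> ?T" for t
    using z that by (auto simp: polydisc_def axis_nth_if dist_norm \<zeta>_def norm_minus_commute algebra_simps)
  have \<zeta>: "norm \<zeta> < R" using z by (auto simp: polydisc_def \<zeta>_def)
  have "(\<lambda>t. w (z + axis k t)) holomorphic_on ?T"
    by (rule sep_holomorphic_slice[of _ "polydisc z0 R"])
       (use w Q in \<open>auto simp: sep_holomorphic_iff_sv_holomorphic open_polydisc\<close>)
  then obtain G where "\<And>t. t \<in> ?T \<Longrightarrow> (G has_field_derivative w (z + axis k t)) (at t within ?T)"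
    using holomorphic_convex_primitive'[of ?T "\<lambda>t. w (z + axis k t)"] by auto
  then have G: "(G has_field_derivative w (z + axis k t)) (at t)" if "t \<in> ?T" for t
    using that at_within_open[of t ?T] by (metis open_ball)
  have eq: "primitive k z0 w (z + axis k t) = G t - G (- \<zeta>)" if t: "t \<in> ?T" for t
  proof -
    have seg: "- \<zeta> + of_real s * (\<zeta> + t) \<in> ?T" if s: "s \<in> {0..1}" for s :: real
    proof -
      have "norm (of_real s * (\<zeta> + t)) \<le> norm (\<zeta> + t)"
        using s by (auto simp: norm_mult intro: mult_left_le_one_le)
      moreover have "norm (\<zeta> + t) < R"
        using t by (simp add: dist_norm) (metis add.commute diff_minus_eq_add norm_minus_commute)
      moreover have "dist (- \<zeta>) (- \<zeta> + of_real s * (\<zeta> + t)) = norm (of_real s * (\<zeta> + t))"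
        by (rule dist_shift)
      ultimately show ?thesis by simp
    qed
    have "((\<lambda>s. (\<zeta> + t) * w (z + axis k (- \<zeta> + of_real s * (\<zeta> + t)))) has_integral
        (G \<circ> (\<lambda>s. - \<zeta> + of_real s * (\<zeta> + t))) 1 - (G \<circ> (\<lambda>s. - \<zeta> + of_real s * (\<zeta> + t))) 0) {0..1}"
    proof (rule fundamental_theorem_of_calculus)
      fix s :: real assume s: "s \<in> {0..1}"
      have "((\<lambda>s. - \<zeta> + of_real s * (\<zeta> + t)) has_vector_derivative (\<zeta> + t)) (at s)"
        by (rule derivative_eq_intros refl | simp add: has_vector_derivative_def)+
      then have "((G \<circ> (\<lambda>s. - \<zeta> + of_real s * (\<zeta> + t))) has_vector_derivative
          (\<zeta> + t) * w (z + axis k (- \<zeta> + of_real s * (\<zeta> + t)))) (at s)"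
        by (rule field_vector_diff_chain_at) (rule G[OF seg[OF s]])
      then show "((G \<circ> (\<lambda>s. - \<zeta> + of_real s * (\<zeta> + t))) has_vector_derivative
          (\<zeta> + t) * w (z + axis k (- \<zeta> + of_real s * (\<zeta> + t)))) (at s within {0..1})"
        by (rule has_vector_derivative_at_within)
    qed simp
    then have "((\<lambda>s. (\<zeta> + t) * w (z + axis k (- \<zeta> + of_real s * (\<zeta> + t)))) has_integral G t - G (- \<zeta>)) {0..1}"
      by simp
    then have "integral {0..1} (\<lambda>s. (\<zeta> + t) * w (z + axis k (- \<zeta> + of_real s * (\<zeta> + t)))) = G t - G (- \<zeta>)"
      by (rule integral_unique)
    moreover have shift: "(z + axis k t) $ k - z0 $ k = \<zeta> + t" by (simp add: \<zeta>_def)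
    moreover have "z + axis k t + axis k ((of_real s - 1) * (\<zeta> + t)) =
        z + axis k (- \<zeta> + of_real s * (\<zeta> + t))" for s :: real
      by (simp add: vec_eq_iff axis_nth_if algebra_simps)
    ultimately show ?thesis unfolding primitive_def shift by (simp only: integral_mult_right)
  qed
  have "((\<lambda>t. G t - G (- \<zeta>)) has_field_derivative w (z + axis k 0)) (at 0)"
    using G[of 0] \<zeta> by (auto intro!: derivative_eq_intros)
  then have "((\<lambda>t. primitive k z0 w (z + axis k t)) has_field_derivative w (z + axis k 0)) (at 0)"
    by (rule has_field_derivative_transform_within_open[where S = ?T]) (use \<zeta> eq in auto)
  then have "partial k (primitive k z0 w) z = w (z + axis k 0)"
    by (rule partial_eqI)
  then show ?thesis by simp
qed

text \<open>Integrating \<open>s ^ n\<close> gains the factor \<open>1 / (n + 1)\<close>, which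
  later cancels the factor lost by differentiation.\<close>

lemma norm_primitive_le:
  assumes cont: "continuous_on (polydisc z0 R) w" and z: "z \<in> polydisc z0 R"
    and b: "\<And>s. s \<in> {0..1} \<Longrightarrow>
      norm (w (z + axis k ((of_real s - 1) * (z $ k - z0 $ k)))) \<le> c * s ^ n"
  shows "norm (primitive k z0 w z) \<le> norm (z $ k - z0 $ k) * (c / real (n + 1))"
proof -
  have "((\<lambda>s. c * s ^ n) has_integral c * 1 ^ Suc n / real (n + 1) - c * 0 ^ Suc n / real (n + 1)) {0..1::real}"
  proof (rule fundamental_theorem_of_calculus)
    fix s :: real
    have "((\<lambda>s. c * s ^ Suc n / real (n + 1)) has_real_derivative c * s ^ n) (at s within {0..1})"
      by (rule derivative_eq_intros refl | simp)+
    then show "((\<lambda>s. c * s ^ Suc n / real (n + 1)) has_vector_derivative c * s ^ n) (at s within {0..1})"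
      by (simp add: has_real_derivative_iff_has_vector_derivative)
  qed simp
  then have I: "((\<lambda>s. c * s ^ n) has_integral c / real (n + 1)) {0..1::real}" by simp
  have "norm (integral {0..1} (\<lambda>s. w (z + axis k ((of_real s - 1) * (z $ k - z0 $ k))))) \<le>
      integral {0..1} (\<lambda>s. c * s ^ n)"
    by (intro integral_norm_bound_integral integrable_continuous_real
        primitive_integrand_continuous[OF cont z] has_integral_integrable[OF I] b)
  also have "\<dots> = c / real (n + 1)" using I by (rule integral_unique)
  finally show ?thesis unfolding primitive_def norm_mult by (intro mult_left_mono) auto
qed

text \<open>Weierstrass' convergence theorem, applied on each axis; Osgood's lemma combines the
  axes.\<close>

lemma sv_holomorphic_uniform_limit:
  assumes D: "open D" and f: "\<And>n. sv_holomorphic_on (f n) D" and ul: "uniform_limit D f g sequentially"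
  shows "sv_holomorphic_on g D" "\<And>z j. z \<in> D \<Longrightarrow> (\<lambda>n. partial j (f n) z) \<longlonglongrightarrow> partial j g z"
proof -
  have *: "\<exists>d. ((\<lambda>t. g (z + axis j t)) has_field_derivative d) (at 0) \<and> (\<lambda>n. partial j (f n) z) \<longlonglongrightarrow> d"
    if z: "z \<in> D" for z j
  proof -
    obtain e where e: "0 < e" "ball z e \<subseteq> D" using D z openE by blast
    define r where "r = e / 2"
    have r: "0 < r" using e by (simp add: r_def)
    have inD: "z + axis j t \<in> D" if "t \<in> cball 0 r" for t
      by (rule subsetD[OF e(2)]) (use that e in \<open>simp add: dist_norm r_def\<close>)
    have der: "((\<lambda>t. f n (z + axis j t)) has_field_derivative partial j (f n) (z + axis j t)) (at t)"
      if "t \<in> cball 0 r" for n t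
      by (rule sv_holomorphic_DERIV[OF f inD[OF that]])
    have cont: "continuous_on (cball 0 r) (\<lambda>t. f n (z + axis j t))" for n
      by (rule continuous_at_imp_continuous_on, rule ballI, rule DERIV_isCont, rule der)
    have ul': "uniform_limit (cball 0 r) (\<lambda>n t. f n (z + axis j t)) (\<lambda>t. g (z + axis j t)) sequentially"
      unfolding uniform_limit_iff
    proof (intro allI impI)
      fix \<epsilon> :: real assume "0 < \<epsilon>"
      then have "\<forall>\<^sub>F n in sequentially. \<forall>x\<in>D. dist (f n x) (g x) < \<epsilon>"
        using ul unfolding uniform_limit_iff by blast
      then show "\<forall>\<^sub>F n in sequentially. \<forall>t\<in>cball 0 r. dist (f n (z + axis j t)) (g (z + axis j t)) < \<epsilon>"
        by eventually_elim (use inD in blast)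
    qed
    obtain g' where "\<And>w. w \<in> ball 0 r \<Longrightarrow> ((\<lambda>t. g (z + axis j t)) has_field_derivative (g' w)) (at w) \<and>
        ((\<lambda>n. partial j (f n) (z + axis j w)) \<longlongrightarrow> g' w) sequentially"
      by (rule has_complex_derivative_uniform_limit[where z = 0 and r = r and
            f = "\<lambda>n t. f n (z + axis j t)" and f' = "\<lambda>n t. partial j (f n) (z + axis j t)", OF _ ul' _ r])
         (use cont der in auto)
    from this[of 0] show ?thesis using r by auto
  qed
  have "continuous_on D g"
    by (rule uniform_limit_theorem[OF always_eventually ul])
       (use f in \<open>auto intro: sv_holomorphic_on_imp_continuous_on\<close>)
  then have "sep_holomorphic_on g D"
    using * unfolding sep_holomorphic_on_def field_differentiable_def by blast
  then show "sv_holomorphic_on g D" using D by (simp add: sep_holomorphic_iff_sv_holomorphic)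
  fix z j assume "z \<in> D"
  from *[OF this, of j] show "(\<lambda>n. partial j (f n) z) \<longlonglongrightarrow> partial j g z" using partial_eqI by blast
qed

section \<open>Nagumo's estimate and the transport equation\<close>

lemma partial_sum:
  assumes "z \<in> D" "\<And>i. i \<in> I \<Longrightarrow> sv_holomorphic_on (f i) D"
  shows "partial j (\<lambda>z. \<Sum>i\<in>I. f i z) z = (\<Sum>i\<in>I. partial j (f i) z)"
  by (rule partial_eqI, rule DERIV_sum, rule sv_holomorphic_DERIV0[OF assms(2,1)])


text \<open>Keeps the constant in Nagumo's estimate independent of \<open>n\<close>.\<close>

lemma power_ratio_le_exp: "(real (n + 2) / real (n + 1)) ^ n \<le> exp 1"
proof -
  have "(real (n + 2) / real (n + 1)) ^ n \<le> exp (1 / real (n + 1)) ^ n"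
    using exp_ge_add_one_self[of "1 / real (n + 1)"] by (intro power_mono) (auto simp: field_simps)
  also have "\<dots> = exp (real n / real (n + 1))"
    by (simp add: exp_of_nat_mult[symmetric])
  also have "\<dots> \<le> exp 1" by (simp add: field_simps)
  finally show ?thesis .
qed

text \<open>Cauchy's inequality on a circle in direction \<open>j\<close>, whose radius uses up a
  part of the margin \<open>\<rho>\<close>. The majorant \<open>C\<close> depends on the k-th
  coordinate only, so it is constant on that circle. The margin concerns the coordinates other than
  \<open>k\<close>, the only ones in which derivatives are estimated.\<close>

lemma nagumo_estimate:
  assumes w: "sv_holomorphic_on w (polydisc z0 R)"
    and bound: "\<And>z \<rho>. z \<in> polydisc z0 R \<Longrightarrow> 0 < \<rho> \<Longrightarrow> (\<And>j. j \<noteq> k \<Longrightarrow> norm (z $ j - z0 $ j) + \<rho> < R) \<Longrightarrow>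
      norm (w z) \<le> C (z $ k) / \<rho> ^ n"
    and z: "z \<in> polydisc z0 R" and \<rho>: "0 < \<rho>" "\<And>j. j \<noteq> k \<Longrightarrow> norm (z $ j - z0 $ j) + \<rho> < R"
    and j: "j \<noteq> k" and C: "0 \<le> C (z $ k)"
  shows "norm (partial j w z) \<le> 2 * exp 1 * real (n + 1) * C (z $ k) / \<rho> ^ (n + 1)"
proof -
  \<comment> \<open>The best radius for the power \<open>n\<close> would be
    \<open>\<rho> / (n + 1)\<close>, but for \<open>n = 0\<close> it would use up the whole margin;
    \<open>n + 2\<close> always leaves \<open>\<rho>'\<close> positive.\<close>
  define r where "r = \<rho> / real (n + 2)"
  define \<rho>' where "\<rho>' = \<rho> * real (n + 1) / real (n + 2)"
  have "\<rho>' + r = \<rho> * (real (n + 1) + 1) / real (n + 2)"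
    by (simp add: r_def \<rho>'_def add_divide_distrib distrib_left)
  also have "\<dots> = \<rho>" by simp
  finally have "\<rho>' + r = \<rho>" .
  moreover have "0 < r" "0 < \<rho>'" using \<rho>(1) by (auto simp: r_def \<rho>'_def intro!: divide_pos_pos mult_pos_pos)
  ultimately have r: "0 < r" "r \<le> \<rho>" "\<rho>' + r = \<rho>" "0 < \<rho>'" "\<rho>' \<le> \<rho>" by linarith+
  have margin: "norm ((z + axis j t) $ i - z0 $ i) + \<rho>' < R" if "norm t \<le> r" "i \<noteq> k" for t i
  proof -
    have "norm ((z + axis j t) $ i - z0 $ i) \<le> norm (z $ i - z0 $ i) + norm t"
      using norm_triangle_ineq[of "z $ i - z0 $ i" t] by (auto simp: axis_nth_if algebra_simps)
    then show ?thesis using \<rho>(2)[OF that(2)] that(1) r by linarith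
  qed
  have inQ: "z + axis j t \<in> polydisc z0 R" if "norm t \<le> r" for t
    unfolding polydisc_def
  proof (clarify)
    fix i
    show "norm ((z + axis j t) $ i - z0 $ i) < R"
      using margin[OF that, of i] r(4) z j by (cases "i = k") (auto simp: axis_nth_if polydisc_def)
  qed
  have "norm (partial j w z) \<le> (C (z $ k) / \<rho>' ^ n) / r"
  proof (rule norm_partial_le[OF _ r(1) inQ])
    show "sep_holomorphic_on w (polydisc z0 R)"
      using w by (simp add: sep_holomorphic_iff_sv_holomorphic open_polydisc)
    fix t :: complex assume t: "norm t = r"
    then have "norm (w (z + axis j t)) \<le> C ((z + axis j t) $ k) / \<rho>' ^ n"
      by (intro bound inQ r margin) auto
    then show "norm (w (z + axis j t)) \<le> C (z $ k) / \<rho>' ^ n"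
      using j by (simp add: axis_nth_if)
  qed
  also have "\<dots> = C (z $ k) / \<rho> ^ (n + 1) * (real (n + 2) * (real (n + 2) / real (n + 1)) ^ n)"
    using \<rho>(1) by (simp add: r_def \<rho>'_def power_divide power_mult_distrib mult_ac)
  also have "\<dots> \<le> C (z $ k) / \<rho> ^ (n + 1) * ((2 * real (n + 1)) * exp 1)"
    using C \<rho>(1) by (intro mult_left_mono mult_mono power_ratio_le_exp) auto
  finally show ?thesis by (simp add: mult_ac)
qed

lemma isCont_bounded_on_nbhd:
  fixes f :: "'a::metric_space \<Rightarrow> 'b::real_normed_vector"
  assumes "continuous_on D f" "open D" "z0 \<in> D"
  shows "\<exists>U. open U \<and> z0 \<in> U \<and> U \<subseteq> D \<and> (\<forall>z\<in>U. norm (f z) \<le> norm (f z0) + 1)"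
proof -
  have "isCont f z0" using assms continuous_on_eq_continuous_at by blast
  then obtain \<delta> where \<delta>: "0 < \<delta>" "\<And>z. dist z z0 < \<delta> \<Longrightarrow> dist (f z) (f z0) < 1"
    unfolding continuous_at_eps_delta using zero_less_one by blast
  have "norm (f z) \<le> norm (f z0) + 1" if "z \<in> D \<inter> ball z0 \<delta>" for z
  proof -
    have "norm (f z - f z0) < 1" using \<delta>(2)[of z] that by (auto simp: dist_commute simp flip: dist_norm)
    then show ?thesis using norm_triangle_sub[of "f z" "f z0"] by linarith
  qed
  then show ?thesis using assms \<delta>(1) by (intro exI[of _ "D \<inter> ball z0 \<delta>"]) auto
qed

text \<open>Cauchy--Kovalevskaya for the transport equation, solved by iterating \<open>w \<mapsto> - \<integral> \<Sum>\<^sub>j\<^sub>\<noteq>\<^sub>k a\<^sub>j \<partial>\<^sub>j w dz\<^sub>k\<close>. Each step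
  loses one derivative, but the factor lost in Nagumo's estimate is regained by the integration.\<close>

theorem transport_equation_local:
  fixes a :: "'n::finite \<Rightarrow> complex ^ 'n \<Rightarrow> complex"
  assumes D: "open D" "z0 \<in> D" and a: "\<And>j. sv_holomorphic_on (a j) D"
    and ak: "\<And>z. z \<in> D \<Longrightarrow> a k z = 1" and d: "sv_holomorphic_on d D"
  shows "\<exists>u E. open E \<and> z0 \<in> E \<and> E \<subseteq> D \<and> sv_holomorphic_on u E \<and>
    (\<forall>z\<in>E. (\<Sum>j\<in>UNIV. a j z * partial j u z) = d z) \<and> (\<forall>z\<in>E. z $ k = z0 $ k \<longrightarrow> u z = 0)"
proof -
  define N where "N z = (\<Sum>j\<in>UNIV. norm (a j z))" for z
  have contN: "continuous_on D N"
    unfolding N_def by (intro continuous_intros sv_holomorphic_on_imp_continuous_on a)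
  obtain U1 where U1: "open U1" "z0 \<in> U1" "U1 \<subseteq> D" "\<And>z. z \<in> U1 \<Longrightarrow> norm (N z) \<le> norm (N z0) + 1"
    using isCont_bounded_on_nbhd[OF contN D] by blast
  obtain U2 where U2: "open U2" "z0 \<in> U2" "U2 \<subseteq> D" "\<And>z. z \<in> U2 \<Longrightarrow> norm (d z) \<le> norm (d z0) + 1"
    using isCont_bounded_on_nbhd[OF sv_holomorphic_on_imp_continuous_on[OF d] D] by blast
  obtain R where R: "0 < R" "polydisc z0 R \<subseteq> U1 \<inter> U2"
    using polydisc_in_open[of "U1 \<inter> U2" z0] U1 U2 by auto
  let ?Q = "polydisc z0 R"
  define A where "A = norm (N z0) + 1"
  \<comment> \<open>\<open>M\<close> bounds the first iterate, the primitive of \<open>d\<close>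
    over a path of length at most \<open>R\<close>. In \<open>B\<close>, \<open>A\<close> bounds the
    coefficients and \<open>2 * exp 1\<close> is Nagumo's constant.\<close>
  define M where "M = R * (norm (d z0) + 1)"
  define B where "B = 2 * exp 1 * A"
  have pos: "0 < A" "0 \<le> M" "0 < B" using R by (auto simp: A_def M_def B_def intro: add_nonneg_pos)
  have QD: "?Q \<subseteq> D" using R U1 by blast
  have NA: "N z \<le> A" if "z \<in> ?Q" for z using U1(4)[of z] R that by (auto simp: A_def)
  have aQ: "sv_holomorphic_on (a j) ?Q" for j by (rule sv_holomorphic_on_subset[OF a QD])
  have dQ: "sv_holomorphic_on d ?Q" by (rule sv_holomorphic_on_subset[OF d QD])
  \<comment> \<open>As \<open>a k\<close> is 1, the equation reads
    \<open>partial k u = d - S u\<close>, and \<open>S\<close> differentiates in the other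
    directions only.\<close>
  define S where "S v z = (\<Sum>j\<in>UNIV - {k}. a j z * partial j v z)" for v z
  have S_holo: "sv_holomorphic_on (S v) ?Q" if "sv_holomorphic_on v ?Q" for v
    unfolding S_def using aQ that by (intro sv_holomorphic_on_sum sv_holomorphic_on_mult sv_holomorphic_on_partial open_polydisc)
  define w where "w = rec_nat (primitive k z0 d) (\<lambda>n v. primitive k z0 (\<lambda>z. - S v z))"
  have w0: "w 0 = primitive k z0 d" and wS: "w (Suc n) = primitive k z0 (\<lambda>z. - S (w n) z)" for n
    by (simp_all add: w_def)
  have w_holo: "sv_holomorphic_on (w n) ?Q" for n
  proof (induction n)
    case 0 then show ?case unfolding w0 by (rule sv_holomorphic_on_primitive[OF dQ])
  next
    case (Suc n) then show ?case unfolding wS by (intro sv_holomorphic_on_primitive sv_holomorphic_on_minus S_holo)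
  qed
  \<comment> \<open>The n-th power of the distance to the slice reflects the repeated integrations;
    as Nagumo's estimate requires, only the k-th coordinate enters.\<close>
  define C where "C n x = M * (B * norm (x - z0 $ k)) ^ n" for n x
  have C0: "0 \<le> C n x" for n x unfolding C_def using pos by (intro mult_nonneg_nonneg zero_le_power) auto
  have w_bound: "norm (w n z) \<le> C n (z $ k) / \<rho> ^ n"
    if "z \<in> ?Q" "0 < \<rho>" "\<And>j. j \<noteq> k \<Longrightarrow> norm (z $ j - z0 $ j) + \<rho> < R" for n z \<rho>
    using that
  \<comment> \<open>The margin must vary: Nagumo's estimate uses the hypothesis at neighbouring
    points with a smaller margin.\<close>
  proof (induction n arbitrary: z \<rho>)
    case 0
    have "norm (w 0 z) \<le> norm (z $ k - z0 $ k) * ((norm (d z0) + 1) / real (0 + 1))"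
      unfolding w0
    proof (rule norm_primitive_le[OF sv_holomorphic_on_imp_continuous_on[OF dQ] 0(1)])
      fix s :: real assume "s \<in> {0..1}"
      then show "norm (d (z + axis k ((of_real s - 1) * (z $ k - z0 $ k)))) \<le> (norm (d z0) + 1) * s ^ 0"
        using primitive_path_in_polydisc[OF 0(1), of s k] U2(4) R by auto
    qed
    also have "\<dots> \<le> M"
      unfolding M_def using 0(1) by (auto intro!: mult_right_mono simp: polydisc_def less_imp_le)
    finally show ?case by (simp add: C_def)
  next
    case (Suc n)
    have pdb: "norm (partial j (w n) z) \<le> 2 * exp 1 * real (n + 1) * C n (z $ k) / \<rho> ^ (n + 1)"
      if "z \<in> ?Q" "0 < \<rho>" "\<And>j. j \<noteq> k \<Longrightarrow> norm (z $ j - z0 $ j) + \<rho> < R" "j \<noteq> k" for z \<rho> j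
      by (rule nagumo_estimate[OF w_holo Suc.IH]) (use that C0 in auto)
    \<comment> \<open>On the integration path \<open>C n\<close> contributes \<open>s ^ n\<close>,
      so integration divides by \<open>n + 1\<close> and cancels the \<open>n + 1\<close> in
      \<open>?c\<close>. What remains is one more factor
      \<open>B * norm (z $ k - z0 $ k) / \<rho>\<close>.\<close>
    let ?c = "A * (2 * exp 1 * real (n + 1) * C n (z $ k) / \<rho> ^ (n + 1))"
    have "norm (w (Suc n) z) \<le> norm (z $ k - z0 $ k) * (?c / real (n + 1))"
      unfolding wS
    proof (rule norm_primitive_le[OF _ Suc.prems(1)])
      show "continuous_on ?Q (\<lambda>z. - S (w n) z)"
        by (intro sv_holomorphic_on_imp_continuous_on sv_holomorphic_on_minus S_holo w_holo)
      fix s :: real assume s: "s \<in> {0..1}"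
      let ?y = "z + axis k ((of_real s - 1) * (z $ k - z0 $ k))"
      have y: "?y \<in> ?Q" by (rule primitive_path_in_polydisc[OF Suc.prems(1) s])
      have yk: "?y $ k - z0 $ k = of_real s * (z $ k - z0 $ k)" by (simp add: axis_nth_if algebra_simps)
      have Cs: "C n (?y $ k) = C n (z $ k) * s ^ n"
        unfolding C_def yk using s by (simp add: norm_mult power_mult_distrib)
      have "norm (S (w n) ?y) \<le> (\<Sum>j\<in>UNIV - {k}. norm (a j ?y) * (2 * exp 1 * real (n + 1) * C n (?y $ k) / \<rho> ^ (n + 1)))"
        unfolding S_def
        by (rule order_trans[OF norm_sum], rule sum_mono, unfold norm_mult, rule mult_left_mono, rule pdb)
           (use Suc.prems y in \<open>auto simp: axis_nth_if\<close>)
      also have "\<dots> = (\<Sum>j\<in>UNIV - {k}. norm (a j ?y)) * (2 * exp 1 * real (n + 1) * C n (?y $ k) / \<rho> ^ (n + 1))"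
        by (rule sum_distrib_right[symmetric])
      also have "\<dots> \<le> A * (2 * exp 1 * real (n + 1) * C n (?y $ k) / \<rho> ^ (n + 1))"
      proof (rule mult_right_mono)
        have "(\<Sum>j\<in>UNIV - {k}. norm (a j ?y)) \<le> N ?y" unfolding N_def by (rule sum_mono2) auto
        then show "(\<Sum>j\<in>UNIV - {k}. norm (a j ?y)) \<le> A" using NA[OF y] by linarith
        show "0 \<le> 2 * exp 1 * real (n + 1) * C n (?y $ k) / \<rho> ^ (n + 1)"
          using C0[of n "?y $ k"] Suc.prems(2) by simp
      qed
      finally have "norm (S (w n) ?y) \<le> A * (2 * exp 1 * real (n + 1) * (C n (z $ k) * s ^ n) / \<rho> ^ (n + 1))"
        unfolding Cs .
      then show "norm (- S (w n) ?y) \<le> ?c * s ^ n" by (simp add: mult_ac)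
    qed
    also have "\<dots> = C (Suc n) (z $ k) / \<rho> ^ Suc n"
    proof -
      have eq: "?c / real (n + 1) = B * C n (z $ k) / \<rho> ^ (n + 1)" by (simp add: B_def)
      show ?thesis unfolding eq by (simp add: C_def)
    qed
    finally show ?case .
  qed
  \<comment> \<open>The first bound leaves the margin \<open>R / 2\<close> in every coordinate; the
    second makes the ratio \<open>B * norm (z $ k - z0 $ k) / (R / 2)\<close> of the majorants at
    most 1/2.\<close>
  define \<eta> where "\<eta> = min (R / 2) (R / (4 * B))"
  have \<eta>: "0 < \<eta>" "\<eta> \<le> R / 2" "\<eta> \<le> R / (4 * B)" using R pos by (auto simp: \<eta>_def)
  let ?E = "polydisc z0 \<eta>"
  have EQ: "?E \<subseteq> ?Q" using \<eta> R by (intro polydisc_mono) auto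
  have Eprem: "z \<in> ?Q" "0 < R / 2" "\<And>j. j \<noteq> k \<Longrightarrow> norm (z $ j - z0 $ j) + R / 2 < R" if "z \<in> ?E" for z
  proof -
    show "z \<in> ?Q" using that EQ by blast
    show "0 < R / 2" using R by simp
    fix j
    have "norm (z $ j - z0 $ j) < \<eta>" using that by (simp add: polydisc_def)
    then show "norm (z $ j - z0 $ j) + R / 2 < R" using \<eta>(2) by simp
  qed
  have CE: "C n (z $ k) / (R / 2) ^ n \<le> M * (1 / 2) ^ n" if z: "z \<in> ?E" for z n
  proof -
    have "norm (z $ k - z0 $ k) \<le> R / (4 * B)" using z \<eta> by (auto simp: polydisc_def intro: less_imp_le less_le_trans)
    then have "B * norm (z $ k - z0 $ k) / (R / 2) \<le> 1 / 2" using pos R by (simp add: field_simps)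
    then have "(B * norm (z $ k - z0 $ k) / (R / 2)) ^ n \<le> (1 / 2) ^ n"
      using pos R by (intro power_mono) auto
    then have "M * (B * norm (z $ k - z0 $ k) / (R / 2)) ^ n \<le> M * (1 / 2) ^ n"
      using pos by (intro mult_left_mono)
    then show ?thesis by (simp add: C_def power_divide)
  qed
  have wE: "norm (w n z) \<le> M * (1 / 2) ^ n" if "z \<in> ?E" for z n
    using w_bound[OF Eprem[OF that]] CE[OF that, of n] by (rule order_trans)
  \<comment> \<open>Values alone do not control \<open>S (w n)\<close>, so Nagumo's estimate is
    applied once more; its factor \<open>n + 1\<close> is harmless against
    \<open>(1 / 2) ^ n\<close>.\<close>
  have pdE: "norm (partial j (w n) z) \<le> 4 * exp 1 * M / R * (real (n + 1) * (1 / 2) ^ n)" if z: "z \<in> ?E" and j: "j \<noteq> k" for z n j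
  proof -
    have "norm (partial j (w n) z) \<le> 2 * exp 1 * real (n + 1) * C n (z $ k) / (R / 2) ^ (n + 1)"
      by (rule nagumo_estimate[OF w_holo w_bound]) (use Eprem[OF z] j C0 in auto)
    also have "\<dots> = 2 * exp 1 * real (n + 1) / (R / 2) * (C n (z $ k) / (R / 2) ^ n)" by simp
    also have "\<dots> \<le> 2 * exp 1 * real (n + 1) / (R / 2) * (M * (1 / 2) ^ n)"
      using R by (intro mult_left_mono CE[OF z]) auto
    also have "2 * exp 1 * x / (R / 2) * (M * y) = 4 * exp 1 * M / R * (x * y)" for x y by simp
    finally show ?thesis .
  qed
  define u where "u z = (\<Sum>n. w n z)" for z
  have "uniform_limit ?E (\<lambda>n z. \<Sum>i<n. w i z) u sequentially"
    unfolding u_def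
  proof (rule Weierstrass_m_test)
    show "norm (w n z) \<le> M * (1 / 2) ^ n" if "z \<in> ?E" for n z by (rule wE[OF that])
    show "summable (\<lambda>n. M * (1 / 2) ^ n)" by (intro summable_mult summable_geometric) auto
  qed
  moreover have partial_holo: "sv_holomorphic_on (\<lambda>z. \<Sum>i<n. w i z) ?E" for n
    by (intro sv_holomorphic_on_sum sv_holomorphic_on_subset[OF w_holo EQ])
  ultimately have u: "sv_holomorphic_on u ?E"
    and lim: "\<And>z j. z \<in> ?E \<Longrightarrow> (\<lambda>n. partial j (\<lambda>z. \<Sum>i<n. w i z) z) \<longlonglongrightarrow> partial j u z"
    using sv_holomorphic_uniform_limit[where D = ?E and f = "\<lambda>n z. \<Sum>i<n. w i z" and g = u, OF open_polydisc] by auto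
  have eqn: "(\<Sum>j\<in>UNIV. a j z * partial j u z) = d z" if z: "z \<in> ?E" for z
  proof -
    have zQ: "z \<in> ?Q" using z EQ by blast
    have split: "(\<Sum>j\<in>UNIV. a j z * partial j v z) = partial k v z + S v z" for v
      unfolding S_def using ak[of z] zQ QD by (subst sum.remove[of UNIV k]) auto
    \<comment> \<open>The k-th derivative of \<open>w (Suc n)\<close> is \<open>- S (w n)\<close>,
      so the sum telescopes: a partial sum solves the equation up to the defect
      \<open>S (w n)\<close>, which tends to 0.\<close>
    have partial: "(\<Sum>j\<in>UNIV. a j z * partial j (\<lambda>z. \<Sum>i<Suc n. w i z) z) = d z + S (w n) z" for n
    proof -
      have "(\<Sum>j\<in>UNIV. a j z * partial j (\<lambda>z. \<Sum>i<Suc n. w i z) z) =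
          (\<Sum>j\<in>UNIV. \<Sum>i<Suc n. a j z * partial j (w i) z)"
        by (rule sum.cong[OF refl], subst partial_sum[OF zQ w_holo]) (rule sum_distrib_left)
      also have "\<dots> = (\<Sum>i<Suc n. \<Sum>j\<in>UNIV. a j z * partial j (w i) z)" by (rule sum.swap)
      also have "\<dots> = (\<Sum>i<Suc n. partial k (w i) z + S (w i) z)" by (simp only: split)
      also have "\<dots> = d z + S (w n) z"
      proof (induction n)
        case 0 show ?case using partial_primitive[OF dQ zQ] by (simp add: w0)
      next
        case (Suc n)
        have "partial k (w (Suc n)) z = - S (w n) z"
          unfolding wS by (rule partial_primitive[OF sv_holomorphic_on_minus[OF S_holo[OF w_holo]] zQ])
        with Suc show ?case by simp
      qed
      finally show ?thesis .
    qed
    have pd0: "(\<lambda>n. partial j (w n) z) \<longlonglongrightarrow> 0" if "j \<noteq> k" for j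
    proof (rule Lim_null_comparison)
      show "\<forall>\<^sub>F n in sequentially. norm (partial j (w n) z) \<le> 4 * exp 1 * M / R * (real (n + 1) * (1 / 2) ^ n)"
        by (rule always_eventually) (use pdE[OF z that] in blast)
      have "(\<lambda>n. real n * (1 / 2) ^ n + (1 / 2) ^ n) \<longlonglongrightarrow> (0::real) + 0"
        by (intro tendsto_add LIMSEQ_power_zero powser_times_n_limit_0) auto
      then show "(\<lambda>n. 4 * exp 1 * M / R * (real (n + 1) * (1 / 2) ^ n)) \<longlonglongrightarrow> 0"
        by (intro tendsto_mult_right_zero) (simp add: algebra_simps)
    qed
    have "(\<lambda>n. S (w n) z) \<longlonglongrightarrow> (\<Sum>j\<in>UNIV - {k}. a j z * 0)"
      unfolding S_def by (intro tendsto_intros pd0) auto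
    then have "(\<lambda>n. d z + S (w n) z) \<longlonglongrightarrow> d z + 0" by (intro tendsto_add) auto
    moreover have "(\<lambda>n. \<Sum>j\<in>UNIV. a j z * partial j (\<lambda>z. \<Sum>i<Suc n. w i z) z) \<longlonglongrightarrow> (\<Sum>j\<in>UNIV. a j z * partial j u z)"
      by (intro tendsto_sum tendsto_mult tendsto_const LIMSEQ_Suc lim[OF z])
    ultimately show ?thesis unfolding partial by (simp add: LIMSEQ_unique)
  qed
  \<comment> \<open>Every iterate carries the factor \<open>z $ k - z0 $ k\<close> of
    \<open>primitive\<close>.\<close>
  have "u z = 0" if "z $ k = z0 $ k" for z
  proof -
    have "w n z = 0" for n using that by (cases n) (auto simp: w0 wS primitive_def)
    then show ?thesis by (simp add: u_def)
  qed
  then show ?thesis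
    using u eqn \<eta>(1) EQ QD by (intro exI[of _ u] exI[of _ ?E]) (auto intro: open_polydisc centre_in_polydisc)
qed

section \<open>Unimodular charts adapted to a vector field\<close>

definition jac :: "(complex ^ 'n::finite \<Rightarrow> complex ^ 'k::finite) \<Rightarrow> complex ^ 'n \<Rightarrow> complex ^ 'n ^ 'k" where
  "jac P z = (\<chi> i j. partial j (\<lambda>z. P z $ i) z)"

lemma jac_has_derivative:
  assumes "sv_holomorphic_map_on P D" "z \<in> D"
  shows "(P has_derivative (\<lambda>h. jac P z *v h)) (at z)"
  using sv_holomorphic_map_has_derivative[OF assms] by (simp add: jac_def)

lemma matrix_vector_mult_inject:
  fixes A B :: "'a::comm_ring_1 ^ 'n::finite ^ 'm::finite"
  shows "(\<lambda>h. A *v h) = (\<lambda>h. B *v h) \<longleftrightarrow> A = B"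
  by (metis matrix_eq)

lemma jac_eqI:
  assumes "sv_holomorphic_map_on P D" "z \<in> D" "(P has_derivative (\<lambda>h. A *v h)) (at z)"
  shows "jac P z = A"
  using has_derivative_unique[OF jac_has_derivative[OF assms(1,2)] assms(3)] matrix_vector_mult_inject by blast

lemma matrix_frechet_derivative:
  assumes "sv_holomorphic_map_on P D" "z \<in> D"
  shows "frechet_derivative P (at z) = (\<lambda>h. jac P z *v h)" "matrix (frechet_derivative P (at z)) = jac P z"
proof -
  show "frechet_derivative P (at z) = (\<lambda>h. jac P z *v h)"
    using frechet_derivative_at[OF jac_has_derivative[OF assms]] by simp
  then show "matrix (frechet_derivative P (at z)) = jac P z"
    by (simp add: matrix_of_matrix_vector_mul)
qed

lemma sv_holomorphic_map_on_compose:
  assumes "sv_holomorphic_map_on P E" "sv_holomorphic_map_on T D" "T ` D \<subseteq> E"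
  shows "sv_holomorphic_map_on (\<lambda>z. P (T z)) D"
  unfolding sv_holomorphic_map_on_def
proof
  fix i
  have "sv_holomorphic_on (\<lambda>z. P z $ i) E" using assms(1) by (simp add: sv_holomorphic_map_on_def)
  then show "sv_holomorphic_on (\<lambda>z. P (T z) $ i) D" by (rule sv_holomorphic_on_compose[OF _ assms(2,3)])
qed

lemma jac_compose:
  assumes P: "sv_holomorphic_map_on P E" and T: "sv_holomorphic_map_on T D" and TD: "T ` D \<subseteq> E" and z: "z \<in> D"
  shows "jac (\<lambda>z. P (T z)) z = jac P (T z) ** jac T z"
proof (rule jac_eqI[OF sv_holomorphic_map_on_compose[OF P T TD] z])
  have "T z \<in> E" using TD z by blast
  from has_derivative_compose[OF jac_has_derivative[OF T z] jac_has_derivative[OF P this]]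
  show "((\<lambda>z. P (T z)) has_derivative (\<lambda>h. (jac P (T z) ** jac T z) *v h)) (at z)"
    by (simp add: matrix_vector_mul_assoc)
qed

lemma jac_cong:
  assumes "open D" "z \<in> D" "\<And>w. w \<in> D \<Longrightarrow> P w = P' w"
  shows "jac P z = jac P' z"
proof -
  have "partial j (\<lambda>z. P z $ i) z = partial j (\<lambda>z. P' z $ i) z" for i j
    unfolding partial_def
  proof (rule deriv_cong_ev)
    have "open ((\<lambda>t. z + axis j t) -` D)"
      by (rule open_vimage[OF assms(1)]) (intro continuous_intros)
    then have "\<forall>\<^sub>F t in nhds 0. t \<in> (\<lambda>t. z + axis j t) -` D"
      using assms(2) by (intro eventually_nhds_in_open) auto
    then show "\<forall>\<^sub>F t in nhds 0. P (z + axis j t) $ i = P' (z + axis j t) $ i"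
      by eventually_elim (simp add: assms(3))
  qed simp
  then show ?thesis by (simp add: jac_def)
qed

lemma det_eq_0_if_kernel:
  fixes M :: "'a::field ^ 'n::finite ^ 'n"
  assumes "M *v a = 0" "a \<noteq> 0"
  shows "det M = 0"
proof (rule ccontr)
  assume "det M \<noteq> 0"
  then obtain B where "B ** M = mat 1" unfolding invertible_det_nz[symmetric] invertible_def by blast
  then have "a = B *v (M *v a)" by (simp add: matrix_vector_mul_assoc)
  with assms show False by simp
qed

text \<open>Multilinearity: the combination \<open>\<beta> A\<^sub>k - \<alpha> B\<^sub>k\<close> as
  k-th row gives a matrix that kills \<open>a\<close>, hence has determinant 0. For Jacobian
  matrices this is the contraction of a volume form with the vector \<open>a\<close>.\<close>

lemma det_row_ratio:
  fixes A B :: "'a::field ^ 'n::finite ^ 'n"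
  assumes rows: "\<And>i. i \<noteq> k \<Longrightarrow> A $ i = B $ i" and zero: "\<And>i. i \<noteq> k \<Longrightarrow> (A *v a) $ i = 0" and "a \<noteq> 0"
  shows "det A * (B *v a) $ k = det B * (A *v a) $ k"
proof -
  let ?\<alpha> = "(A *v a) $ k" and ?\<beta> = "(B *v a) $ k"
  let ?M = "(\<chi> i. if i = k then ?\<beta> *s A $ i + (- ?\<alpha>) *s B $ i else A $ i) :: 'a ^ 'n ^ 'n"
  have "?M *v a = 0"
  proof (subst vec_eq_iff, clarify)
    fix i
    have "(\<Sum>j\<in>UNIV. (?\<beta> * A $ k $ j - ?\<alpha> * B $ k $ j) * a $ j) = ?\<beta> * ?\<alpha> - ?\<alpha> * ?\<beta>"
      by (simp add: matrix_vector_mult_def left_diff_distrib sum_subtractf sum_distrib_left mult.assoc)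
    then show "(?M *v a) $ i = 0 $ i"
      using zero[of i] by (cases "i = k") (simp_all add: matrix_vector_mult_def)
  qed
  then have "det ?M = 0" using \<open>a \<noteq> 0\<close> by (rule det_eq_0_if_kernel)
  moreover have "det ?M = ?\<beta> * det (\<chi> i. if i = k then A $ i else A $ i) +
      (- ?\<alpha>) * det (\<chi> i. if i = k then B $ i else A $ i)"
    unfolding det_row_add det_row_mul ..
  moreover have "(\<chi> i. if i = k then A $ i else A $ i) = A" by (simp add: vec_eq_iff)
  moreover have "(\<chi> i. if i = k then B $ i else A $ i) = B" using rows by (simp add: vec_eq_iff)
  ultimately show ?thesis by (simp add: mult.commute)
qed

lemma matrix_vector_mult_axis: "((M :: 'a::comm_ring_1 ^ 'n::finite ^ 'm::finite) *v axis k 1) $ j = M $ j $ k"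
  by (simp add: matrix_vector_mult_def axis_def if_distrib[of "\<lambda>x. _ * x"] cong: if_cong)

lemma partial_nth: "partial j (\<lambda>z. z $ i) z = (if i = j then 1 else 0)"
  by (rule partial_eqI) (cases "i = j"; simp add: axis_nth_if; auto intro!: derivative_eq_intros)

lemma partial_diff:
  assumes "sv_holomorphic_on f D" "sv_holomorphic_on g D" "z \<in> D"
  shows "partial j (\<lambda>z. f z - g z) z = partial j f z - partial j g z"
  by (rule partial_eqI, rule DERIV_diff) (rule sv_holomorphic_DERIV0, fact, fact)+

lemma sv_holomorphic_on_det_jac:
  assumes "open D" "sv_holomorphic_map_on P D"
  shows "sv_holomorphic_on (\<lambda>z. det (jac P z)) D"
  using assms unfolding sv_holomorphic_map_on_def
  by (intro sv_holomorphic_on_det) (auto simp: jac_def intro!: sv_holomorphic_on_partial)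

text \<open>Once the rows other than \<open>k\<close> annihilate the field,
  \<open>det_row_ratio\<close> makes the determinant proportional to the derivative of the k-th
  component along the field. Prescribing the determinant is then a transport equation for that
  component.\<close>

theorem foliated_chart_local:
  fixes X :: "complex ^ 'n::finite \<Rightarrow> complex ^ 'n"
  assumes D: "open D" "z0 \<in> D" and X: "sv_holomorphic_map_on X D" "X z0 \<noteq> 0" and s: "sv_holomorphic_on s D"
  shows "\<exists>E P k. open E \<and> z0 \<in> E \<and> E \<subseteq> D \<and> sv_holomorphic_map_on P E \<and>
    (\<forall>z\<in>E. det (jac P z) = s z \<and> (\<forall>j. j \<noteq> k \<longrightarrow> (jac P z *v X z) $ j = 0))"
proof -
  obtain k where k: "X z0 $ k \<noteq> 0" using X(2) by (auto simp: vec_eq_iff)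
  have Xi: "sv_holomorphic_on (\<lambda>z. X z $ i) D" for i using X(1) by (simp add: sv_holomorphic_map_on_def)
  define D1 where "D1 = D \<inter> (\<lambda>z. X z $ k) -` (- {0})"
  have D1: "open D1" "z0 \<in> D1" "D1 \<subseteq> D" "\<And>z. z \<in> D1 \<Longrightarrow> X z $ k \<noteq> 0"
    unfolding D1_def using D k
    by (auto intro!: continuous_open_preimage sv_holomorphic_on_imp_continuous_on[OF Xi])
  \<comment> \<open>Rescaling keeps the tangent line, hence the first integrals, and makes the k-th
    coefficient 1.\<close>
  define a where "a j z = X z $ j / X z $ k" for j z
  have a: "sv_holomorphic_on (a j) D1" for j
    unfolding a_def using D1(4) by (intro sv_holomorphic_on_divide sv_holomorphic_on_subset[OF Xi D1(3)])
  have ak: "a k z = 1" if "z \<in> D1" for z using D1(4)[OF that] by (simp add: a_def)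
  \<comment> \<open>If \<open>u j\<close> has the same derivative along \<open>a\<close> as the
    coordinate \<open>z $ j\<close>, then \<open>z $ j - u j z\<close> is a first integral. The zero
    data on the slice will make these first integrals independent.\<close>
  define sol where "sol j u E \<longleftrightarrow> open E \<and> z0 \<in> E \<and> E \<subseteq> D1 \<and> sv_holomorphic_on u E \<and>
    (\<forall>z\<in>E. (\<Sum>i\<in>UNIV. a i z * partial i u z) = a j z) \<and> (\<forall>z\<in>E. z $ k = z0 $ k \<longrightarrow> u z = 0)" for j u E
  have "\<exists>u E. sol j u E" for j
    unfolding sol_def
    by (rule transport_equation_local[where a = a and D = D1 and k = k, OF D1(1,2) a ak a])
  then obtain u E where uE: "\<And>j. sol j (u j) (E j)" by metis
  note uE = uE[unfolded sol_def, THEN conjunct1] uE[unfolded sol_def, THEN conjunct2, THEN conjunct1]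
    uE[unfolded sol_def, THEN conjunct2, THEN conjunct2, THEN conjunct1]
    uE[unfolded sol_def, THEN conjunct2, THEN conjunct2, THEN conjunct2, THEN conjunct1]
    uE[unfolded sol_def, THEN conjunct2, THEN conjunct2, THEN conjunct2, THEN conjunct2, THEN conjunct1, rule_format]
    uE[unfolded sol_def, THEN conjunct2, THEN conjunct2, THEN conjunct2, THEN conjunct2, THEN conjunct2, rule_format]
  define E1 where "E1 = (\<Inter>j. E j)"
  have E1: "open E1" "z0 \<in> E1" "E1 \<subseteq> D1" unfolding E1_def using uE(1,2) uE(3)[of k] by (auto intro: open_INT)
  have u: "sv_holomorphic_on (u j) E1" for j
    by (rule sv_holomorphic_on_subset[OF uE(4)]) (auto simp: E1_def)
  \<comment> \<open>The k-th component is a placeholder with derivative 1 along \<open>a\<close>; it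
    is replaced by \<open>\<phi>\<close> below.\<close>
  define f where "f z = (\<chi> j. if j = k then z $ j else z $ j - u j z)" for z
  have f: "sv_holomorphic_map_on f E1"
    unfolding sv_holomorphic_map_on_def
  proof
    fix i show "sv_holomorphic_on (\<lambda>z. f z $ i) E1"
      by (cases "i = k") (auto simp: f_def intro!: sv_holomorphic_on_diff u)
  qed
  have jf: "jac f z $ i $ j = (if i = j then 1 else 0) - (if i = k then 0 else partial j (u i) z)" if "z \<in> E1" for z i j
    using partial_diff[OF sv_holomorphic_on_nth[of i] u[of i] that, of j]
    by (cases "i = k") (auto simp: jac_def f_def partial_nth)
  have split: "(\<Sum>j\<in>UNIV. ((if i = j then 1 else 0) - c j) * v $ j) = v $ i - (\<Sum>j\<in>UNIV. c j * v $ j)" for v :: "complex ^ 'n" and c i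
    by (simp add: left_diff_distrib sum_subtractf if_distrib[of "\<lambda>x. x * _"] cong: if_cong)
  let ?a = "\<lambda>z. \<chi> j. a j z"
  have jfa: "(jac f z *v ?a z) $ i = (if i = k then 1 else 0)" if z: "z \<in> E1" for z i
  proof -
    have "(jac f z *v ?a z) $ i = a i z - (\<Sum>j\<in>UNIV. (if i = k then 0 else partial j (u i) z) * a j z)"
      using split[where v = "?a z"] by (simp add: matrix_vector_mult_def jf[OF z])
    also have "\<dots> = (if i = k then 1 else 0)"
      using ak[of z] E1 z uE(5)[of z i] by (auto simp: E1_def mult.commute)
    finally show ?thesis .
  qed
  \<comment> \<open>For \<open>j \<noteq> k\<close> the j-th axis through \<open>z0\<close> lies in
    the slice on which \<open>u i\<close> vanishes.\<close>
  have pd0: "partial j (u i) z0 = 0" if "j \<noteq> k" for i j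
  proof -
    have "((\<lambda>t. 0) has_field_derivative 0) (at (0::complex))" by simp
    moreover have "open ((\<lambda>t. z0 + axis j t) -` E i)"
      by (rule open_vimage[OF uE(1)]) (intro continuous_intros)
    ultimately have "((\<lambda>t. u i (z0 + axis j t)) has_field_derivative 0) (at 0)"
      by (rule has_field_derivative_transform_within_open)
         (use uE(2) uE(6)[of _ i] that in \<open>auto simp: axis_nth_if\<close>)
    then show ?thesis by (rule partial_eqI)
  qed
  \<comment> \<open>At \<open>z0\<close> the Jacobian differs from the identity only in column
    \<open>k\<close>, off the diagonal. So row \<open>k\<close> forces \<open>v $ k = 0\<close>, and
    the other rows give the rest.\<close>
  have det0: "det (jac f z0) \<noteq> 0"
    unfolding invertible_det_nz[symmetric] invertible_left_inverse matrix_left_invertible_ker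
  proof (intro allI impI)
    fix v assume v: "jac f z0 *v v = 0"
    have eq: "v $ i - (if i = k then 0 else partial k (u i) z0) * v $ k = 0" for i
    proof -
      have "(\<Sum>j\<in>UNIV. (if i = k then 0 else partial j (u i) z0) * v $ j) =
          (\<Sum>j\<in>UNIV. if j = k then (if i = k then 0 else partial k (u i) z0) * v $ k else 0)"
        by (rule sum.cong) (use pd0 in auto)
      then show ?thesis
        using arg_cong[OF v, of "\<lambda>x. x $ i"] split[of i "\<lambda>j. if i = k then 0 else partial j (u i) z0" v]
        by (simp add: matrix_vector_mult_def jf[OF E1(2)])
    qed
    from eq[of k] have "v $ k = 0" by simp
    with eq show "v = 0" by (simp add: vec_eq_iff)
  qed
  have holo_det: "sv_holomorphic_on (\<lambda>z. det (jac f z)) E1" by (rule sv_holomorphic_on_det_jac[OF E1(1) f])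
  let ?E2 = "E1 \<inter> (\<lambda>z. det (jac f z)) -` (- {0})"
  from det0 holo_det have E2: "open ?E2" "z0 \<in> ?E2"
    using E1 by (auto intro!: continuous_open_preimage sv_holomorphic_on_imp_continuous_on)
  have sub: "?E2 \<subseteq> D1" "?E2 \<subseteq> E1" "?E2 \<subseteq> D" using E1 D1 by auto
  \<comment> \<open>By \<open>det_row_ratio\<close>, exchanging the placeholder for
    \<open>\<phi>\<close> multiplies the determinant by the derivative of \<open>\<phi>\<close>
    along \<open>a\<close>; this is the factor that turns it into \<open>s\<close>.\<close>
  define \<kappa> where "\<kappa> z = s z / det (jac f z)" for z
  have "sv_holomorphic_on \<kappa> ?E2"
    unfolding \<kappa>_def
    by (intro sv_holomorphic_on_divide sv_holomorphic_on_subset[OF holo_det sub(2)] sv_holomorphic_on_subset[OF s sub(3)]) auto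
  from transport_equation_local[where a = a and D = ?E2 and k = k and d = \<kappa>, OF E2 sv_holomorphic_on_subset[OF a sub(1)] ak this]
  obtain \<phi> E3 where E3: "open E3" "z0 \<in> E3" "E3 \<subseteq> ?E2" and \<phi>: "sv_holomorphic_on \<phi> E3"
    "\<And>z. z \<in> E3 \<Longrightarrow> (\<Sum>j\<in>UNIV. a j z * partial j \<phi> z) = \<kappa> z"
    using sub(1) by auto blast
  define P where "P z = (\<chi> j. if j = k then \<phi> z else f z $ j)" for z
  have P: "sv_holomorphic_map_on P E3"
    unfolding sv_holomorphic_map_on_def
  proof
    fix i
    have "sv_holomorphic_on (\<lambda>z. f z $ i) E3"
      using f E3(3) unfolding sv_holomorphic_map_on_def by (blast intro: sv_holomorphic_on_subset)
    with \<phi>(1) show "sv_holomorphic_on (\<lambda>z. P z $ i) E3" by (cases "i = k") (auto simp: P_def)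
  qed
  have "det (jac P z) = s z \<and> (\<forall>j. j \<noteq> k \<longrightarrow> (jac P z *v X z) $ j = 0)" if z: "z \<in> E3" for z
  proof
    have zE: "z \<in> E1" "det (jac f z) \<noteq> 0" "X z $ k \<noteq> 0" using z E3(3) sub(1) D1(4) by auto
    have rows: "jac f z $ i = jac P z $ i" if "i \<noteq> k" for i
      using that by (simp add: jac_def P_def vec_eq_iff)
    have "?a z \<noteq> 0"
      using ak[of z] zE(1) E1(3) by (auto simp: vec_eq_iff intro!: exI[of _ k])
    from det_row_ratio[OF rows _ this, of k] jfa[OF zE(1)]
    have "det (jac f z) * (jac P z *v ?a z) $ k = det (jac P z)" by simp
    moreover have "(jac P z *v ?a z) $ k = \<kappa> z"
      using \<phi>(2)[OF z] by (simp add: matrix_vector_mult_def jac_def P_def mult.commute)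
    ultimately show "det (jac P z) = s z" using zE(2) by (simp add: \<kappa>_def)
    show "\<forall>j. j \<noteq> k \<longrightarrow> (jac P z *v X z) $ j = 0"
    proof (intro allI impI)
      fix j assume "j \<noteq> k"
      have "X z = X z $ k *s ?a z" using zE(3) by (simp add: vec_eq_iff a_def)
      then have "(jac P z *v X z) $ j = X z $ k * (jac P z *v ?a z) $ j"
        by (metis vector_scalar_commute vector_smult_component)
      also have "(jac P z *v ?a z) $ j = (jac f z *v ?a z) $ j"
        using rows[OF \<open>j \<noteq> k\<close>] by (simp add: matrix_vector_mult_def)
      finally show "(jac P z *v X z) $ j = 0" using jfa[OF zE(1), of j] \<open>j \<noteq> k\<close> by simp
    qed
  qed
  then show ?thesis using E3 P sub(3) by (intro exI[of _ E3] exI[of _ P] exI[of _ k]) auto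
qed

text \<open>The slice of a polydisc parallel to an axis is a disc, so a vanishing derivative on it
  forces constancy. With \<open>c = 0\<close> this serves the first integrals, with general
  \<open>c\<close> the affine coordinate.\<close>

lemma partial_const_along_axis:
  assumes T: "sv_holomorphic_on T (polydisc x0 r)" 
    and zero: "\<And>\<tau>. y + axis k \<tau> \<in> polydisc x0 r \<Longrightarrow> partial k T (y + axis k \<tau>) = c"
    and y: "y \<in> polydisc x0 r" "y + axis k t \<in> polydisc x0 r"
  shows "T (y + axis k t) = T y + c * t"
proof -
  let ?S = "ball (x0 $ k - y $ k) r"
  have inQ: "y + axis k \<tau> \<in> polydisc x0 r" if "\<tau> \<in> ?S" for \<tau>
    using that y(1) by (auto simp: polydisc_def axis_nth_if dist_norm norm_minus_commute algebra_simps)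
  have S: "0 \<in> ?S" "t \<in> ?S"
    using y by (auto simp: polydisc_def axis_nth_if dist_norm norm_minus_commute algebra_simps dest: spec[of _ k])
  have "((\<lambda>\<tau>. T (y + axis k \<tau>) - c * \<tau>) has_field_derivative 0) (at \<tau> within ?S)" if "\<tau> \<in> ?S" for \<tau>
  proof -
    have "((\<lambda>\<tau>. T (y + axis k \<tau>)) has_field_derivative c) (at \<tau>)"
      using sv_holomorphic_DERIV[OF T inQ[OF that]] zero[OF inQ[OF that]] by simp
    then have "((\<lambda>\<tau>. T (y + axis k \<tau>) - c * \<tau>) has_field_derivative c - c * 1) (at \<tau>)"
      by (auto intro!: derivative_eq_intros)
    then show ?thesis by (auto intro: has_field_derivative_at_within)
  qed
  then obtain C where C: "\<And>\<tau>. \<tau> \<in> ?S \<Longrightarrow> T (y + axis k \<tau>) - c * \<tau> = C"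
    using has_field_derivative_zero_constant[of ?S "\<lambda>\<tau>. T (y + axis k \<tau>) - c * \<tau>"] by auto
  from C[OF S(1)] C[OF S(2)] show ?thesis by (simp add: algebra_simps)
qed

section \<open>Inverse functions and changes between unimodular charts\<close>

lemma linear_inverse_complex:
  fixes M K :: "complex ^ 'n::finite ^ 'n"
  assumes "K ** M = mat 1" "M ** K = mat 1"
  shows "inv (\<lambda>h. M *v h) = (\<lambda>h. K *v h)"
  by (rule inv_unique_comp) (auto simp: fun_eq_iff matrix_vector_mul_assoc assms)

text \<open>The real inverse function theorem gives a differentiable inverse. Its derivative is the
  functional inverse of a complex matrix, hence again a complex matrix, and this is
  holomorphy.\<close>

theorem holomorphic_inverse_function:
  fixes P :: "complex ^ 'n::finite \<Rightarrow> complex ^ 'n"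
  assumes D: "open D" "z0 \<in> D" and P: "sv_holomorphic_map_on P D" and det: "\<And>z. z \<in> D \<Longrightarrow> det (jac P z) \<noteq> 0"
  shows "\<exists>U V g. open U \<and> U \<subseteq> D \<and> z0 \<in> U \<and> open V \<and> P z0 \<in> V \<and> homeomorphism U V P g \<and>
    sv_holomorphic_map_on g V \<and> (\<forall>y\<in>V. jac P (g y) ** jac g y = mat 1)"
proof -
  define f' where "f' z = Blinfun (\<lambda>h. jac P z *v h)" for z
  have f': "blinfun_apply (f' z) = (\<lambda>h. jac P z *v h)" for z
    unfolding f'_def by (rule bounded_linear_Blinfun_apply) (rule matrix_vector_mul_bounded_linear)
  have der: "(P has_derivative blinfun_apply (f' z)) (at z)" if "z \<in> D" for z
    unfolding f' by (rule jac_has_derivative[OF P that])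
  have contpd: "continuous_on D (partial j (\<lambda>z. P z $ i))" for i j
    using P D unfolding sv_holomorphic_map_on_def
    by (intro sv_holomorphic_on_imp_continuous_on sv_holomorphic_on_partial) auto
  have cont: "continuous_on D f'"
  proof (rule continuous_on_blinfun_componentwise)
    fix h :: "complex ^ 'n"
    show "continuous_on D (\<lambda>z. blinfun_apply (f' z) h)"
      unfolding f' matrix_vector_mult_def jac_def
      by (intro continuous_on_vec_lambda continuous_on_sum continuous_on_mult continuous_on_const)
         (simp add: contpd)
  qed
  have K: "\<exists>K. K ** jac P z = mat 1 \<and> jac P z ** K = mat 1" if "z \<in> D" for z
    using det[OF that] unfolding invertible_det_nz[symmetric] invertible_def by blast
  then obtain K0 where K0: "K0 ** jac P z0 = mat 1" using D by blast
  define invf where "invf = Blinfun (\<lambda>h. K0 *v h)"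
  have invf: "blinfun_apply invf = (\<lambda>h. K0 *v h)"
    unfolding invf_def by (rule bounded_linear_Blinfun_apply) (rule matrix_vector_mul_bounded_linear)
  have "invf o\<^sub>L f' z0 = id_blinfun"
    by (rule blinfun_eqI) (simp add: invf f' matrix_vector_mul_assoc K0)
  from inverse_function_theorem[OF D(1) der cont D(2) this]
  obtain U V g g' where *: "open U" "U \<subseteq> D" "z0 \<in> U" "open V" "P z0 \<in> V" "homeomorphism U V P g"
    "\<And>y. y \<in> V \<Longrightarrow> (g has_derivative (g' y)) (at y)"
    "\<And>y. y \<in> V \<Longrightarrow> g' y = inv (blinfun_apply (f' (g y)))"
    by metis
  have gV: "g y \<in> U" "P (g y) = y" if "y \<in> V" for y
    using *(6) that by (auto simp: homeomorphism_def)
  have deriv: "\<exists>K. (g has_derivative (\<lambda>h. K *v h)) (at y)" if y: "y \<in> V" for y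
  proof -
    obtain K where "K ** jac P (g y) = mat 1" "jac P (g y) ** K = mat 1" using K gV(1)[OF y] *(2) by blast
    then have "g' y = (\<lambda>h. K *v h)" using *(8)[OF y] by (simp add: f' linear_inverse_complex)
    then show ?thesis using *(7)[OF y] by auto
  qed
  have g: "sv_holomorphic_map_on g V"
    unfolding sv_holomorphic_map_on_def sv_holomorphic_on_def
  proof (intro allI ballI)
    fix i y assume "y \<in> V"
    then obtain K where "(g has_derivative (\<lambda>h. K *v h)) (at y)" using deriv by blast
    then have "((\<lambda>y. g y $ i) has_derivative (\<lambda>h. (K *v h) $ i)) (at y)"
      by (rule bounded_linear.has_derivative[OF bounded_linear_vec_nth])
    moreover have "(K *v (a *s h)) $ i = a * (K *v h) $ i" for a h
      by (metis vector_scalar_commute vector_smult_component)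
    ultimately show "\<exists>L. ((\<lambda>y. g y $ i) has_derivative L) (at y) \<and> (\<forall>a v. L (a *s v) = a * L v)" by blast
  qed
  have "jac P (g y) ** jac g y = mat 1" if y: "y \<in> V" for y
  proof -
    have "jac P (g y) ** jac g y = jac (\<lambda>y. P (g y)) y"
      by (rule jac_compose[OF P g _ y, symmetric]) (use gV *(2) in auto)
    also have "\<dots> = jac (\<lambda>y. y) y" by (rule jac_cong[OF *(4) y gV(2)])
    also have "\<dots> = mat 1" by (simp add: jac_def partial_nth mat_def)
    finally show ?thesis .
  qed
  with * g show ?thesis by blast
qed

text \<open>In the coordinates \<open>P\<close> the map \<open>P'\<close> becomes a unimodular \<open>T\<close> whose components \<open>j \<noteq> k'\<close> do not depend on
  the \<open>k\<close>-th coordinate. So along a coordinate line the Jacobian matrix of \<open>T\<close> only changes in row \<open>k'\<close>, and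
  as its determinant stays \<open>1\<close>, \<open>\<partial>\<^sub>k T\<^sub>k\<^sub>'\<close> is constant.\<close>

theorem foliated_charts_affine:
  fixes P P' X :: "complex ^ 'n::finite \<Rightarrow> complex ^ 'n"
  assumes D: "open D" "z0 \<in> D" and P: "sv_holomorphic_map_on P D" and P': "sv_holomorphic_map_on P' D"
    and det: "\<And>z. z \<in> D \<Longrightarrow> det (jac P z) \<noteq> 0" "\<And>z. z \<in> D \<Longrightarrow> det (jac P' z) = det (jac P z)"
    and X: "\<And>z. z \<in> D \<Longrightarrow> X z \<noteq> 0"
      "\<And>z j. z \<in> D \<Longrightarrow> j \<noteq> k \<Longrightarrow> (jac P z *v X z) $ j = 0"
      "\<And>z j. z \<in> D \<Longrightarrow> j \<noteq> k' \<Longrightarrow> (jac P' z *v X z) $ j = 0"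
  shows "\<exists>N a b. open N \<and> z0 \<in> N \<and> N \<subseteq> D \<and> inj_on P N \<and> a \<noteq> 0 \<and>
    (\<forall>y\<in>N. (\<forall>j. j \<noteq> k \<longrightarrow> P y $ j = P z0 $ j) \<longrightarrow> P' y $ k' = a * P y $ k + b)"
proof -
  obtain U V g where *: "open U" "U \<subseteq> D" "z0 \<in> U" "open V" "P z0 \<in> V" "homeomorphism U V P g"
    and g: "sv_holomorphic_map_on g V" "\<And>y. y \<in> V \<Longrightarrow> jac P (g y) ** jac g y = mat 1"
    using holomorphic_inverse_function[OF D P det(1)] by blast
  have gV: "g y \<in> U" "P (g y) = y" if "y \<in> V" for y
    using *(6) that by (auto simp: homeomorphism_def)
  have gP: "g (P z) = z" if "z \<in> U" for z
    using *(6) that by (auto simp: homeomorphism_def)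
  define x0 where "x0 = P z0"
  obtain r where r: "0 < r" "polydisc x0 r \<subseteq> V" using polydisc_in_open[OF *(4,5)] by (auto simp: x0_def)
  let ?Q = "polydisc x0 r"
  have x0Q: "x0 \<in> ?Q" using r(1) by (rule centre_in_polydisc)
  define T where "T y = P' (g y)" for y
  have gQ: "sv_holomorphic_map_on g ?Q"
    using g(1) r(2) unfolding sv_holomorphic_map_on_def by (blast intro: sv_holomorphic_on_subset)
  have gD: "g ` ?Q \<subseteq> D" using gV(1) *(2) r(2) by blast
  have T: "sv_holomorphic_map_on T ?Q"
    unfolding T_def by (rule sv_holomorphic_map_on_compose[OF P' gQ gD])
  have Ti: "sv_holomorphic_on (\<lambda>y. T y $ i) ?Q" for i using T by (simp add: sv_holomorphic_map_on_def)
  have jacT: "jac T y = jac P' (g y) ** jac g y" if "y \<in> ?Q" for y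
    unfolding T_def by (rule jac_compose[OF P' gQ gD that])
  have detT: "det (jac T y) = 1" if y: "y \<in> ?Q" for y
  proof -
    have "det (jac P (g y)) * det (jac g y) = 1"
      using arg_cong[OF g(2), of y det] y r(2) by (auto simp: det_mul)
    then show ?thesis using det(2)[of "g y"] gD y by (auto simp: jacT det_mul)
  qed
  \<comment> \<open>In the coordinates \<open>P\<close> the field is a nonzero multiple of the k-th
    basis vector. So the k-th column of \<open>jac g y\<close> is a multiple of
    \<open>X (g y)\<close>, which the rows of \<open>jac P'\<close> other than \<open>k'\<close>
    annihilate.\<close>
  have col: "jac T y $ j $ k = 0" if y: "y \<in> ?Q" and j: "j \<noteq> k'" for y j
  proof -
    have gy: "g y \<in> D" using gD y by blast
    let ?v = "jac g y *v axis k 1"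
    define \<mu> where "\<mu> = (jac P (g y) *v X (g y)) $ k"
    have PX: "jac P (g y) *v X (g y) = \<mu> *s axis k 1"
      using X(2)[OF gy] by (auto simp: vec_eq_iff \<mu>_def axis_nth_if)
    have "\<mu> \<noteq> 0"
    proof
      assume "\<mu> = 0"
      then have "det (jac P (g y)) = 0" using PX X(1)[OF gy] by (intro det_eq_0_if_kernel) auto
      with det(1)[OF gy] show False by simp
    qed
    have "jac P (g y) *v (X (g y) - \<mu> *s ?v) = 0"
    proof -
      have "jac P (g y) *v ?v = axis k 1" using g(2)[of y] y r(2) by (auto simp: matrix_vector_mul_assoc)
      then show ?thesis by (simp add: matrix_vector_mult_diff_distrib PX vector_scalar_commute)
    qed
    then have "X (g y) - \<mu> *s ?v = 0" using det(1)[OF gy] det_eq_0_if_kernel by blast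
    then have "(jac P' (g y) *v (\<mu> *s ?v)) $ j = 0" using X(3)[OF gy j] by simp
    then have "(jac P' (g y) *v ?v) $ j = 0" using \<open>\<mu> \<noteq> 0\<close> by (simp add: vector_scalar_commute)
    then have "(jac T y *v axis k 1) $ j = 0" by (simp add: jacT[OF y] matrix_vector_mul_assoc)
    then show ?thesis by (simp add: matrix_vector_mult_axis)
  qed
  have indep: "T (y + axis k t) $ j = T y $ j" if "y \<in> ?Q" "y + axis k t \<in> ?Q" "j \<noteq> k'" for y t j
    using partial_const_along_axis[OF Ti[of j], where k = k and c = 0 and y = y and t = t] col[OF _ that(3)] that by (auto simp: jac_def)
  define \<alpha> where "\<alpha> = jac T x0 $ k' $ k"
  have \<alpha>: "jac T (x0 + axis k t) $ k' $ k = \<alpha>" if t: "x0 + axis k t \<in> ?Q" for t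
  proof -
    have rows: "jac T (x0 + axis k t) $ j = jac T x0 $ j" if "j \<noteq> k'" for j
    proof -
      have "partial i (\<lambda>y. T y $ j) (x0 + axis k t) = partial i (\<lambda>y. T y $ j) x0" for i
        unfolding partial_def
      proof (rule deriv_cong_ev)
        \<comment> \<open>Invariance of the j-th component under the shift by
          \<open>axis k t\<close> holds at all points near \<open>x0\<close>, so its derivatives in
          every direction are invariant too.\<close>
        let ?S = "(\<lambda>\<tau>. x0 + axis i \<tau>) -` ?Q \<inter> (\<lambda>\<tau>. (x0 + axis i \<tau>) + axis k t) -` ?Q"
        have "open ?S" by (intro open_Int open_vimage[OF open_polydisc] continuous_intros)
        then have "\<forall>\<^sub>F \<tau> in nhds 0. \<tau> \<in> ?S"
          using t x0Q by (intro eventually_nhds_in_open) auto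
        then show "\<forall>\<^sub>F \<tau> in nhds 0. T (x0 + axis k t + axis i \<tau>) $ j = T (x0 + axis i \<tau>) $ j"
        proof eventually_elim
          case (elim \<tau>)
          then have "T ((x0 + axis i \<tau>) + axis k t) $ j = T (x0 + axis i \<tau>) $ j"
            by (intro indep that) auto
          moreover have "(x0 + axis i \<tau>) + axis k t = x0 + axis k t + axis i \<tau>" by simp
          ultimately show ?case by metis
        qed
      qed simp
      then show ?thesis by (simp add: jac_def vec_eq_iff)
    qed
    have "det (jac T (x0 + axis k t)) * (jac T x0 *v axis k 1) $ k' =
        det (jac T x0) * (jac T (x0 + axis k t) *v axis k 1) $ k'"
      by (rule det_row_ratio[OF rows]) (use col[OF t] in \<open>auto simp: matrix_vector_mult_axis\<close>)
    then show ?thesis by (simp add: detT[OF t] detT[OF x0Q] matrix_vector_mult_axis \<alpha>_def)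
  qed
  have "\<alpha> \<noteq> 0"
  proof
    assume "\<alpha> = 0"
    then have "jac T x0 $ j $ k = 0" for j
      using col[OF x0Q, of j] by (cases "j = k'") (auto simp: \<alpha>_def)
    then have "jac T x0 *v axis k 1 = 0" by (simp add: matrix_vector_mult_axis vec_eq_iff)
    then have "det (jac T x0) = 0" by (rule det_eq_0_if_kernel) simp
    then show False using detT[OF x0Q] by simp
  qed
  have line: "T (x0 + axis k t) $ k' = T x0 $ k' + \<alpha> * t" if t: "x0 + axis k t \<in> ?Q" for t
    using partial_const_along_axis[OF Ti[of k'], where k = k and c = \<alpha> and y = x0 and t = t] \<alpha> t x0Q by (simp add: jac_def)
  \<comment> \<open>Points of \<open>N\<close> that agree with \<open>z0\<close> in all first
    integrals are mapped to the axis slice of the polydisc through \<open>x0\<close>, where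
    \<open>line\<close> applies.\<close>
  define N where "N = U \<inter> P -` ?Q"
  have "open N" unfolding N_def
    using *(1,6) by (intro continuous_open_preimage open_polydisc) (auto simp: homeomorphism_def)
  moreover have "z0 \<in> N" using *(3) x0Q by (simp add: N_def x0_def)
  moreover have "N \<subseteq> D" using *(2) by (auto simp: N_def)
  moreover have "inj_on P N" by (rule inj_on_inverseI[of _ g]) (simp add: N_def gP)
  moreover have "P' y $ k' = \<alpha> * P y $ k + (T x0 $ k' - \<alpha> * x0 $ k)"
    if y: "y \<in> N" and eq: "\<And>j. j \<noteq> k \<Longrightarrow> P y $ j = P z0 $ j" for y
  proof -
    have Py: "P y = x0 + axis k (P y $ k - x0 $ k)"
      using eq by (auto simp: vec_eq_iff axis_nth_if x0_def)
    have "P' y = T (x0 + axis k (P y $ k - x0 $ k))"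
      using y by (simp add: T_def gP N_def flip: Py)
    then show ?thesis using line[of "P y $ k - x0 $ k"] y by (simp add: N_def algebra_simps flip: Py)
  qed
  ultimately show ?thesis using \<open>\<alpha> \<noteq> 0\<close> by blast
qed

section \<open>Adapted charts and leaves on the manifold\<close>

lemma chart_simps:
  assumes "is_chart c"
  shows "p \<in> dom_of c \<Longrightarrow> param c (coord c p) = p"
    "z \<in> coord c ` dom_of c \<Longrightarrow> coord c (param c z) = z"
    "z \<in> coord c ` dom_of c \<Longrightarrow> param c z \<in> dom_of c"
    "open (dom_of c)" "continuous_on (dom_of c) (coord c)"
  using assms unfolding is_chart_def homeomorphism_def by auto

lemma open_chart_image:
  assumes c: "is_chart c" and "open W"
  shows "open (coord c ` (dom_of c \<inter> W))"
proof -
  have "coord c ` (dom_of c \<inter> W) = coord c ` dom_of c \<inter> param c -` W"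
    using chart_simps[OF c] by (auto simp: image_iff)
  also have "open \<dots>"
    using c \<open>open W\<close> unfolding is_chart_def homeomorphism_def by (intro continuous_open_preimage) auto
  finally show ?thesis .
qed

lemma open_chart_preimage:
  assumes "is_chart c" "open N"
  shows "open (dom_of c \<inter> coord c -` N)"
  using chart_simps(4,5)[OF assms(1)] assms(2) by (intro continuous_open_preimage)

lemma tangent_discD:
  assumes "tangent_disc A F \<gamma>"
  shows "continuous_on (ball 0 1) \<gamma>" "\<And>t. t \<in> ball 0 1 \<Longrightarrow> \<gamma> t \<notin> sing A F"
    "\<And>c i. c \<in> A \<Longrightarrow> (\<lambda>t. coord c (\<gamma> t) $ i) holomorphic_on {t \<in> ball 0 1. \<gamma> t \<in> dom_of c}"
    "\<And>t U Z c. t \<in> ball 0 1 \<Longrightarrow> (U, Z) \<in> F \<Longrightarrow> c \<in> A \<Longrightarrow> \<gamma> t \<in> U \<Longrightarrow> \<gamma> t \<in> dom_of c \<Longrightarrow>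
      \<exists>a. a \<noteq> 0 \<and> (\<forall>i. deriv (\<lambda>s. coord c (\<gamma> s) $ i) t = a * Z c (\<gamma> t) $ i)"
  using assms unfolding tangent_disc_def by blast+

lemma tangent_disc_ball_into_open:
  assumes "continuous_on (ball 0 1) \<gamma>" "open N" "t0 \<in> ball (0::complex) 1" "\<gamma> t0 \<in> N"
  shows "\<exists>\<delta>>0. ball t0 \<delta> \<subseteq> ball 0 1 \<and> \<gamma> ` ball t0 \<delta> \<subseteq> N"
proof -
  have "open (ball 0 1 \<inter> \<gamma> -` N)" using assms(1,2) by (intro continuous_open_preimage) auto
  then obtain \<delta> where "0 < \<delta>" "ball t0 \<delta> \<subseteq> ball 0 1 \<inter> \<gamma> -` N"
    using assms(3,4) openE by (metis IntI vimageI)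
  then show ?thesis by (intro exI[of _ \<delta>]) auto
qed

text \<open>\<open>s\<close> is a holomorphic volume form: \<open>s c\<close> is its coefficient
  with respect to the coordinate frame of \<open>c\<close>.\<close>

locale trivialized_foliation =
  fixes A :: "('m::t2_space, 'n::finite) chart set" and F :: "('m, 'n) foliation_data"
    and s :: "('m, 'n) chart \<Rightarrow> 'm \<Rightarrow> complex"
  assumes atlas: "complex_atlas A" and foliation: "foliation A F"
    and s_section: "holo_line_bundle_section A canonical_cocycle s"
    and s_nz: "\<And>c p. c \<in> A \<Longrightarrow> p \<in> dom_of c \<Longrightarrow> s c p \<noteq> 0"
begin

lemma chart: "c \<in> A \<Longrightarrow> is_chart c"
  using atlas by (simp add: complex_atlas_def)

lemma obtain_chart: obtains c where "c \<in> A" "p \<in> dom_of c"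
  using atlas unfolding complex_atlas_def by blast

lemma transition_holomorphic:
  "c \<in> A \<Longrightarrow> c' \<in> A \<Longrightarrow> sv_holomorphic_map_on (transition c c') (coord c ` (dom_of c \<inter> dom_of c'))"
  using atlas by (auto simp: complex_atlas_def holo_compatible_def)

lemma change_diff_eq:
  assumes "c \<in> A" "c' \<in> A" "p \<in> dom_of c" "p \<in> dom_of c'"
  shows "change_diff c c' p = (\<lambda>h. jac (transition c c') (coord c p) *v h)"
    "canonical_cocycle c c' p = det (jac (transition c c') (coord c p))"
proof -
  have "coord c p \<in> coord c ` (dom_of c \<inter> dom_of c')" using assms by blast
  from matrix_frechet_derivative[OF transition_holomorphic[OF assms(1,2)] this]
  show "change_diff c c' p = (\<lambda>h. jac (transition c c') (coord c p) *v h)"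
    "canonical_cocycle c c' p = det (jac (transition c c') (coord c p))"
    by (simp_all add: change_diff_def canonical_cocycle_def)
qed

section \<open>Generators of the foliation and adapted charts\<close>

lemma obtain_vfield: obtains V Z where "(V, Z) \<in> F" "p \<in> V"
proof -
  have "p \<in> (\<Union>(U, Z)\<in>F. U)" using foliation by (simp add: foliation_def)
  then show ?thesis using that by auto
qed

lemma vfield:
  assumes "(V, Z) \<in> F"
  shows "open V" "holo_vfield_on A V Z"
  using assms foliation unfolding foliation_def by blast+

lemma vfield_change:
  assumes "(V, Z) \<in> F" "c \<in> A" "c' \<in> A" "p \<in> dom_of c" "p \<in> dom_of c'" "p \<in> V"
  shows "Z c' p = jac (transition c c') (coord c p) *v Z c p"
proof -
  have "Z c' p = change_diff c c' p (Z c p)"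
    using vfield(2)[OF assms(1)] assms(2-6) unfolding holo_vfield_on_def by blast
  then show ?thesis by (simp only: change_diff_eq(1)[OF assms(2-5)])
qed

lemma vfield_proportional:
  assumes "(V, Z) \<in> F" "(W, Y) \<in> F" "p \<in> V" "p \<in> W" "c \<in> A" "p \<in> dom_of c"
  shows "\<exists>a. a \<noteq> 0 \<and> Z c p = a *s Y c p"
proof -
  obtain g where "\<forall>p \<in> V \<inter> W. g p \<noteq> 0 \<and> (\<forall>c\<in>A. p \<in> dom_of c \<longrightarrow> Z c p = g p *s Y c p)"
    using foliation assms(1,2) unfolding foliation_def by blast
  with assms show ?thesis by blast
qed

text \<open>Generators differ by nonzero factors and coordinate changes act linearly, so one
  generator in one chart decides.\<close>

lemma sing_iff:
  assumes "(V, Z) \<in> F" "p \<in> V" "c \<in> A" "p \<in> dom_of c"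
  shows "p \<in> sing A F \<longleftrightarrow> Z c p = 0"
proof
  assume "p \<in> sing A F"
  then obtain W Y where WY: "(W, Y) \<in> F" "p \<in> zero_set A W Y" unfolding sing_def by auto
  then have "p \<in> W" "Y c p = 0" using assms by (auto simp: zero_set_def)
  then show "Z c p = 0" using vfield_proportional[OF assms(1) WY(1) assms(2) _ assms(3,4)] by auto
next
  assume "Z c p = 0"
  then have "Z c' p = 0" if "c' \<in> A" "p \<in> dom_of c'" for c'
    using vfield_change[OF assms(1,3) that(1) assms(4) that(2) assms(2)] by simp
  then show "p \<in> sing A F" using assms unfolding sing_def zero_set_def by blast
qed

text \<open>The \<open>k\<close>-th component is the affine coordinate, the others are first integrals.\<close>

definition adapted :: "'n \<Rightarrow> 'm set \<Rightarrow> ('m \<Rightarrow> complex ^ 'n) \<Rightarrow> bool" where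
  "adapted k U \<Psi> \<longleftrightarrow> open U \<and> U \<inter> sing A F = {} \<and>
     (\<forall>c\<in>A. sv_holomorphic_map_on (\<lambda>z. \<Psi> (param c z)) (coord c ` (dom_of c \<inter> U)) \<and>
       (\<forall>p \<in> dom_of c \<inter> U. det (jac (\<lambda>z. \<Psi> (param c z)) (coord c p)) = s c p \<and>
          (\<forall>V Z j. (V, Z) \<in> F \<longrightarrow> p \<in> V \<longrightarrow> j \<noteq> k \<longrightarrow> (jac (\<lambda>z. \<Psi> (param c z)) (coord c p) *v Z c p) $ j = 0)))"

lemma adaptedD:
  assumes "adapted k U \<Psi>"
  shows "open U" "\<And>p. p \<in> U \<Longrightarrow> p \<notin> sing A F"
    "\<And>c. c \<in> A \<Longrightarrow> sv_holomorphic_map_on (\<lambda>z. \<Psi> (param c z)) (coord c ` (dom_of c \<inter> U))"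
    "\<And>c p. c \<in> A \<Longrightarrow> p \<in> dom_of c \<Longrightarrow> p \<in> U \<Longrightarrow> det (jac (\<lambda>z. \<Psi> (param c z)) (coord c p)) = s c p"
    "\<And>c p V Z j. c \<in> A \<Longrightarrow> p \<in> dom_of c \<Longrightarrow> p \<in> U \<Longrightarrow> (V, Z) \<in> F \<Longrightarrow> p \<in> V \<Longrightarrow> j \<noteq> k \<Longrightarrow>
       (jac (\<lambda>z. \<Psi> (param c z)) (coord c p) *v Z c p) $ j = 0"
  using assms unfolding adapted_def by blast+

text \<open>Otherwise all components of the derivative along \<open>Z\<close> would vanish, and the
  Jacobian, whose determinant is \<open>s\<close>, would kill a nonzero vector.\<close>

lemma adapted_transversal:
  assumes \<Psi>: "adapted k U \<Psi>" and c: "c \<in> A" "p \<in> dom_of c" and p: "p \<in> U" and Z: "(V, Z) \<in> F" "p \<in> V"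
  shows "(jac (\<lambda>z. \<Psi> (param c z)) (coord c p) *v Z c p) $ k \<noteq> 0"
proof
  let ?J = "jac (\<lambda>z. \<Psi> (param c z)) (coord c p)"
  assume "(?J *v Z c p) $ k = 0"
  then have "(?J *v Z c p) $ j = 0" for j
    using adaptedD(5)[OF \<Psi> c p Z, of j] by (cases "j = k") auto
  then have "?J *v Z c p = 0" by (simp add: vec_eq_iff)
  moreover have "Z c p \<noteq> 0" using sing_iff[OF Z(1,2) c] adaptedD(2)[OF \<Psi> p] by simp
  ultimately have "det ?J = 0" by (rule det_eq_0_if_kernel)
  then show False using adaptedD(4)[OF \<Psi> c p] s_nz[OF c] by simp
qed

text \<open>The construction takes place in one chart \<open>c\<close>. In any other chart the
  determinant acquires the factor \<open>canonical_cocycle\<close>, which is how the coefficients of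
  \<open>s\<close> transform, so unimodularity does not depend on the chart.\<close>

theorem adapted_exists:
  assumes "p0 \<notin> sing A F"
  shows "\<exists>k U \<Psi>. p0 \<in> U \<and> adapted k U \<Psi>"
proof -
  obtain U0 Z0 where UZ: "(U0, Z0) \<in> F" "p0 \<in> U0" by (rule obtain_vfield)
  obtain c where c: "c \<in> A" "p0 \<in> dom_of c" by (rule obtain_chart)
  note ch = chart_simps[OF chart[OF c(1)]]
  let ?D = "coord c ` (dom_of c \<inter> U0)"
  let ?X = "\<lambda>z. Z0 c (param c z)"
  have D: "open ?D" using vfield(1)[OF UZ(1)] by (intro open_chart_image chart c)
  have z0: "coord c p0 \<in> ?D" using UZ(2) c(2) by blast
  have X: "sv_holomorphic_map_on ?X ?D"
    using vfield(2)[OF UZ(1)] c(1) by (simp add: holo_vfield_on_def o_def)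
  have X0: "?X (coord c p0) \<noteq> 0"
    using sing_iff[OF UZ c] assms ch(1)[OF c(2)] by simp
  have sD: "sv_holomorphic_on (\<lambda>z. s c (param c z)) ?D"
    using s_section c(1) unfolding holo_line_bundle_section_def holo_fun_on_def
    by (auto simp: o_def intro: sv_holomorphic_on_subset)
  obtain E P k where E: "open E" "coord c p0 \<in> E" "E \<subseteq> ?D" and P: "sv_holomorphic_map_on P E"
    "\<And>z. z \<in> E \<Longrightarrow> det (jac P z) = s c (param c z)"
    "\<And>z j. z \<in> E \<Longrightarrow> j \<noteq> k \<Longrightarrow> (jac P z *v ?X z) $ j = 0"
    using foliated_chart_local[OF D z0 X X0 sD] by blast
  have "continuous_on E ?X"
  proof -
    have "continuous_on ?D (\<lambda>z. \<chi> i. ?X z $ i)"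
      using X unfolding sv_holomorphic_map_on_def
      by (intro continuous_on_vec_lambda sv_holomorphic_on_imp_continuous_on) blast
    then show ?thesis using E(3) by (simp add: continuous_on_subset)
  qed
  \<comment> \<open>Shrinking to the points where the generator is nonzero keeps the chart off the
    singular set.\<close>
  define E' where "E' = E \<inter> ?X -` (- {0})"
  have E': "open E'" "coord c p0 \<in> E'" "E' \<subseteq> E" "\<And>z. z \<in> E' \<Longrightarrow> ?X z \<noteq> 0"
    using E X0 \<open>continuous_on E ?X\<close> by (auto simp: E'_def intro!: continuous_open_preimage)
  define U where "U = dom_of c \<inter> coord c -` E'"
  have U: "open U" "p0 \<in> U" "U \<subseteq> dom_of c"
    unfolding U_def using E' c by (auto intro: open_chart_preimage chart)
  have UU0: "q \<in> U0" "Z0 c q \<noteq> 0" if q: "q \<in> U" for q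
  proof -
    have "coord c q \<in> ?D" "q \<in> dom_of c" using q E'(3) E(3) by (auto simp: U_def)
    then obtain q' where "q' \<in> dom_of c" "q' \<in> U0" "coord c q = coord c q'" by blast
    then show "q \<in> U0" using ch(1) \<open>q \<in> dom_of c\<close> by metis
    show "Z0 c q \<noteq> 0" using E'(4)[of "coord c q"] q ch(1)[OF \<open>q \<in> dom_of c\<close>] by (simp add: U_def)
  qed
  let ?\<Psi> = "\<lambda>q. P (coord c q)"
  have "adapted k U ?\<Psi>"
    unfolding adapted_def
  proof (intro conjI ballI allI impI)
    show "open U" by (rule U)
    show "U \<inter> sing A F = {}"
      using UU0 sing_iff[OF UZ(1) _ c(1)] U(3) by blast
    fix c' assume c': "c' \<in> A"
    note ch' = chart_simps[OF chart[OF c']]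
    let ?T = "transition c' c"
    have eq: "(\<lambda>z. ?\<Psi> (param c' z)) = (\<lambda>z. P (?T z))" by (simp add: transition_def)
    have T: "sv_holomorphic_map_on ?T (coord c' ` (dom_of c' \<inter> U))"
      using transition_holomorphic[OF c' c(1)] U(3) unfolding sv_holomorphic_map_on_def
      by (blast intro: sv_holomorphic_on_subset)
    have Tq: "?T (coord c' q) = coord c q" if "q \<in> dom_of c'" for q
      using ch'(1)[OF that] by (simp add: transition_def)
    have TE: "?T ` (coord c' ` (dom_of c' \<inter> U)) \<subseteq> E"
      using Tq E'(3) by (auto simp: U_def)
    show "sv_holomorphic_map_on (\<lambda>z. ?\<Psi> (param c' z)) (coord c' ` (dom_of c' \<inter> U))"
      unfolding eq by (rule sv_holomorphic_map_on_compose[OF P(1) T TE])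
    fix q assume q: "q \<in> dom_of c' \<inter> U"
    have qc: "q \<in> dom_of c" "q \<in> dom_of c'" "coord c q \<in> E" using q E'(3) by (auto simp: U_def)
    have J: "jac (\<lambda>z. ?\<Psi> (param c' z)) (coord c' q) = jac P (coord c q) ** jac ?T (coord c' q)"
      unfolding eq using jac_compose[OF P(1) T TE, of "coord c' q"] q Tq[of q] by auto
    have "s c' q = canonical_cocycle c' c q * s c q"
      using s_section c(1) c' qc unfolding holo_line_bundle_section_def by blast
    then show "det (jac (\<lambda>z. ?\<Psi> (param c' z)) (coord c' q)) = s c' q"
      using P(2)[OF qc(3)] ch(1)[OF qc(1)] by (simp add: J det_mul change_diff_eq(2)[OF c' c(1) qc(2,1)] mult.commute)
    show "(jac (\<lambda>z. ?\<Psi> (param c' z)) (coord c' q) *v Z c' q) $ j = 0"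
      if VZF: "(V, Z) \<in> F" and qV: "q \<in> V" and j: "j \<noteq> k" for V Z j
    proof -
      have "q \<in> U0" using UU0 q by blast
      obtain a where a: "a \<noteq> 0" "Z c q = a *s Z0 c q"
        using vfield_proportional[OF VZF UZ(1) qV \<open>q \<in> U0\<close> c(1) qc(1)] by blast
      have "jac (\<lambda>z. ?\<Psi> (param c' z)) (coord c' q) *v Z c' q = jac P (coord c q) *v Z c q"
        unfolding J using vfield_change[OF VZF c' c(1) qc(2,1) qV] by (simp add: matrix_vector_mul_assoc)
      also have "\<dots> = a *s (jac P (coord c q) *v Z0 c q)" using a by (simp add: vector_scalar_commute)
      finally show ?thesis
        using P(3)[OF qc(3) j] ch(1)[OF qc(1)] by simp
    qed
  qed
  with U(2) show ?thesis by blast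
qed

lemma adapted_component_diff:
  assumes \<Psi>: "adapted k U \<Psi>" and c: "c \<in> A" "p \<in> dom_of c" and p: "p \<in> U"
  shows "diff_at c (\<lambda>q. \<Psi> q $ k) p = (\<lambda>h. (jac (\<lambda>z. \<Psi> (param c z)) (coord c p) *v h) $ k)"
proof -
  have "((\<lambda>z. \<Psi> (param c z)) has_derivative (\<lambda>h. jac (\<lambda>z. \<Psi> (param c z)) (coord c p) *v h)) (at (coord c p))"
    by (rule jac_has_derivative[OF adaptedD(3)[OF \<Psi> c(1)]]) (use c p in blast)
  then have "((\<lambda>z. \<Psi> (param c z) $ k) has_derivative (\<lambda>h. (jac (\<lambda>z. \<Psi> (param c z)) (coord c p) *v h) $ k)) (at (coord c p))"
    by (rule bounded_linear.has_derivative[OF bounded_linear_vec_nth])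
  from frechet_derivative_at[OF this] show ?thesis by (simp add: diff_at_def o_def)
qed

lemma adapted_submersion:
  assumes \<Psi>: "adapted k U \<Psi>"
  shows "holo_submersion_on A U (\<lambda>q. \<Psi> q $ k)" "transverse_on A F U (\<lambda>q. \<Psi> q $ k)"
proof -
  show "transverse_on A F U (\<lambda>q. \<Psi> q $ k)"
    unfolding transverse_on_def
    using adapted_transversal[OF \<Psi>] by (auto simp: adapted_component_diff[OF \<Psi>])
  show "holo_submersion_on A U (\<lambda>q. \<Psi> q $ k)"
    unfolding holo_submersion_on_def
  proof (intro conjI ballI impI)
    show "holo_fun_on A U (\<lambda>q. \<Psi> q $ k)"
      using adaptedD(3)[OF \<Psi>] unfolding holo_fun_on_def sv_holomorphic_map_on_def by (simp add: o_def)
    fix p c assume p: "p \<in> U" and c: "c \<in> A" "p \<in> dom_of c"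
    let ?J = "jac (\<lambda>z. \<Psi> (param c z)) (coord c p)"
    obtain V Z where VZ: "(V, Z) \<in> F" "p \<in> V" by (rule obtain_vfield)
    let ?m = "(?J *v Z c p) $ k"
    have m: "?m \<noteq> 0" by (rule adapted_transversal[OF \<Psi> c p VZ])
    have "(?J *v ((w / ?m) *s Z c p)) $ k = w" for w
      using m by (simp add: vector_scalar_commute)
    then show "surj (diff_at c (\<lambda>q. \<Psi> q $ k) p)"
      unfolding adapted_component_diff[OF \<Psi> c p] by (rule surjI)
  qed
qed

section \<open>Tangent discs and the leaf topology\<close>

lemma tangent_disc_DERIV:
  assumes \<gamma>: "tangent_disc A F \<gamma>" and c: "c \<in> A" and t: "t \<in> ball 0 1" "\<gamma> t \<in> dom_of c"
  shows "((\<lambda>s. coord c (\<gamma> s) $ i) has_field_derivative deriv (\<lambda>s. coord c (\<gamma> s) $ i) t) (at t)"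
proof -
  have "{t \<in> ball 0 1. \<gamma> t \<in> dom_of c} = ball 0 1 \<inter> \<gamma> -` dom_of c" by auto
  then have "open {t \<in> ball 0 1. \<gamma> t \<in> dom_of c}"
    using continuous_open_preimage[OF tangent_discD(1)[OF \<gamma>] open_ball chart_simps(4)[OF chart[OF c]]] by simp
  then show ?thesis
    using holomorphic_derivI[OF tangent_discD(3)[OF \<gamma> c]] t by blast
qed

text \<open>Plaques are parametrised by the unit disc; rescaling turns small discs inside a plaque
  into plaques, hence into basic open sets of the leaf topology.\<close>

lemma tangent_disc_rescale:
  assumes \<gamma>: "tangent_disc A F \<gamma>" and \<delta>: "0 < \<delta>" "ball t0 \<delta> \<subseteq> ball 0 1"
  shows "tangent_disc A F (\<lambda>t. \<gamma> (t0 + of_real \<delta> * t))"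
    "(\<lambda>t. \<gamma> (t0 + of_real \<delta> * t)) ` ball 0 1 = \<gamma> ` ball t0 \<delta>"
    "inj_on \<gamma> (ball 0 1) \<Longrightarrow> inj_on (\<lambda>t. \<gamma> (t0 + of_real \<delta> * t)) (ball 0 1)"
proof -
  let ?h = "\<lambda>t. t0 + of_real \<delta> * t"
  have h: "?h t \<in> ball t0 \<delta>" if "t \<in> ball 0 1" for t
    using that \<delta>(1) by (simp add: dist_norm norm_mult)
  have h1: "?h t \<in> ball 0 1" if "t \<in> ball 0 1" for t using h[OF that] \<delta>(2) by blast
  have img: "?h ` ball 0 1 = ball t0 \<delta>"
  proof
    show "ball t0 \<delta> \<subseteq> ?h ` ball 0 1"
    proof
      fix u assume u: "u \<in> ball t0 \<delta>"
      have "u = ?h ((u - t0) / of_real \<delta>)" using \<delta>(1) by simp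
      moreover have "(u - t0) / of_real \<delta> \<in> ball 0 1"
        using u \<delta>(1) by (simp add: norm_divide dist_norm norm_minus_commute)
      ultimately show "u \<in> ?h ` ball 0 1" by blast
    qed
  qed (use h in blast)
  show "(\<lambda>t. \<gamma> (?h t)) ` ball 0 1 = \<gamma> ` ball t0 \<delta>"
    unfolding img[symmetric] by (simp add: image_image)
  show "inj_on (\<lambda>t. \<gamma> (?h t)) (ball 0 1)" if inj: "inj_on \<gamma> (ball 0 1)"
  proof (rule inj_onI)
    fix t u assume "t \<in> ball (0::complex) 1" "u \<in> ball (0::complex) 1" "\<gamma> (?h t) = \<gamma> (?h u)"
    then have "?h t = ?h u" using inj h1 by (meson inj_onD)
    then show "t = u" using \<delta>(1) by simp
  qed
  have der: "((\<lambda>t. coord c (\<gamma> (?h t)) $ i) has_field_derivative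
      of_real \<delta> * deriv (\<lambda>s. coord c (\<gamma> s) $ i) (?h t)) (at t)"
    if "c \<in> A" "t \<in> ball 0 1" "\<gamma> (?h t) \<in> dom_of c" for c t i
  proof -
    have "(((\<lambda>s. coord c (\<gamma> s) $ i) \<circ> ?h) has_field_derivative
        deriv (\<lambda>s. coord c (\<gamma> s) $ i) (?h t) * of_real \<delta>) (at t)"
      by (rule DERIV_chain[where g = ?h and x = t, OF tangent_disc_DERIV[OF \<gamma> that(1) h1[OF that(2)] that(3)]])
         (auto intro!: derivative_eq_intros)
    then show ?thesis by (simp add: o_def mult.commute)
  qed
  show "tangent_disc A F (\<lambda>t. \<gamma> (?h t))"
    unfolding tangent_disc_def
  proof (intro conjI ballI allI)
    show "continuous_on (ball 0 1) (\<lambda>t. \<gamma> (?h t))"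
      by (rule continuous_on_compose2[OF tangent_discD(1)[OF \<gamma>]]) (use h1 in \<open>auto intro!: continuous_intros\<close>)
    show "(\<lambda>t. \<gamma> (?h t)) ` ball 0 1 \<inter> sing A F = {}"
      using tangent_discD(2)[OF \<gamma> h1] by blast
    show "(\<lambda>t. coord c (\<gamma> (?h t)) $ i) holomorphic_on {t \<in> ball 0 1. \<gamma> (?h t) \<in> dom_of c}" if "c \<in> A" for c i
      unfolding holomorphic_on_def field_differentiable_def
      using der[OF that] by (blast intro: has_field_derivative_at_within)
    fix t VZ assume t: "t \<in> ball (0::complex) 1" and VZ: "VZ \<in> F"
    obtain V Z where VZ_eq: "VZ = (V, Z)" by (cases VZ)
    have "\<exists>a. a \<noteq> 0 \<and> (\<forall>i. deriv (\<lambda>s. coord c (\<gamma> (?h s)) $ i) t = a * Z c (\<gamma> (?h t)) $ i)"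
      if c: "c \<in> A" and p: "\<gamma> (?h t) \<in> V \<inter> dom_of c" for c
    proof -
      obtain a where a: "a \<noteq> 0" "\<And>i. deriv (\<lambda>s. coord c (\<gamma> s) $ i) (?h t) = a * Z c (\<gamma> (?h t)) $ i"
        using tangent_discD(4)[OF \<gamma> h1[OF t], of V Z c] VZ VZ_eq c p by blast
      have "deriv (\<lambda>s. coord c (\<gamma> (?h s)) $ i) t = (of_real \<delta> * a) * Z c (\<gamma> (?h t)) $ i" for i
        using DERIV_imp_deriv[OF der[OF c t, of i]] p a(2)[of i] by simp
      then show ?thesis using a(1) \<delta>(1) by (intro exI[of _ "of_real \<delta> * a"]) simp
    qed
    then show "case VZ of (V, Z) \<Rightarrow> \<forall>c\<in>A. \<gamma> (?h t) \<in> V \<inter> dom_of c \<longrightarrow>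
        (\<exists>a. a \<noteq> 0 \<and> (\<forall>i. deriv (\<lambda>s. coord c (\<gamma> (?h s)) $ i) t = a * Z c (\<gamma> (?h t)) $ i))"
      unfolding VZ_eq by blast
  qed
qed

text \<open>By the chain rule the derivative is a nonzero multiple of a component of the Jacobian
  applied to \<open>Z\<close>, and exactly the k-th of these components is nonzero.\<close>

lemma adapted_along_disc:
  assumes \<gamma>: "tangent_disc A F \<gamma>" and \<Psi>: "adapted k U \<Psi>" and t: "t \<in> ball 0 1" "\<gamma> t \<in> U"
  shows "\<exists>d. ((\<lambda>s. \<Psi> (\<gamma> s) $ j) has_field_derivative d) (at t) \<and> (d = 0 \<longleftrightarrow> j \<noteq> k)"
proof -
  obtain c where c: "c \<in> A" "\<gamma> t \<in> dom_of c" by (rule obtain_chart)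
  obtain V Z where VZ: "(V, Z) \<in> F" "\<gamma> t \<in> V" by (rule obtain_vfield)
  obtain a where a: "a \<noteq> 0" "\<And>i. deriv (\<lambda>s. coord c (\<gamma> s) $ i) t = a * Z c (\<gamma> t) $ i"
    using tangent_discD(4)[OF \<gamma> t(1) VZ(1) c(1) VZ(2) c(2)] by blast
  let ?J = "jac (\<lambda>z. \<Psi> (param c z)) (coord c (\<gamma> t))"
  let ?d = "a * (?J *v Z c (\<gamma> t)) $ j"
  have curve: "((\<lambda>s. coord c (\<gamma> s)) has_derivative (\<lambda>h. (h * a) *s Z c (\<gamma> t))) (at t)"
  proof (rule has_derivative_vecI)
    fix i
    have "((\<lambda>s. coord c (\<gamma> s) $ i) has_field_derivative a * Z c (\<gamma> t) $ i) (at t)"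
      using tangent_disc_DERIV[OF \<gamma> c(1) t(1) c(2), of i] by (simp add: a(2))
    then show "((\<lambda>s. coord c (\<gamma> s) $ i) has_derivative (\<lambda>h. ((h * a) *s Z c (\<gamma> t)) $ i)) (at t)"
      unfolding has_field_derivative_def
      by (rule has_derivative_eq_rhs) (simp add: fun_eq_iff mult_ac)
  qed
  have "((\<lambda>z. \<Psi> (param c z)) has_derivative (\<lambda>h. ?J *v h)) (at (coord c (\<gamma> t)))"
    by (rule jac_has_derivative[OF adaptedD(3)[OF \<Psi> c(1)]]) (use c t in blast)
  from has_derivative_compose[OF curve this]
  have "((\<lambda>s. \<Psi> (param c (coord c (\<gamma> s)))) has_derivative (\<lambda>h. ?J *v ((h * a) *s Z c (\<gamma> t)))) (at t)" .
  then have "((\<lambda>s. \<Psi> (param c (coord c (\<gamma> s))) $ j) has_derivative (\<lambda>h. (?J *v ((h * a) *s Z c (\<gamma> t))) $ j)) (at t)"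
    by (rule bounded_linear.has_derivative[OF bounded_linear_vec_nth])
  moreover have "(\<lambda>h. (?J *v ((h * a) *s Z c (\<gamma> t))) $ j) = (*) ?d"
    by (simp add: fun_eq_iff vector_scalar_commute mult_ac)
  ultimately have der: "((\<lambda>s. \<Psi> (param c (coord c (\<gamma> s))) $ j) has_field_derivative ?d) (at t)"
    unfolding has_field_derivative_def by simp
  obtain \<delta> where \<delta>: "0 < \<delta>" "\<gamma> ` ball t \<delta> \<subseteq> dom_of c"
    using tangent_disc_ball_into_open[OF tangent_discD(1)[OF \<gamma>] chart_simps(4)[OF chart[OF c(1)]] t(1) c(2)] by blast
  from der have "((\<lambda>s. \<Psi> (\<gamma> s) $ j) has_field_derivative ?d) (at t)"
  proof (rule has_field_derivative_transform_within_open[where S = "ball t \<delta>"])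
    fix u assume "u \<in> ball t \<delta>"
    then have "\<gamma> u \<in> dom_of c" using \<delta>(2) by blast
    then show "\<Psi> (param c (coord c (\<gamma> u))) $ j = \<Psi> (\<gamma> u) $ j"
      using chart_simps(1)[OF chart[OF c(1)]] by simp
  qed (use \<delta>(1) in auto)
  moreover have "?d = 0 \<longleftrightarrow> j \<noteq> k"
    using a(1) adaptedD(5)[OF \<Psi> c t(2) VZ, of j] adapted_transversal[OF \<Psi> c t(2) VZ] by auto
  ultimately show ?thesis by blast
qed

text \<open>On a small disc the first integrals have derivative 0 and the affine coordinate is not
  constant, so the open mapping theorem applies to it. The open image is what allows two discs
  through a point to be compared.\<close>

lemma adapted_disc_nbhd:
  assumes \<gamma>: "tangent_disc A F \<gamma>" and \<Psi>: "adapted k U \<Psi>" and t0: "t0 \<in> ball 0 1"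
    and N: "open N" "N \<subseteq> U" "\<gamma> t0 \<in> N"
  obtains \<delta> where "0 < \<delta>" "ball t0 \<delta> \<subseteq> ball 0 1" "\<gamma> ` ball t0 \<delta> \<subseteq> N"
    "\<forall>t\<in>ball t0 \<delta>. \<forall>j. j \<noteq> k \<longrightarrow> \<Psi> (\<gamma> t) $ j = \<Psi> (\<gamma> t0) $ j"
    "continuous_on (ball t0 \<delta>) (\<lambda>t. \<Psi> (\<gamma> t) $ k)" "open ((\<lambda>t. \<Psi> (\<gamma> t) $ k) ` ball t0 \<delta>)"
proof -
  obtain \<delta> where \<delta>: "0 < \<delta>" "ball t0 \<delta> \<subseteq> ball 0 1" "\<gamma> ` ball t0 \<delta> \<subseteq> N"
    using tangent_disc_ball_into_open[OF tangent_discD(1)[OF \<gamma>] N(1) t0 N(3)] by blast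
  have der: "\<exists>d. ((\<lambda>s. \<Psi> (\<gamma> s) $ j) has_field_derivative d) (at t) \<and> (d = 0 \<longleftrightarrow> j \<noteq> k)" if "t \<in> ball t0 \<delta>" for t j
    by (rule adapted_along_disc[OF \<gamma> \<Psi>]) (use that \<delta> N in blast)+
  have const: "\<Psi> (\<gamma> t) $ j = \<Psi> (\<gamma> t0) $ j" if t: "t \<in> ball t0 \<delta>" and j: "j \<noteq> k" for t j
  proof -
    have "((\<lambda>s. \<Psi> (\<gamma> s) $ j) has_field_derivative 0) (at u within ball t0 \<delta>)" if "u \<in> ball t0 \<delta>" for u
      using der[OF that, of j] j by (auto intro: has_field_derivative_at_within)
    then obtain C where "\<And>u. u \<in> ball t0 \<delta> \<Longrightarrow> \<Psi> (\<gamma> u) $ j = C"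
      using has_field_derivative_zero_constant[of "ball t0 \<delta>" "\<lambda>s. \<Psi> (\<gamma> s) $ j"] by auto
    then show ?thesis using t \<delta>(1) by simp
  qed
  let ?h = "\<lambda>t. \<Psi> (\<gamma> t) $ k"
  have holo: "?h holomorphic_on ball t0 \<delta>"
    unfolding holomorphic_on_def field_differentiable_def
    using der[of _ k] by (blast intro: has_field_derivative_at_within)
  have "\<not> ?h constant_on ball t0 \<delta>"
  proof
    assume "?h constant_on ball t0 \<delta>"
    then obtain C where C: "\<And>t. t \<in> ball t0 \<delta> \<Longrightarrow> ?h t = C" unfolding constant_on_def by blast
    obtain d where d: "(?h has_field_derivative d) (at t0)" "d \<noteq> 0" using der[of t0 k] \<delta>(1) by auto
    from d(1) have "((\<lambda>t. C) has_field_derivative d) (at t0)"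
      by (rule has_field_derivative_transform_within_open[where S = "ball t0 \<delta>"]) (use \<delta>(1) C in auto)
    then have "d = 0" using DERIV_unique[OF _ DERIV_const] by blast
    with d(2) show False by simp
  qed
  then have "open (?h ` ball t0 \<delta>)"
    by (intro open_mapping_thm[OF holo]) auto
  moreover have "continuous_on (ball t0 \<delta>) ?h" by (rule holomorphic_on_imp_continuous_on[OF holo])
  moreover have "\<forall>t\<in>ball t0 \<delta>. \<forall>j. j \<noteq> k \<longrightarrow> \<Psi> (\<gamma> t) $ j = \<Psi> (\<gamma> t0) $ j" using const by blast
  ultimately show ?thesis using \<delta> by (intro that)
qed

text \<open>\<open>foliated_charts_affine\<close> read in one chart of the atlas: both Jacobian
  determinants equal \<open>s\<close> there, so they agree.\<close>

lemma adapted_pair_affine: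
  assumes \<Psi>: "adapted k U \<Psi>" and \<Psi>': "adapted k' U' \<Psi>'" and x: "x \<in> U" "x \<in> U'"
  obtains N a b where "open N" "x \<in> N" "N \<subseteq> U \<inter> U'" "inj_on \<Psi> N" "a \<noteq> 0"
    "\<forall>y\<in>N. (\<forall>j. j \<noteq> k \<longrightarrow> \<Psi> y $ j = \<Psi> x $ j) \<longrightarrow> \<Psi>' y $ k' = a * \<Psi> y $ k + b"
proof -
  obtain c where c: "c \<in> A" "x \<in> dom_of c" by (rule obtain_chart)
  obtain V Z where VZ: "(V, Z) \<in> F" "x \<in> V" by (rule obtain_vfield)
  note ch = chart_simps[OF chart[OF c(1)]]
  define W where "W = U \<inter> U' \<inter> V"
  have W: "open W" "x \<in> W" "W \<subseteq> U" "W \<subseteq> U'" "W \<subseteq> V"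
    using adaptedD(1)[OF \<Psi>] adaptedD(1)[OF \<Psi>'] vfield(1)[OF VZ(1)] x VZ(2) by (auto simp: W_def)
  let ?D = "coord c ` (dom_of c \<inter> W)"
  have D: "open ?D" by (rule open_chart_image[OF chart[OF c(1)] W(1)])
  have z0: "coord c x \<in> ?D" using c(2) W(2) by blast
  have P: "sv_holomorphic_map_on (\<lambda>z. \<Psi> (param c z)) ?D"
    using adaptedD(3)[OF \<Psi> c(1)] W(3) unfolding sv_holomorphic_map_on_def
    by (blast intro: sv_holomorphic_on_subset)
  have P': "sv_holomorphic_map_on (\<lambda>z. \<Psi>' (param c z)) ?D"
    using adaptedD(3)[OF \<Psi>' c(1)] W(4) unfolding sv_holomorphic_map_on_def
    by (blast intro: sv_holomorphic_on_subset)
  have det: "det (jac (\<lambda>z. \<Psi> (param c z)) z) \<noteq> 0"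
    "det (jac (\<lambda>z. \<Psi>' (param c z)) z) = det (jac (\<lambda>z. \<Psi> (param c z)) z)" if z: "z \<in> ?D" for z
  proof -
    obtain q where q: "z = coord c q" "q \<in> dom_of c" "q \<in> U" "q \<in> U'" using z W(3,4) by blast
    show "det (jac (\<lambda>z. \<Psi> (param c z)) z) \<noteq> 0"
      "det (jac (\<lambda>z. \<Psi>' (param c z)) z) = det (jac (\<lambda>z. \<Psi> (param c z)) z)"
      using adaptedD(4)[OF \<Psi> c(1) q(2,3)] adaptedD(4)[OF \<Psi>' c(1) q(2,4)] s_nz[OF c(1) q(2)]
      by (simp_all add: q(1))
  qed
  have X: "Z c (param c z) \<noteq> 0" if z: "z \<in> ?D" for z
  proof -
    obtain q where q: "z = coord c q" "q \<in> dom_of c" "q \<in> U" "q \<in> V" using z W(3,5) by blast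
    then show ?thesis using sing_iff[OF VZ(1) q(4) c(1) q(2)] adaptedD(2)[OF \<Psi> q(3)] ch(1) by simp
  qed
  have X1: "(jac (\<lambda>z. \<Psi> (param c z)) z *v Z c (param c z)) $ j = 0" if z: "z \<in> ?D" and j: "j \<noteq> k" for z j
  proof -
    obtain q where q: "z = coord c q" "q \<in> dom_of c" "q \<in> U" "q \<in> V" using z W(3,5) by blast
    then show ?thesis using adaptedD(5)[OF \<Psi> c(1) q(2,3) VZ(1) q(4) j] ch(1) by simp
  qed
  have X2: "(jac (\<lambda>z. \<Psi>' (param c z)) z *v Z c (param c z)) $ j = 0" if z: "z \<in> ?D" and j: "j \<noteq> k'" for z j
  proof -
    obtain q where q: "z = coord c q" "q \<in> dom_of c" "q \<in> U'" "q \<in> V" using z W(4,5) by blast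
    then show ?thesis using adaptedD(5)[OF \<Psi>' c(1) q(2,3) VZ(1) q(4) j] ch(1) by simp
  qed
  obtain N a b where N: "open N" "coord c x \<in> N" "N \<subseteq> ?D" "inj_on (\<lambda>z. \<Psi> (param c z)) N" "a \<noteq> 0"
    "\<And>z. z \<in> N \<Longrightarrow> (\<And>j. j \<noteq> k \<Longrightarrow> \<Psi> (param c z) $ j = \<Psi> (param c (coord c x)) $ j) \<Longrightarrow>
      \<Psi>' (param c z) $ k' = a * \<Psi> (param c z) $ k + b"
    using foliated_charts_affine[where P = "\<lambda>z. \<Psi> (param c z)" and P' = "\<lambda>z. \<Psi>' (param c z)" and
        X = "\<lambda>z. Z c (param c z)" and k = k and k' = k', OF D z0 P P' det X X1 X2] by blast
  define M where "M = dom_of c \<inter> coord c -` N"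
  have MW: "M \<subseteq> W"
  proof
    fix q assume q: "q \<in> M"
    then obtain q' where "q' \<in> dom_of c" "q' \<in> W" "coord c q = coord c q'" using N(3) by (auto simp: M_def)
    then show "q \<in> W" using ch(1) q by (metis IntD1 M_def)
  qed
  have "open M" unfolding M_def by (rule open_chart_preimage[OF chart[OF c(1)] N(1)])
  moreover have "x \<in> M" using c(2) N(2) by (simp add: M_def)
  moreover have "M \<subseteq> U \<inter> U'" using MW W by blast
  moreover have "inj_on \<Psi> M"
  proof (rule inj_onI)
    fix p q assume pq: "p \<in> M" "q \<in> M" "\<Psi> p = \<Psi> q"
    then have "\<Psi> (param c (coord c p)) = \<Psi> (param c (coord c q))" by (simp add: M_def ch(1))
    then have "coord c p = coord c q" using inj_onD[OF N(4)] pq by (simp add: M_def)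
    then show "p = q" using ch(1) pq by (metis IntD1 M_def)
  qed
  moreover have "\<Psi>' y $ k' = a * \<Psi> y $ k + b" if "y \<in> M" "\<forall>j. j \<noteq> k \<longrightarrow> \<Psi> y $ j = \<Psi> x $ j" for y
    using N(6)[of "coord c y"] that c(2) by (simp add: M_def ch(1))
  then have "\<forall>y\<in>M. (\<forall>j. j \<noteq> k \<longrightarrow> \<Psi> y $ j = \<Psi> x $ j) \<longrightarrow> \<Psi>' y $ k' = a * \<Psi> y $ k + b" by blast
  ultimately show ?thesis using N(5) by (intro that)
qed

text \<open>Says that tangent discs are continuous into the leaf topology. The essential case is a
  plaque: near a common point both discs lie in the same level set of the first integrals, where a
  point is determined by its affine coordinate, and the plaque attains an open set of values of
  it.\<close>

lemma leaf_open_contains_disc: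
  assumes "openin (leaf_topology A F) Q" "tangent_disc A F \<gamma>" "t0 \<in> ball 0 1" "\<gamma> t0 \<in> Q"
  shows "\<exists>\<delta>>0. ball t0 \<delta> \<subseteq> ball 0 1 \<and> \<gamma> ` ball t0 \<delta> \<subseteq> Q"
proof -
  have "generate_topology_on {\<gamma> ` ball 0 1 | \<gamma>. tangent_disc A F \<gamma> \<and> inj_on \<gamma> (ball 0 1)} Q"
    using assms(1) unfolding leaf_topology_def openin_topology_generated_by_iff .
  then show ?thesis using assms(4)
  proof (induction Q rule: generate_topology_on.induct)
    case (Int a b)
    obtain \<delta>1 where 1: "0 < \<delta>1" "ball t0 \<delta>1 \<subseteq> ball 0 1" "\<gamma> ` ball t0 \<delta>1 \<subseteq> a" using Int by auto
    obtain \<delta>2 where 2: "0 < \<delta>2" "\<gamma> ` ball t0 \<delta>2 \<subseteq> b" using Int by auto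
    have "ball t0 (min \<delta>1 \<delta>2) \<subseteq> ball t0 \<delta>1" "ball t0 (min \<delta>1 \<delta>2) \<subseteq> ball t0 \<delta>2" by auto
    then show ?case using 1 2 by (intro exI[of _ "min \<delta>1 \<delta>2"]) (auto simp: subset_iff)
  next
    case (UN K)
    then obtain k where "k \<in> K" "\<gamma> t0 \<in> k" by blast
    with UN.IH[of k] show ?case by blast
  next
    case (Basis B)
    then obtain \<gamma>' where \<gamma>': "B = \<gamma>' ` ball 0 1" "tangent_disc A F \<gamma>'" by blast
    then obtain t1 where t1: "t1 \<in> ball 0 1" "\<gamma> t0 = \<gamma>' t1" using Basis.prems by auto
    let ?x = "\<gamma> t0"
    obtain k U \<Psi> where \<Psi>: "?x \<in> U" "adapted k U \<Psi>"
      using adapted_exists[OF tangent_discD(2)[OF assms(2,3)]] by blast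
    \<comment> \<open>The chart is compared with itself, just to get a neighbourhood on which it is
      injective.\<close>
    obtain N where N: "open N" "?x \<in> N" "N \<subseteq> U" "inj_on \<Psi> N"
      by (rule adapted_pair_affine[OF \<Psi>(2,2,1,1)]) (simp add: that)
    have "\<gamma>' t1 \<in> N" using N(2) t1(2) by simp
    then obtain \<delta>' where \<delta>': "0 < \<delta>'" "ball t1 \<delta>' \<subseteq> ball 0 1" "\<gamma>' ` ball t1 \<delta>' \<subseteq> N"
      "\<forall>t\<in>ball t1 \<delta>'. \<forall>j. j \<noteq> k \<longrightarrow> \<Psi> (\<gamma>' t) $ j = \<Psi> (\<gamma>' t1) $ j"
      "continuous_on (ball t1 \<delta>') (\<lambda>t. \<Psi> (\<gamma>' t) $ k)" "open ((\<lambda>t. \<Psi> (\<gamma>' t) $ k) ` ball t1 \<delta>')"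
      by (rule adapted_disc_nbhd[OF \<gamma>'(2) \<Psi>(2) t1(1) N(1,3)])
    obtain \<delta> where \<delta>: "0 < \<delta>" "ball t0 \<delta> \<subseteq> ball 0 1" "\<gamma> ` ball t0 \<delta> \<subseteq> N"
      "\<forall>t\<in>ball t0 \<delta>. \<forall>j. j \<noteq> k \<longrightarrow> \<Psi> (\<gamma> t) $ j = \<Psi> (\<gamma> t0) $ j"
      "continuous_on (ball t0 \<delta>) (\<lambda>t. \<Psi> (\<gamma> t) $ k)" "open ((\<lambda>t. \<Psi> (\<gamma> t) $ k) ` ball t0 \<delta>)"
      by (rule adapted_disc_nbhd[OF assms(2) \<Psi>(2) assms(3) N(1,3,2)])
    \<comment> \<open>Parameters whose affine coordinate is also attained on the other disc.\<close>
    let ?S = "ball t0 \<delta> \<inter> (\<lambda>t. \<Psi> (\<gamma> t) $ k) -` ((\<lambda>t. \<Psi> (\<gamma>' t) $ k) ` ball t1 \<delta>')"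
    have "open ?S" using \<delta>(5) \<delta>'(6) by (intro continuous_open_preimage) auto
    moreover have "t0 \<in> ?S" using \<delta>(1) \<delta>'(1) t1(2) by (auto intro!: image_eqI[of _ _ t1])
    ultimately obtain \<epsilon> where \<epsilon>: "0 < \<epsilon>" "ball t0 \<epsilon> \<subseteq> ?S" using openE by blast
    have "\<gamma> t \<in> B" if t: "t \<in> ball t0 \<epsilon>" for t
    proof -
      have t\<delta>: "t \<in> ball t0 \<delta>" using t \<epsilon> by blast
      obtain t' where t': "t' \<in> ball t1 \<delta>'" "\<Psi> (\<gamma> t) $ k = \<Psi> (\<gamma>' t') $ k" using t \<epsilon> by blast
      have "\<Psi> (\<gamma> t) $ j = \<Psi> (\<gamma>' t') $ j" for j
        using bspec[OF \<delta>(4) t\<delta>, rule_format, of j] bspec[OF \<delta>'(4) t'(1), rule_format, of j] t'(2) t1(2) by (cases "j = k") auto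
      then have "\<Psi> (\<gamma> t) = \<Psi> (\<gamma>' t')" by (simp add: vec_eq_iff)
      moreover have "\<gamma> t \<in> N" "\<gamma>' t' \<in> N" using \<delta>(3) \<delta>'(3) t\<delta> t'(1) by blast+
      ultimately have "\<gamma> t = \<gamma>' t'" using inj_onD[OF N(4)] by blast
      then show ?thesis using \<gamma>'(1) t'(1) \<delta>'(2) by blast
    qed
    then show ?case using \<epsilon> \<delta>(2) by (intro exI[of _ \<epsilon>]) auto
  qed auto
qed

lemma leaf_point_on_disc:
  assumes "openin (leaf_topology A F) Q" "x \<in> Q"
  obtains \<gamma> t0 where "tangent_disc A F \<gamma>" "inj_on \<gamma> (ball 0 1)" "t0 \<in> ball 0 1" "x = \<gamma> t0"
proof -
  have "x \<in> topspace (leaf_topology A F)" using assms openin_subset by blast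
  then obtain B where "x \<in> B" "B \<in> {\<gamma> ` ball 0 1 | \<gamma>. tangent_disc A F \<gamma> \<and> inj_on \<gamma> (ball 0 1)}"
    unfolding leaf_topology_def topology_generated_by_topspace by (rule UnionE)
  then obtain \<gamma> where \<gamma>: "B = \<gamma> ` ball 0 1" "tangent_disc A F \<gamma>" "inj_on \<gamma> (ball 0 1)" by blast
  then obtain t0 where "t0 \<in> ball 0 1" "x = \<gamma> t0" using \<open>x \<in> B\<close> by (auto simp del: mem_ball)
  with \<gamma> show ?thesis by (intro that)
qed

lemma openin_leaf_disc:
  assumes "tangent_disc A F \<gamma>" "inj_on \<gamma> (ball 0 1)" "0 < \<delta>" "ball t0 \<delta> \<subseteq> ball 0 1"
  shows "openin (leaf_topology A F) (\<gamma> ` ball t0 \<delta>)"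
  unfolding leaf_topology_def tangent_disc_rescale(2)[OF assms(1,3,4), symmetric]
  by (rule topology_generated_by_Basis)
     (use tangent_disc_rescale(1,3)[OF assms(1,3,4)] assms(2) in blast)

text \<open>Every point of \<open>W\<close> has a leafwise neighbourhood with an affine expression.
  The regions belonging to different coefficients are open and disjoint, so by connectedness there
  is only one.\<close>

theorem adapted_affine_on_leaf_open:
  assumes \<Psi>: "adapted k U \<Psi>" and \<Psi>': "adapted k' U' \<Psi>'"
    and W: "openin (leaf_topology A F) W" "connectedin (leaf_topology A F) W" "W \<subseteq> U \<inter> U'"
    and inj: "inj_on (\<lambda>p. \<Psi> p $ k) W"
  shows "\<exists>a b. a \<noteq> 0 \<and> (\<forall>x\<in>W. \<Psi>' x $ k' = a * \<Psi> x $ k + b)"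
proof (cases "W = {}")
  case True
  then show ?thesis by (intro exI[of _ 1]) auto
next
  case False
  let ?T = "leaf_topology A F"
  define S where "S ab = \<Union>{Q. openin ?T Q \<and> Q \<subseteq> W \<and> (\<forall>y\<in>Q. \<Psi>' y $ k' = fst ab * \<Psi> y $ k + snd ab)}" for ab
  have openS: "openin ?T (S ab)" for ab unfolding S_def by (rule openin_Union) blast
  have cover: "\<exists>a b. a \<noteq> 0 \<and> x \<in> S (a, b)" if x: "x \<in> W" for x
  proof -
    obtain \<gamma> t0 where \<gamma>: "tangent_disc A F \<gamma>" "inj_on \<gamma> (ball 0 1)" "t0 \<in> ball 0 1" "x = \<gamma> t0"
      by (rule leaf_point_on_disc[OF W(1) x])
    have xU: "x \<in> U" "x \<in> U'" using x W(3) by auto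
    obtain N a b where N: "open N" "x \<in> N" "N \<subseteq> U \<inter> U'" "inj_on \<Psi> N" "a \<noteq> 0"
      "\<forall>y\<in>N. (\<forall>j. j \<noteq> k \<longrightarrow> \<Psi> y $ j = \<Psi> x $ j) \<longrightarrow> \<Psi>' y $ k' = a * \<Psi> y $ k + b"
      by (rule adapted_pair_affine[OF \<Psi> \<Psi>' xU])
    have NU: "N \<subseteq> U" "\<gamma> t0 \<in> N" using N \<gamma>(4) by auto
    obtain \<delta>1 where 1: "0 < \<delta>1" "ball t0 \<delta>1 \<subseteq> ball 0 1" "\<gamma> ` ball t0 \<delta>1 \<subseteq> N"
      "\<forall>t\<in>ball t0 \<delta>1. \<forall>j. j \<noteq> k \<longrightarrow> \<Psi> (\<gamma> t) $ j = \<Psi> (\<gamma> t0) $ j"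
      "continuous_on (ball t0 \<delta>1) (\<lambda>t. \<Psi> (\<gamma> t) $ k)" "open ((\<lambda>t. \<Psi> (\<gamma> t) $ k) ` ball t0 \<delta>1)"
      by (rule adapted_disc_nbhd[OF \<gamma>(1) \<Psi> \<gamma>(3) N(1) NU])
    obtain \<delta>2 where 2: "0 < \<delta>2" "\<gamma> ` ball t0 \<delta>2 \<subseteq> W"
      using leaf_open_contains_disc[OF W(1) \<gamma>(1,3)] x \<gamma>(4) by blast
    define \<delta> where "\<delta> = min \<delta>1 \<delta>2"
    have \<delta>: "0 < \<delta>" "ball t0 \<delta> \<subseteq> ball t0 \<delta>1" "ball t0 \<delta> \<subseteq> ball t0 \<delta>2" using 1 2 by (auto simp: \<delta>_def)
    have "openin ?T (\<gamma> ` ball t0 \<delta>)" using \<gamma>(1,2) \<delta>(1)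
      by (rule openin_leaf_disc) (use \<delta>(2) 1(2) in blast)
    moreover have "\<gamma> ` ball t0 \<delta> \<subseteq> W" using \<delta>(3) 2(2) by blast
    moreover have "\<Psi>' y $ k' = a * \<Psi> y $ k + b" if "y \<in> \<gamma> ` ball t0 \<delta>" for y
      using that \<delta>(2) 1(3,4) \<gamma>(4) by (intro N(6)[rule_format]) auto
    moreover have "x \<in> \<gamma> ` ball t0 \<delta>" using \<gamma>(4) \<delta>(1) by simp
    ultimately have "x \<in> S (a, b)" unfolding S_def by auto
    then show ?thesis using N(5) by blast
  qed
  \<comment> \<open>A leafwise open set has no isolated points. A second point of it gives, by
    injectivity on \<open>W\<close>, a second value of the coordinate, and two values determine an
    affine map.\<close>
  have disjoint: "ab = cd" if x: "x \<in> S ab" "x \<in> S cd" for x ab cd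
  proof -
    obtain O1 where O1: "openin ?T O1" "O1 \<subseteq> W" "x \<in> O1" "\<And>y. y \<in> O1 \<Longrightarrow> \<Psi>' y $ k' = fst ab * \<Psi> y $ k + snd ab"
      using x(1) unfolding S_def by blast
    obtain O2 where O2: "openin ?T O2" "x \<in> O2" "\<And>y. y \<in> O2 \<Longrightarrow> \<Psi>' y $ k' = fst cd * \<Psi> y $ k + snd cd"
      using x(2) unfolding S_def by blast
    obtain \<gamma> t0 where \<gamma>: "tangent_disc A F \<gamma>" "inj_on \<gamma> (ball 0 1)" "t0 \<in> ball 0 1" "x = \<gamma> t0"
      by (rule leaf_point_on_disc[OF O1(1,3)])
    have "openin ?T (O1 \<inter> O2)" "\<gamma> t0 \<in> O1 \<inter> O2" using O1 O2 \<gamma>(4) by auto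
    then obtain \<delta> where \<delta>: "0 < \<delta>" "ball t0 \<delta> \<subseteq> ball 0 1" "\<gamma> ` ball t0 \<delta> \<subseteq> O1 \<inter> O2"
      using leaf_open_contains_disc[OF _ \<gamma>(1,3)] by blast
    define t1 where "t1 = t0 + of_real (\<delta> / 2)"
    have t1: "t1 \<in> ball t0 \<delta>" "t1 \<noteq> t0" using \<delta>(1) by (auto simp: t1_def dist_norm)
    define y where "y = \<gamma> t1"
    have y: "y \<in> O1" "y \<in> O2" using \<delta>(3) t1(1) by (auto simp: y_def)
    have "y \<noteq> x" using inj_onD[OF \<gamma>(2), of t1 t0] t1 \<delta>(2) \<gamma>(3,4) by (auto simp: y_def)
    then have ne: "\<Psi> y $ k \<noteq> \<Psi> x $ k" using inj_onD[OF inj, of y x] y O1(2,3) by blast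
    have "(fst ab - fst cd) * (\<Psi> y $ k - \<Psi> x $ k) =
        (fst ab * \<Psi> y $ k + snd ab) - (fst cd * \<Psi> y $ k + snd cd) -
        ((fst ab * \<Psi> x $ k + snd ab) - (fst cd * \<Psi> x $ k + snd cd))"
      by (simp add: algebra_simps)
    also have "\<dots> = 0"
      using O1(4)[OF y(1)] O1(4)[OF O1(3)] O2(3)[OF y(2)] O2(3)[OF O2(2)] by simp
    finally have "(fst ab - fst cd) * (\<Psi> y $ k - \<Psi> x $ k) = 0" .
    then have "fst ab = fst cd" using ne by simp
    moreover have "snd ab = snd cd" using O1(4)[OF O1(3)] O2(3)[OF O2(2)] calculation by simp
    ultimately show ?thesis by (rule prod_eqI)
  qed
  obtain x0 where x0: "x0 \<in> W" using False by blast
  obtain a b where ab: "a \<noteq> 0" "x0 \<in> S (a, b)" using cover[OF x0] by blast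
  define R where "R = (\<Union>cd\<in>- {(a, b)}. S cd)"
  have "openin ?T R" unfolding R_def by (rule openin_Union) (use openS in auto)
  moreover have WR: "W \<subseteq> S (a, b) \<union> R"
  proof
    fix x assume "x \<in> W"
    then obtain c d where "x \<in> S (c, d)" using cover by blast
    then show "x \<in> S (a, b) \<union> R" unfolding R_def by (cases "(c, d) = (a, b)") auto
  qed
  moreover have "S (a, b) \<inter> R \<inter> W = {}"
  proof -
    have False if x: "x \<in> S (a, b)" "x \<in> R" for x
    proof -
      obtain cd where "cd \<noteq> (a, b)" "x \<in> S cd" using x(2) unfolding R_def by auto
      with disjoint[OF x(1)] show False by auto
    qed
    then show ?thesis by auto
  qed
  moreover have "S (a, b) \<inter> W \<noteq> {}" using ab(2) x0 by auto
  ultimately have "R \<inter> W = {}" using W(2) openS[of "(a, b)"] unfolding connectedin by metis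
  then have "W \<subseteq> S (a, b)" using WR by auto
  then have "\<Psi>' x $ k' = a * \<Psi> x $ k + b" if "x \<in> W" for x
    using that unfolding S_def by auto
  with ab(1) show ?thesis by blast
qed

theorem foliated_affine_structure_exists: "\<exists>\<Phi>. foliated_affine_structure A F \<Phi>"
proof
  \<comment> \<open>All adapted charts are taken at once: any two of them change affinely, so no
    choice of a cover is made.\<close>
  let ?\<Phi> = "{(U, \<lambda>p. \<Psi> p $ k) | U \<Psi> k. adapted k U \<Psi>}"
  show "foliated_affine_structure A F ?\<Phi>"
    unfolding foliated_affine_structure_def
  proof (intro conjI ballI)
    show "(\<Union>(U, \<phi>)\<in>?\<Phi>. U) = - sing A F"
      using adapted_exists adaptedD(2) by (fastforce simp: set_eq_iff)
    show "case x of (U, \<phi>) \<Rightarrow> open U \<and> holo_submersion_on A U \<phi> \<and> transverse_on A F U \<phi>" if "x \<in> ?\<Phi>" for x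
      using that adaptedD(1) adapted_submersion by auto
    fix L c d assume "c \<in> ?\<Phi>" "d \<in> ?\<Phi>"
    \<comment> \<open>The second chart \<open>d\<close> is the one that is inverted, so it takes the
      role of the injective \<open>\<Psi>\<close>.\<close>
    then obtain U \<Psi> k V \<Psi>' k' where c: "c = (V, \<lambda>p. \<Psi>' p $ k')" "adapted k' V \<Psi>'"
      and d: "d = (U, \<lambda>p. \<Psi> p $ k)" "adapted k U \<Psi>" by blast
    show "affine_change_on A F L c d"
      unfolding affine_change_on_def c(1) d(1) prod.case
    proof (intro allI impI, elim conjE)
      fix W assume W: "openin (leaf_topology A F) W" "connectedin (leaf_topology A F) W"
        "W \<subseteq> L \<inter> V \<inter> U" and inj: "inj_on (\<lambda>p. \<Psi> p $ k) W"
      have "W \<subseteq> U \<inter> V" using W(3) by blast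
      from adapted_affine_on_leaf_open[OF d(2) c(2) W(1,2) this inj]
      obtain a b where ab: "a \<noteq> 0" "\<And>x. x \<in> W \<Longrightarrow> \<Psi>' x $ k' = a * \<Psi> x $ k + b" by blast
      have "((\<lambda>p. \<Psi>' p $ k') \<circ> inv_into W (\<lambda>p. \<Psi> p $ k)) z = a * z + b" if z: "z \<in> (\<lambda>p. \<Psi> p $ k) ` W" for z
        using ab(2)[OF inv_into_into[OF z]] f_inv_into_f[OF z] by simp
      then show "\<exists>a b. a \<noteq> 0 \<and> (\<forall>z\<in>(\<lambda>p. \<Psi> p $ k) ` W.
          ((\<lambda>p. \<Psi>' p $ k') \<circ> inv_into W (\<lambda>p. \<Psi> p $ k)) z = a * z + b)"
        using ab(1) by blast
    qed
  qed
qed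

end

theorem corollary2p10:
  fixes A :: "('m::t2_space, 'n::finite) chart set"
    and F :: "('m, 'n) foliation_data"
  assumes "calabi_yau A"
    and "foliation A F"
  shows "\<exists>\<Phi>. foliated_affine_structure A F \<Phi>"
proof -
  obtain s where "holo_line_bundle_section A canonical_cocycle s" "\<forall>c\<in>A. \<forall>p\<in>dom_of c. s c p \<noteq> 0"
    using assms(1) unfolding calabi_yau_def trivial_line_bundle_def by blast
  with assms interpret trivialized_foliation A F s
    by unfold_locales (auto simp: calabi_yau_def)
  show ?thesis by (rule foliated_affine_structure_exists)
qed

end
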